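(* Let $m\ge 0$, $1<p<\infty$, $\omega\in A_p(\mathbb{R}^n)$, let $\mathscr{T}$ be a mesh of $\Omega$ from the shape regular family $\mathbb{T}$ and let $z$ be an interior node of $\mathscr{T}$. If $v\in W^{m+1}_p(\omega,S_z)$, then $$|v-Q^m_z v|_{W^k_p(\omega,S_z)}\le C\,h_z^{m+1-k}\,|v|_{W^{m+1}_p(\omega,S_z)},\qquad k=0,1,\dots,m+1,$$ where the constant $C$ depends only on $C_{p,\omega}$, $\sigma$, $\psi$ and $m$ (and on the fixed $n$, $p$).
   Context: $\Omega\subset\mathbb{R}^n$, $n\ge1$, is open, bounded, connected, with polyhedral Lipschitz boundary. A weight is $\omega\in L^1_{\rm loc}(\mathbb{R}^n)$ with $\omega>0$ a.e. For $1<p<\infty$, $\omega\in A_p(\mathbb{R}^n)$ means $C_{p,\omega}=\sup_B\big(\frac1{|B|}\int_B\omega\big)\big(\frac1{|B|}\int_B\omega^{1/(1-p)}\big)^{p-1}<\infty$, the supremum being over all balls $B$. $\|u\|_{L^p(\omega,D)}=(\int_D|u|^p\omega)^{1/p}$; $W^k_p(\omega,D)$ is the set of $u\in L^p(\omega,D)$ with weak derivatives $D^\kappa u\in L^p(\omega,D)$ for $|\kappa|\le k$, and $|u|_{W^k_p(\omega,D)}=(\sum_{|\kappa|=k}\|D^\kappa u\|^p_{L^p(\omega,D)})^{1/p}$. Meshes: $\mathbb{T}$ is a family of conforming meshes $\mathscr{T}=\{T\}$ of $\Omega$ into (closed) simplices or $n$-rectangles, shape regular: $h_T/\rho_T\le\sigma$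 for all $T\in\mathscr{T}\in\mathbb{T}$, with a fixed $\sigma>1$, $h_T=\mathrm{diam}\,T$, $\rho_T$ the diameter of the largest ball contained in $T$. Nodes are the Lagrange nodes of the degree $m$ elements (the vertices if $m\in\{0,1\}$); a node is interior if it does not lie on $\partial\Omega$. For a node $z$, $S_z=\bigcup_{T\ni z}T$ and $h_z=\min\{h_T: z\in T\}$. Averaged Taylor polynomial: $\psi\in C^\infty(\mathbb{R}^n)$ is fixed with $\int\psi=1$ and $\mathrm{supp}\,\psi$ contained in the ball of radius $r=r(\sigma)$ centered at $0$, and $\psi_z(x)=\frac{(m+1)^n}{h_z^n}\psi\big(\frac{(m+1)(z-x)}{h_z}\big)$, where $r$ is chosen so small that $\mathrm{supp}\,\psi_z\subset S_z$ for every interior node $z$ of every mesh of the family. With $P^m v(x,y)=\sum_{|\alpha|\le m}\frac1{\alpha!}D^\alpha v(x)(y-x)^\alpha$, set $Q^m_zv(y)=\int P^mv(x,y)\psi_z(x)\,dx$.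
   Formalization: For n = 1 shape regularity also requires h_T ≤ σ h_T' for touching elements T, T' of a mesh; without this the claim fails in dimension one, where h_T/ρ_T is always 1 (m = 0, ω = 1, v(x) = x, two intervals of very different lengths). *)

theory Defs
  imports "HOL-Analysis.Analysis"
begin

section \<open>Multi-indices and classical derivatives\<close>

type_synonym 'n multi_index = "'n \<Rightarrow> nat"

definition mi_order :: "'n::finite multi_index \<Rightarrow> nat" where
  "mi_order \<alpha> = (\<Sum>i\<in>UNIV. \<alpha> i)"

definition mi_fact :: "'n::finite multi_index \<Rightarrow> real" where
  "mi_fact \<alpha> = (\<Prod>i\<in>UNIV. fact (\<alpha> i))"

definition mi_power :: "real ^ 'n::finite \<Rightarrow> 'n multi_index \<Rightarrow> real" where
  "mi_power y \<alpha> = (\<Prod>i\<in>UNIV. (y $ i) ^ \<alpha> i)"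

definition partial :: "'n::finite \<Rightarrow> (real ^ 'n \<Rightarrow> real) \<Rightarrow> real ^ 'n \<Rightarrow> real" where
  "partial i f x = frechet_derivative f (at x) (axis i 1)"

definition iterated_partial :: "'n::finite list \<Rightarrow> (real ^ 'n \<Rightarrow> real) \<Rightarrow> real ^ 'n \<Rightarrow> real" where
  "iterated_partial js f = foldr partial js f"

text \<open>Differentiability of all iterated partial derivatives makes all of them continuous,
  so this is membership in the class of infinitely differentiable functions.\<close>

definition smooth :: "(real ^ 'n::finite \<Rightarrow> real) \<Rightarrow> bool" where
  "smooth f \<longleftrightarrow> (\<forall>js x. iterated_partial js f differentiable (at x))"

text \<open>The index type carries no order, so a list that realises a multi-index is chosen;
  the order of differentiation is irrelevant for the smooth functions this is applied to.\<close>

definition index_list :: "'n::finite multi_index \<Rightarrow> 'n list" where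
  "index_list \<alpha> = (SOME js. \<forall>i. count_list js i = \<alpha> i)"

lemma count_index_list:
  fixes \<alpha> :: "'n::finite multi_index"
  shows "count_list (index_list \<alpha>) i = \<alpha> i"
proof -
  obtain js where "mset js = Abs_multiset \<alpha>"
    using ex_mset by blast
  then have "\<forall>i. count_list js i = \<alpha> i"
    by (metis count_Abs_multiset count_mset finite)
  then show ?thesis
    unfolding index_list_def by (rule someI2) blast
qed

definition classical_deriv ::
  "'n::finite multi_index \<Rightarrow> (real ^ 'n \<Rightarrow> real) \<Rightarrow> real ^ 'n \<Rightarrow> real" where
  "classical_deriv \<alpha> f = iterated_partial (index_list \<alpha>) f"

definition supp :: "(real ^ 'n::finite \<Rightarrow> real) \<Rightarrow> (real ^ 'n) set" where
  "supp f = closure {x. f x \<noteq> 0}"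

section \<open>Weights and weighted Sobolev spaces\<close>

definition locally_integrable_on :: "(real ^ 'n::finite \<Rightarrow> real) \<Rightarrow> (real ^ 'n) set \<Rightarrow> bool" where
  "locally_integrable_on f D \<longleftrightarrow> (\<forall>K. compact K \<and> K \<subseteq> D \<longrightarrow> f absolutely_integrable_on K)"

definition weight :: "(real ^ 'n::finite \<Rightarrow> real) \<Rightarrow> bool" where
  "weight \<omega> \<longleftrightarrow> locally_integrable_on \<omega> UNIV \<and> (AE x in lebesgue. \<omega> x > 0)"

definition Ap_quotient :: "real \<Rightarrow> (real ^ 'n::finite \<Rightarrow> real) \<Rightarrow> (real ^ 'n) set \<Rightarrow> real" where
  "Ap_quotient p \<omega> B =
     ((LINT x:B|lebesgue. \<omega> x) / measure lebesgue B) *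
     ((LINT x:B|lebesgue. \<omega> x powr (1 / (1 - p))) / measure lebesgue B) powr (p - 1)"

definition Ap_const :: "real \<Rightarrow> (real ^ 'n::finite \<Rightarrow> real) \<Rightarrow> real" where
  "Ap_const p \<omega> = Sup {Ap_quotient p \<omega> (ball x s) |x s. s > 0}"

text \<open>Finiteness of the supremum has two parts here: the Lebesgue integral of a non-integrable
  function is 0 by convention, so integrability of the dual weight on balls is required
  separately.\<close>

definition Ap_weight :: "real \<Rightarrow> (real ^ 'n::finite \<Rightarrow> real) \<Rightarrow> bool" where
  "Ap_weight p \<omega> \<longleftrightarrow> weight \<omega> \<and>
     (\<forall>x s. s > 0 \<longrightarrow> (\<lambda>y. \<omega> y powr (1 / (1 - p))) absolutely_integrable_on ball x s) \<and>
     bdd_above {Ap_quotient p \<omega> (ball x s) |x s. s > 0}"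

definition weighted_Lp ::
  "real \<Rightarrow> (real ^ 'n::finite \<Rightarrow> real) \<Rightarrow> (real ^ 'n) set \<Rightarrow> (real ^ 'n \<Rightarrow> real) set" where
  "weighted_Lp p \<omega> D = {u. set_borel_measurable lebesgue D u \<and>
     (\<lambda>x. \<bar>u x\<bar> powr p * \<omega> x) absolutely_integrable_on D}"

definition weighted_Lp_norm ::
  "real \<Rightarrow> (real ^ 'n::finite \<Rightarrow> real) \<Rightarrow> (real ^ 'n) set \<Rightarrow> (real ^ 'n \<Rightarrow> real) \<Rightarrow> real" where
  "weighted_Lp_norm p \<omega> D u = (LINT x:D|lebesgue. \<bar>u x\<bar> powr p * \<omega> x) powr (1 / p)"

definition test_function :: "(real ^ 'n::finite) set \<Rightarrow> (real ^ 'n \<Rightarrow> real) \<Rightarrow> bool" where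
  "test_function D \<phi> \<longleftrightarrow> smooth \<phi> \<and> compact (supp \<phi>) \<and> supp \<phi> \<subseteq> D"

text \<open>The sets \<open>D\<close> below are meant to be open.\<close>

definition has_weak_deriv :: "(real ^ 'n::finite) set \<Rightarrow> 'n multi_index \<Rightarrow>
    (real ^ 'n \<Rightarrow> real) \<Rightarrow> (real ^ 'n \<Rightarrow> real) \<Rightarrow> bool" where
  "has_weak_deriv D \<kappa> u g \<longleftrightarrow> locally_integrable_on u D \<and> locally_integrable_on g D \<and>
     (\<forall>\<phi>. test_function D \<phi> \<longrightarrow>
        (LINT x:D|lebesgue. u x * classical_deriv \<kappa> \<phi> x) =
        (- 1) ^ mi_order \<kappa> * (LINT x:D|lebesgue. g x * \<phi> x))"

text \<open>A representative; it is determined almost everywhere on \<open>D\<close> and arbitrary outside of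
  \<open>D\<close>, so it must only be integrated over subsets of \<open>D\<close>.\<close>

definition weak_deriv :: "(real ^ 'n::finite) set \<Rightarrow> 'n multi_index \<Rightarrow>
    (real ^ 'n \<Rightarrow> real) \<Rightarrow> real ^ 'n \<Rightarrow> real" where
  "weak_deriv D \<kappa> u = (SOME g. has_weak_deriv D \<kappa> u g)"

definition weighted_sobolev ::
  "nat \<Rightarrow> real \<Rightarrow> (real ^ 'n::finite \<Rightarrow> real) \<Rightarrow> (real ^ 'n) set \<Rightarrow> (real ^ 'n \<Rightarrow> real) set" where
  "weighted_sobolev k p \<omega> D = {u \<in> weighted_Lp p \<omega> D.
     \<forall>\<kappa>. mi_order \<kappa> \<le> k \<longrightarrow> (\<exists>g \<in> weighted_Lp p \<omega> D. has_weak_deriv D \<kappa> u g)}"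

definition weighted_seminorm ::
  "nat \<Rightarrow> real \<Rightarrow> (real ^ 'n::finite \<Rightarrow> real) \<Rightarrow> (real ^ 'n) set \<Rightarrow> (real ^ 'n \<Rightarrow> real) \<Rightarrow> real" where
  "weighted_seminorm k p \<omega> D u =
     (\<Sum>\<kappa> | mi_order \<kappa> = k. weighted_Lp_norm p \<omega> D (weak_deriv D \<kappa> u) powr p) powr (1 / p)"

section \<open>Domains and meshes\<close>

definition lipschitz_boundary :: "(real ^ 'n::finite) set \<Rightarrow> bool" where
  "lipschitz_boundary \<Omega> \<longleftrightarrow>
     (\<forall>x \<in> frontier \<Omega>. \<exists>e \<delta> L g. norm e = 1 \<and> \<delta> > 0 \<and> L-lipschitz_on {y. y \<bullet> e = 0} g \<and>
        \<Omega> \<inter> ball x \<delta> = {y \<in> ball x \<delta>. y \<bullet> e > g (y - (y \<bullet> e) *\<^sub>R e)})"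

definition polyhedral_boundary :: "(real ^ 'n::finite) set \<Rightarrow> bool" where
  "polyhedral_boundary \<Omega> \<longleftrightarrow> (\<exists>P. finite P \<and> (\<forall>F\<in>P. polytope F) \<and> frontier \<Omega> = \<Union>P)"

definition polyhedral_lipschitz_domain :: "(real ^ 'n::finite) set \<Rightarrow> bool" where
  "polyhedral_lipschitz_domain \<Omega> \<longleftrightarrow> open \<Omega> \<and> bounded \<Omega> \<and> connected \<Omega> \<and>
     polyhedral_boundary \<Omega> \<and> lipschitz_boundary \<Omega>"

definition n_rectangle :: "(real ^ 'n::finite) set \<Rightarrow> bool" where
  "n_rectangle T \<longleftrightarrow> (\<exists>a b. (\<forall>i. a $ i < b $ i) \<and> T = cbox a b)"

text \<open>The face condition forces distinct elements to have disjoint interiors, because an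
  element is the only face of itself that meets its interior.\<close>

definition conforming_mesh :: "(real ^ 'n::finite) set \<Rightarrow> (real ^ 'n) set set \<Rightarrow> bool" where
  "conforming_mesh \<Omega> \<T> \<longleftrightarrow> finite \<T> \<and>
     (\<forall>T\<in>\<T>. int CARD('n) simplex T \<or> n_rectangle T) \<and>
     \<Union>\<T> = closure \<Omega> \<and>
     (\<forall>T\<in>\<T>. \<forall>T'\<in>\<T>. T \<inter> T' face_of T \<and> T \<inter> T' face_of T')"

definition inner_diameter :: "(real ^ 'n::finite) set \<Rightarrow> real" where
  "inner_diameter T = Sup {2 * s |x s. s \<ge> 0 \<and> cball x s \<subseteq> T}"

text \<open>In dimension at least two, the bound on the aspect ratios makes the diameters of
  touching elements of a conforming mesh comparable. In dimension one the aspect ratio of every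
  element is 1, and comparability is the customary meaning of shape regularity.\<close>

definition shape_regular_family ::
  "real \<Rightarrow> (real ^ 'n::finite) set \<Rightarrow> (real ^ 'n) set set set \<Rightarrow> bool" where
  "shape_regular_family \<sigma> \<Omega> TT \<longleftrightarrow> (\<forall>\<T>\<in>TT. conforming_mesh \<Omega> \<T> \<and>
     (\<forall>T\<in>\<T>. diameter T / inner_diameter T \<le> \<sigma>) \<and>
     (CARD('n) = 1 \<longrightarrow> (\<forall>T\<in>\<T>. \<forall>T'\<in>\<T>. T \<inter> T' \<noteq> {} \<longrightarrow> diameter T \<le> \<sigma> * diameter T')))"

definition simplex_nodes :: "nat \<Rightarrow> (real ^ 'n::finite) set \<Rightarrow> (real ^ 'n) set" where
  "simplex_nodes l T = {z. \<exists>V a. \<not> affine_dependent V \<and> card V = CARD('n) + 1 \<and>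
     T = convex hull V \<and> (\<Sum>v\<in>V. a v) = l \<and> z = (\<Sum>v\<in>V. (real (a v) / real l) *\<^sub>R v)}"

definition rectangle_nodes :: "nat \<Rightarrow> (real ^ 'n::finite) set \<Rightarrow> (real ^ 'n) set" where
  "rectangle_nodes l T = {z. \<exists>a b j. (\<forall>i. a $ i < b $ i) \<and> T = cbox a b \<and>
     (\<forall>i. j i \<le> l \<and> z $ i = a $ i + (real (j i) / real l) * (b $ i - a $ i))}"

text \<open>At most one of the two node sets is nonempty, except in dimension one, where they agree.
  Degree 0 uses the vertices, that is, the nodes of degree 1.\<close>

definition nodes :: "nat \<Rightarrow> (real ^ 'n::finite) set set \<Rightarrow> (real ^ 'n) set" where
  "nodes m \<T> = (\<Union>T\<in>\<T>. simplex_nodes (max 1 m) T \<union> rectangle_nodes (max 1 m) T)"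

definition interior_nodes ::
  "nat \<Rightarrow> (real ^ 'n::finite) set \<Rightarrow> (real ^ 'n) set set \<Rightarrow> (real ^ 'n) set" where
  "interior_nodes m \<Omega> \<T> = nodes m \<T> - frontier \<Omega>"

definition patch :: "(real ^ 'n::finite) set set \<Rightarrow> real ^ 'n \<Rightarrow> (real ^ 'n) set" where
  "patch \<T> z = \<Union>{T \<in> \<T>. z \<in> T}"

definition node_size :: "(real ^ 'n::finite) set set \<Rightarrow> real ^ 'n \<Rightarrow> real" where
  "node_size \<T> z = Min (diameter ` {T \<in> \<T>. z \<in> T})"

section \<open>Averaged Taylor polynomials\<close>

definition scaled_kernel ::
  "nat \<Rightarrow> (real ^ 'n::finite \<Rightarrow> real) \<Rightarrow> real \<Rightarrow> real ^ 'n \<Rightarrow> real ^ 'n \<Rightarrow> real" where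
  "scaled_kernel m \<psi> h z x =
     (real (m + 1) ^ CARD('n) / h ^ CARD('n)) * \<psi> ((real (m + 1) / h) *\<^sub>R (z - x))"

definition taylor_poly :: "nat \<Rightarrow> (real ^ 'n::finite) set \<Rightarrow> (real ^ 'n \<Rightarrow> real) \<Rightarrow>
    real ^ 'n \<Rightarrow> real ^ 'n \<Rightarrow> real" where
  "taylor_poly m D v x y =
     (\<Sum>\<alpha> | mi_order \<alpha> \<le> m. 1 / mi_fact \<alpha> * weak_deriv D \<alpha> v x * mi_power (y - x) \<alpha>)"

text \<open>The average is an integral over the interior of the patch: there the weak derivatives are
  defined, and the kernel vanishes almost everywhere outside when its support lies in the patch,
  whose boundary is a null set.\<close>

definition averaged_taylor :: "nat \<Rightarrow> (real ^ 'n::finite \<Rightarrow> real) \<Rightarrow> (real ^ 'n) set set \<Rightarrow>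
    real ^ 'n \<Rightarrow> (real ^ 'n \<Rightarrow> real) \<Rightarrow> real ^ 'n \<Rightarrow> real" where
  "averaged_taylor m \<psi> \<T> z v y =
     (LINT x:interior (patch \<T> z)|lebesgue.
        taylor_poly m (interior (patch \<T> z)) v x y * scaled_kernel m \<psi> (node_size \<T> z) z x)"

end

theory Submission
  imports Defs
begin

text \<open>If the patch is star-shaped with respect to a ball \<open>B\<close>, the averages of a function over the
  balls \<open>y + t (B - y)\<close> interpolate between its average over \<open>B\<close> (for \<open>t = 1\<close>) and its value at
  \<open>y\<close> (for \<open>t \<rightarrow> 0\<close>). The derivative in \<open>t\<close> is controlled by an average of the gradient over a ball
  around \<open>y\<close> of radius comparable to \<open>t\<close>, and such averages are bounded on the weighted space
  uniformly in \<open>t\<close>, by Hoelder's inequality, the \<open>A\<^sub>p\<close> condition and Tonelli's theorem. This gives the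
  weighted Poincare inequality without the maximal function. For \<open>w = v - Q v\<close> the identity
  \<open>\<Sum>\<^sub>\<beta> \<integral> D\<^sup>\<alpha>\<^sup>+\<^sup>\<beta> w(x) (z - x)\<^sup>\<beta> / \<beta>! \<psi>\<^sub>z(x) dx = 0\<close> expresses the mean of \<open>D\<^sup>\<alpha> w\<close> through higher derivatives,
  so the Poincare inequality can be iterated up to order \<open>m + 1\<close>, where \<open>D\<^sup>\<alpha> w = D\<^sup>\<alpha> v\<close>.

  The constants are uniform because \<open>z\<close> is a lattice point of every element of its patch, which
  keeps the faces not containing \<open>z\<close> at a distance comparable to the size of the element, and
  because the elements around \<open>z\<close> are bounded in number and linked to each other by elements
  that share an edge, which makes their diameters comparable.\<close>

section \<open>Iterated partial derivatives and test functions\<close>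

text \<open>Two cancellations make the Poincare constants uniform. The substitution
  \<open>w = y + t (y' - y)\<close> costs a factor \<open>t^-n\<close>, and the integral over a ball
  of radius proportional to \<open>t\<close> gains the volume \<open>t^n\<close>, so nothing is
  singular at \<open>t = 0\<close>; the mollification parameter drops out in the same way. What
  remains is the length of \<open>y' - y\<close>, the source of the factor \<open>h\<close> in each
  Poincare step.

  The Poincare step produces a mean over a ball, whereas the moment identity speaks of means against
  \<psi>_z, a kernel that may change sign. Passing from one to the other, and bounding all higher
  moments, uses one estimate for functionals \<open>\<integral> f \<theta>\<close>: Hoelder's
  inequality and then the \<open>A_p\<close> condition on a single ball. Hence \<omega> enters the
  constants only through its characteristic.

  The moment identity is not obtained by commuting derivatives with averaging: \<open>Q v\<close> is
  rewritten as a polynomial about \<open>z\<close>, its derivatives are given by explicit formulas,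
  and the Taylor expansion of a polynomial is exact.\<close>

lemma iterated_partial_Nil [simp]: "iterated_partial [] f = f"
  by (simp add: iterated_partial_def)

lemma iterated_partial_Cons [simp]:
  "iterated_partial (i # js) f = partial i (iterated_partial js f)"
  by (simp add: iterated_partial_def)

lemma iterated_partial_append:
  "iterated_partial (xs @ ys) f = iterated_partial xs (iterated_partial ys f)"
  by (simp add: iterated_partial_def)

lemma smooth_differentiable: "smooth f \<Longrightarrow> f differentiable (at x)"
  unfolding smooth_def by (metis iterated_partial_Nil)

lemma smooth_iterated_partial: "smooth f \<Longrightarrow> smooth (iterated_partial js f)"
  unfolding smooth_def by (metis iterated_partial_append)

lemma smooth_partial: "smooth f \<Longrightarrow> smooth (partial i f)"
  using smooth_iterated_partial[of f "[i]"] by simp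

lemma smooth_continuous_on: "smooth f \<Longrightarrow> continuous_on S f"
  by (meson continuous_at_imp_continuous_on differentiable_imp_continuous_within
      smooth_differentiable)

lemma partialI: "(f has_derivative f') (at x) \<Longrightarrow> partial i f x = f' (axis i 1)"
  unfolding partial_def by (metis frechet_derivative_at)

lemma has_derivative_partial:
  fixes f :: "real ^ 'n::finite \<Rightarrow> real"
  assumes "f differentiable (at x)"
  shows "(f has_derivative (\<lambda>h. \<Sum>i\<in>UNIV. h $ i * partial i f x)) (at x)"
proof -
  let ?D = "frechet_derivative f (at x)"
  have D: "(f has_derivative ?D) (at x)"
    using assms frechet_derivative_works by blast
  then have lin: "linear ?D" by (rule has_derivative_linear)
  have "?D h = (\<Sum>i\<in>UNIV. h $ i * partial i f x)" for h
  proof -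
    have "?D h = ?D (\<Sum>i\<in>UNIV. h $ i *s axis i 1)"
      by (simp only: basis_expansion)
    also have "\<dots> = (\<Sum>i\<in>UNIV. h $ i * partial i f x)"
      by (simp add: linear_sum[OF lin] linear_cmul[OF lin] scalar_mult_eq_scaleR partial_def)
    finally show ?thesis .
  qed
  then have "?D = (\<lambda>h. \<Sum>i\<in>UNIV. h $ i * partial i f x)" by auto
  with D show ?thesis by simp
qed

lemma has_real_derivative_line:
  fixes f :: "real ^ 'n::finite \<Rightarrow> real"
  assumes "f differentiable (at (x + t *\<^sub>R h))"
  shows "((\<lambda>t. f (x + t *\<^sub>R h)) has_real_derivative
           (\<Sum>i\<in>UNIV. h $ i * partial i f (x + t *\<^sub>R h))) (at t within S)"
proof -
  have "((\<lambda>t. x + t *\<^sub>R h) has_derivative (\<lambda>s. s *\<^sub>R h)) (at t within S)"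
    by (auto intro!: derivative_eq_intros)
  from has_derivative_compose[OF this has_derivative_partial[OF assms]]
  show ?thesis
    unfolding has_field_derivative_def
    by (rule has_derivative_eq_rhs) (simp add: sum_distrib_left mult_ac fun_eq_iff)
qed

lemma has_real_derivative_axis:
  fixes f :: "real ^ 'n::finite \<Rightarrow> real"
  assumes "f differentiable (at (x + t *\<^sub>R axis i 1))"
  shows "((\<lambda>t. f (x + t *\<^sub>R axis i 1)) has_real_derivative
           partial i f (x + t *\<^sub>R axis i 1)) (at t within S)"
  using has_real_derivative_line[OF assms]
  by (simp add: axis_def if_distrib[where f="\<lambda>c. c * _"] cong: if_cong)

text \<open>The mean value theorem is used twice: in direction \<open>i\<close> for the increment of
  \<open>f\<close> along \<open>axis j\<close>, then in direction \<open>j\<close> for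
  \<open>partial i f\<close>. The second difference is symmetric in \<open>i\<close> and
  \<open>j\<close>, the mixed derivative on the right is not yet; \<open>partial_commute\<close>
  exploits this.\<close>

lemma second_difference_mvt:
  fixes f :: "real ^ 'n::finite \<Rightarrow> real"
  assumes f: "smooth f" and t: "0 < t"
  shows "\<exists>\<xi>. dist \<xi> x \<le> 2 * t \<and>
    f (x + t *\<^sub>R axis i 1 + t *\<^sub>R axis j 1) - f (x + t *\<^sub>R axis i 1)
      - f (x + t *\<^sub>R axis j 1) + f x = t * (t * partial j (partial i f) \<xi>)"
proof -
  let ?ei = "axis i 1 :: real ^ 'n" and ?ej = "axis j 1 :: real ^ 'n"
  let ?F = "\<lambda>s. f ((x + t *\<^sub>R ?ej) + s *\<^sub>R ?ei) - f (x + s *\<^sub>R ?ei)"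
  have "\<exists>s>0. s < t \<and> ?F t - ?F 0 = (t - 0) *
      (partial i f ((x + t *\<^sub>R ?ej) + s *\<^sub>R ?ei) - partial i f (x + s *\<^sub>R ?ei))"
    by (rule MVT2[OF t])
      (intro DERIV_diff has_real_derivative_axis smooth_differentiable[OF f])
  then obtain s where s: "0 < s" "s < t" and Fs: "?F t - ?F 0 = t *
      (partial i f ((x + t *\<^sub>R ?ej) + s *\<^sub>R ?ei) - partial i f (x + s *\<^sub>R ?ei))"
    by auto
  let ?G = "\<lambda>q. partial i f ((x + s *\<^sub>R ?ei) + q *\<^sub>R ?ej)"
  have "\<exists>q>0. q < t \<and> ?G t - ?G 0 = (t - 0) * partial j (partial i f) ((x + s *\<^sub>R ?ei) + q *\<^sub>R ?ej)"
    by (rule MVT2[OF t])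
      (intro has_real_derivative_axis smooth_differentiable smooth_partial f)
  then obtain q where q: "0 < q" "q < t"
    and Gq: "?G t - ?G 0 = t * partial j (partial i f) ((x + s *\<^sub>R ?ei) + q *\<^sub>R ?ej)"
    by auto
  have "dist ((x + s *\<^sub>R ?ei) + q *\<^sub>R ?ej) x = norm (s *\<^sub>R ?ei + q *\<^sub>R ?ej)"
    by (simp add: dist_norm)
  also have "\<dots> \<le> s + q"
    using norm_triangle_ineq[of "s *\<^sub>R ?ei" "q *\<^sub>R ?ej"] s q by simp
  finally have "dist ((x + s *\<^sub>R ?ei) + q *\<^sub>R ?ej) x \<le> 2 * t" using s q by simp
  moreover have "?F t - ?F 0 = t * (t * partial j (partial i f) ((x + s *\<^sub>R ?ei) + q *\<^sub>R ?ej))"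
    using Fs Gq by (simp add: algebra_simps)
  ultimately show ?thesis
    by (intro exI[of _ "(x + s *\<^sub>R ?ei) + q *\<^sub>R ?ej"]) (simp add: algebra_simps)
qed

text \<open>Both mixed derivatives, taken at points within \<open>2 t\<close> of \<open>x\<close>,
  equal the same second difference divided by \<open>t^2\<close>; continuity lets \<open>t\<close>
  tend to 0.\<close>

lemma partial_commute:
  assumes f: "smooth f"
  shows "partial i (partial j f) = partial j (partial i f)"
proof
  fix x
  let ?A = "partial i (partial j f)" and ?B = "partial j (partial i f)"
  have cont: "isCont ?A x" "isCont ?B x"
    using smooth_continuous_on[OF smooth_partial[OF smooth_partial[OF f]], of UNIV]
    by (auto simp: continuous_on_eq_continuous_at)
  have "\<bar>?A x - ?B x\<bar> \<le> e" if e: "0 < e" for e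
  proof -
    obtain d1 where d1: "d1 > 0" "\<And>y. dist y x < d1 \<Longrightarrow> dist (?A y) (?A x) < e / 2"
      using cont(1) e unfolding continuous_at_eps_delta by (meson half_gt_zero)
    obtain d2 where d2: "d2 > 0" "\<And>y. dist y x < d2 \<Longrightarrow> dist (?B y) (?B x) < e / 2"
      using cont(2) e unfolding continuous_at_eps_delta by (meson half_gt_zero)
    \<comment> \<open>A quarter leaves \<open>2 t\<close> strictly below both continuity
      radii.\<close>
    define t where "t = min d1 d2 / 4"
    have t: "0 < t" "2 * t < d1" "2 * t < d2" using d1 d2 by (auto simp: t_def)
    obtain \<xi> where xi: "dist \<xi> x \<le> 2 * t"
      "f (x + t *\<^sub>R axis i 1 + t *\<^sub>R axis j 1) - f (x + t *\<^sub>R axis i 1)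
      - f (x + t *\<^sub>R axis j 1) + f x = t * (t * ?B \<xi>)"
      using second_difference_mvt[OF f t(1)] by blast
    obtain \<eta> where eta: "dist \<eta> x \<le> 2 * t"
      "f (x + t *\<^sub>R axis j 1 + t *\<^sub>R axis i 1) - f (x + t *\<^sub>R axis j 1)
      - f (x + t *\<^sub>R axis i 1) + f x = t * (t * ?A \<eta>)"
      using second_difference_mvt[OF f t(1)] by blast
    have "t * (t * ?B \<xi>) = t * (t * ?A \<eta>)"
      using xi(2) eta(2) by (simp add: algebra_simps)
    then have "?B \<xi> = ?A \<eta>" using t by simp
    then show ?thesis
      using d1(2)[of \<eta>] d2(2)[of \<xi>] xi(1) eta(1) t unfolding dist_real_def by linarith
  qed
  then have "\<bar>?A x - ?B x\<bar> \<le> 0" by (rule field_le_epsilon[of _ 0, simplified])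
  then show "?A x = ?B x" by simp
qed

lemma iterated_partial_commute:
  "smooth f \<Longrightarrow> iterated_partial js (partial i f) = partial i (iterated_partial js f)"
  by (induction js) (auto simp: partial_commute smooth_iterated_partial)

text \<open>\<open>index_list\<close> is an arbitrary choice, so computations with
  \<open>classical_deriv\<close> pass through this independence of order. The head of
  \<open>xs\<close> is located in \<open>ys\<close> and moved to the front by commuting partial
  derivatives.\<close>

lemma iterated_partial_cong_mset:
  assumes "smooth f" "mset xs = mset ys"
  shows "iterated_partial xs f = iterated_partial ys f"
  using assms(2)
proof (induction xs arbitrary: ys)
  case (Cons a xs)
  then have "a \<in> set ys" by (metis list.set_intros(1) mset_eq_setD)
  then obtain us vs where ys: "ys = us @ a # vs" by (meson split_list)
  with Cons.prems have "mset xs = mset (us @ vs)" by simp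
  from Cons.IH[OF this] show ?case
    unfolding ys
    by (simp add: iterated_partial_append iterated_partial_commute smooth_iterated_partial assms(1))
qed simp

lemma classical_deriv_eq_iterated:
  assumes "smooth f" "\<And>i. count_list js i = \<alpha> i"
  shows "classical_deriv \<alpha> f = iterated_partial js f"
  unfolding classical_deriv_def
  by (rule iterated_partial_cong_mset[OF assms(1)])
     (simp add: multiset_eq_iff count_mset count_index_list assms(2))

lemma length_eq_mi_order:
  assumes "\<And>i. count_list js i = \<alpha> i"
  shows "length js = mi_order \<alpha>"
proof -
  have "length js = (\<Sum>i\<in>set js. count_list js i)" by (simp add: sum_count_set)
  also have "\<dots> = (\<Sum>i\<in>UNIV. count_list js i)"
    by (rule sum.mono_neutral_left) (auto simp: count_list_0_iff)
  finally show ?thesis by (simp add: mi_order_def assms)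
qed

section \<open>Arithmetic of multi-indices\<close>

definition mi_unit :: "'n \<Rightarrow> 'n multi_index" where
  "mi_unit i = (\<lambda>j. if j = i then 1 else 0)"

definition mi_add :: "'n multi_index \<Rightarrow> 'n multi_index \<Rightarrow> 'n multi_index" where
  "mi_add \<alpha> \<beta> = (\<lambda>i. \<alpha> i + \<beta> i)"

lemma mi_order_add: "mi_order (mi_add \<alpha> \<beta>) = mi_order \<alpha> + mi_order \<beta>"
  by (simp add: mi_order_def mi_add_def sum.distrib)

lemma mi_order_unit [simp]: "mi_order (mi_unit i) = 1"
  by (simp add: mi_order_def mi_unit_def)

lemma mi_order_zero [simp]: "mi_order (\<lambda>_. 0) = 0"
  by (simp add: mi_order_def)

lemma mi_order_eq_0_iff: "mi_order \<alpha> = 0 \<longleftrightarrow> \<alpha> = (\<lambda>_. 0)"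
  by (auto simp: mi_order_def)

lemma finite_multi_index: "finite {\<alpha> :: 'n::finite multi_index. mi_order \<alpha> \<le> k}"
proof (rule finite_subset)
  show "{\<alpha> :: 'n multi_index. mi_order \<alpha> \<le> k} \<subseteq> PiE UNIV (\<lambda>_. {..k})"
  proof
    fix \<alpha> :: "'n multi_index" assume "\<alpha> \<in> {\<alpha>. mi_order \<alpha> \<le> k}"
    then have "\<alpha> i \<le> k" for i
      using member_le_sum[of i UNIV \<alpha>] by (simp add: mi_order_def)
    then show "\<alpha> \<in> PiE UNIV (\<lambda>_. {..k})" by auto
  qed
  show "finite (PiE (UNIV :: 'n set) (\<lambda>_. {..k}))" by (intro finite_PiE) auto
qed

lemma classical_deriv_partial:
  assumes "smooth f"
  shows "classical_deriv \<alpha> (partial i f) = classical_deriv (mi_add \<alpha> (mi_unit i)) f"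
proof -
  have "classical_deriv (mi_add \<alpha> (mi_unit i)) f = iterated_partial (index_list \<alpha> @ [i]) f"
    by (rule classical_deriv_eq_iterated[OF assms])
       (simp add: count_index_list mi_add_def mi_unit_def)
  then show ?thesis by (simp add: classical_deriv_def iterated_partial_append)
qed

section \<open>Affine substitutions and mollification kernels\<close>

lemma partial_affine:
  fixes f :: "real ^ 'n::finite \<Rightarrow> real"
  assumes "f differentiable (at (a *\<^sub>R x + b))"
  shows "(\<lambda>x. c * f (a *\<^sub>R x + b)) differentiable (at x)"
    and "partial i (\<lambda>x. c * f (a *\<^sub>R x + b)) x = c * a * partial i f (a *\<^sub>R x + b)"
proof -
  have "((\<lambda>x. a *\<^sub>R x + b) has_derivative (\<lambda>h. a *\<^sub>R h)) (at x)"
    by (auto intro!: derivative_eq_intros)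
  from has_derivative_compose[OF this has_derivative_partial[OF assms]]
  have D: "((\<lambda>x. c * f (a *\<^sub>R x + b)) has_derivative
      (\<lambda>h. c * (\<Sum>i\<in>UNIV. (a *\<^sub>R h) $ i * partial i f (a *\<^sub>R x + b)))) (at x)"
    by (rule has_derivative_mult_right)
  then show "(\<lambda>x. c * f (a *\<^sub>R x + b)) differentiable (at x)"
    by (rule differentiableI)
  have "(\<Sum>j\<in>UNIV. (a *\<^sub>R axis i 1) $ j * partial j f (a *\<^sub>R x + b)) =
    (\<Sum>j\<in>UNIV. if j = i then a * partial j f (a *\<^sub>R x + b) else 0)"
    by (rule sum.cong) (auto simp: axis_def)
  then show "partial i (\<lambda>x. c * f (a *\<^sub>R x + b)) x = c * a * partial i f (a *\<^sub>R x + b)"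
    unfolding partialI[OF D] by simp
qed

lemma iterated_partial_affine:
  assumes f: "smooth f"
  shows "iterated_partial js (\<lambda>x. c * f (a *\<^sub>R x + b)) =
    (\<lambda>x. (c * a ^ length js) * iterated_partial js f (a *\<^sub>R x + b))"
proof (induction js)
  case (Cons i js)
  have "iterated_partial js f differentiable (at x)" for x
    using f by (simp add: smooth_def)
  then have "partial i (\<lambda>x. (c * a ^ length js) * iterated_partial js f (a *\<^sub>R x + b)) x =
      (c * a ^ length js) * a * partial i (iterated_partial js f) (a *\<^sub>R x + b)" for x
    by (rule partial_affine(2))
  then show ?case
    by (simp add: Cons.IH fun_eq_iff mult_ac)
qed simp

lemma smooth_affine:
  assumes f: "smooth f"
  shows "smooth (\<lambda>x. c * f (a *\<^sub>R x + b))"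
  unfolding smooth_def iterated_partial_affine[OF f]
  by (intro allI partial_affine(1)) (use f in \<open>simp add: smooth_def\<close>)

lemma supp_partial: "supp (partial i f) \<subseteq> supp f"
  unfolding supp_def
proof (rule closure_minimal)
  show "{x. partial i f x \<noteq> 0} \<subseteq> closure {x. f x \<noteq> 0}"
  proof (rule subsetI, rule ccontr)
    fix x assume x: "x \<in> {x. partial i f x \<noteq> 0}" "x \<notin> closure {x. f x \<noteq> 0}"
    have z: "f y = 0" if "y \<in> - closure {x. f x \<noteq> 0}" for y
      using that closure_subset[of "{x. f x \<noteq> 0}"] by auto
    have "((\<lambda>_. 0) has_derivative (\<lambda>h. 0)) (at x)" by (rule has_derivative_const)
    then have "(f has_derivative (\<lambda>h. 0)) (at x)"
    proof (rule has_derivative_transform_within_open)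
      show "open (- closure {x. f x \<noteq> 0})" by blast
      show "x \<in> - closure {x. f x \<noteq> 0}" using x(2) by blast
    qed (rule z[symmetric])
    from partialI[OF this, of i] x show False by simp
  qed
qed simp

lemma zero_outside_supp: "x \<notin> supp f \<Longrightarrow> f x = 0"
  unfolding supp_def using closure_subset[of "{x. f x \<noteq> 0}"] by auto

lemma compact_supp_subset: "supp f \<subseteq> K \<Longrightarrow> compact K \<Longrightarrow> compact (supp f)"
  using compact_Int_closed[of K "supp f"] by (simp add: supp_def Int_absorb1)

lemma test_function_partial: "test_function D \<phi> \<Longrightarrow> test_function D (partial i \<phi>)"
  unfolding test_function_def
  using supp_partial[of i \<phi>] compact_supp_subset[of "partial i \<phi>" "supp \<phi>"] smooth_partial by blast

lemma supp_kernel_subset: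
  fixes \<psi> :: "real ^ 'n::finite \<Rightarrow> real"
  assumes psi: "\<And>x. \<rho> < norm x \<Longrightarrow> \<psi> x = 0" and a: "a > 0"
  shows "supp (\<lambda>x. c * \<psi> (a *\<^sub>R (y - x))) \<subseteq> cball y (\<rho> / a)"
  unfolding supp_def
proof (rule closure_minimal)
  show "{x. c * \<psi> (a *\<^sub>R (y - x)) \<noteq> 0} \<subseteq> cball y (\<rho> / a)"
  proof
    fix x assume "x \<in> {x. c * \<psi> (a *\<^sub>R (y - x)) \<noteq> 0}"
    then have "\<psi> (a *\<^sub>R (y - x)) \<noteq> 0" by auto
    then have "norm (a *\<^sub>R (y - x)) \<le> \<rho>" using psi[of "a *\<^sub>R (y - x)"] by linarith
    then have "a * norm (y - x) \<le> \<rho>" using a by (simp only: norm_scaleR abs_of_pos)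
    then show "x \<in> cball y (\<rho> / a)"
      using a by (simp add: dist_norm pos_le_divide_eq mult.commute)
  qed
qed simp

text \<open>Makes the scaled mollifier admissible in the definition of weak derivatives, as long as
  its support ball around \<open>y\<close> fits into \<open>D\<close>.\<close>

lemma test_function_kernel:
  fixes \<psi> :: "real ^ 'n::finite \<Rightarrow> real"
  assumes "smooth \<psi>" and "\<And>x. \<rho> < norm x \<Longrightarrow> \<psi> x = 0" and "a > 0" and "cball y (\<rho> / a) \<subseteq> D"
  shows "test_function D (\<lambda>x. c * \<psi> (a *\<^sub>R (y - x)))"
  unfolding test_function_def
proof (intro conjI)
  have "(\<lambda>x. c * \<psi> (a *\<^sub>R (y - x))) = (\<lambda>x. c * \<psi> ((- a) *\<^sub>R x + a *\<^sub>R y))"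
    by (simp add: algebra_simps)
  then show "smooth (\<lambda>x. c * \<psi> (a *\<^sub>R (y - x)))"
    using smooth_affine[OF assms(1)] by metis
  have *: "supp (\<lambda>x. c * \<psi> (a *\<^sub>R (y - x))) \<subseteq> cball y (\<rho> / a)"
    by (rule supp_kernel_subset) (use assms in auto)
  then show "supp (\<lambda>x. c * \<psi> (a *\<^sub>R (y - x))) \<subseteq> D" using assms(4) by blast
  show "compact (supp (\<lambda>x. c * \<psi> (a *\<^sub>R (y - x))))"
    using * by (rule compact_supp_subset) simp
qed

section \<open>Integration on Euclidean space\<close>

lemma nn_integral_lborel_affine:
  fixes f :: "'a::euclidean_space \<Rightarrow> ennreal"
  assumes [measurable]: "f \<in> borel_measurable borel" and c: "c \<noteq> 0"
  shows "(\<integral>\<^sup>+x. f x \<partial>lborel) = ennreal (\<bar>c\<bar> ^ DIM('a)) * (\<integral>\<^sup>+x. f (t + c *\<^sub>R x) \<partial>lborel)"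
  by (subst lborel_affine[OF c, of t])
     (simp add: nn_integral_density nn_integral_distr nn_integral_cmult)

lemma nn_integral_lborel_translate:
  fixes f :: "'a::euclidean_space \<Rightarrow> ennreal"
  assumes "f \<in> borel_measurable borel"
  shows "(\<integral>\<^sup>+x. f (x + t) \<partial>lborel) = (\<integral>\<^sup>+x. f x \<partial>lborel)"
  using nn_integral_lborel_affine[OF assms, of 1 t] by (simp add: add.commute)

lemma integral_lborel_affine:
  fixes f :: "'a::euclidean_space \<Rightarrow> real"
  assumes [measurable]: "f \<in> borel_measurable borel" and c: "c \<noteq> 0"
  shows "(\<integral>x. f x \<partial>lborel) = \<bar>c\<bar> ^ DIM('a) * (\<integral>x. f (t + c *\<^sub>R x) \<partial>lborel)"
  by (subst lborel_affine[OF c, of t])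
     (simp add: integral_density integral_distr)

lemma integrable_lborel_affine:
  fixes f :: "'a::euclidean_space \<Rightarrow> real"
  assumes f: "integrable lborel f" and c: "c \<noteq> 0"
  shows "integrable lborel (\<lambda>x. f (t + c *\<^sub>R x))"
proof -
  have [measurable]: "f \<in> borel_measurable borel" using f by simp
  have "(\<integral>\<^sup>+x. ennreal (norm (f x)) \<partial>lborel) < \<infinity>"
    using f by (simp add: integrable_iff_bounded)
  then show ?thesis
    unfolding integrable_iff_bounded
    by (subst (asm) nn_integral_lborel_affine[OF _ c, of _ t])
       (auto simp: ennreal_mult_less_top c)
qed

lemma integral_lborel_translate:
  fixes f :: "'a::euclidean_space \<Rightarrow> real"
  assumes "f \<in> borel_measurable borel"
  shows "(\<integral>x. f (x + t) \<partial>lborel) = (\<integral>x. f x \<partial>lborel)"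
  using integral_lborel_affine[OF assms, of 1 t] by (simp add: add.commute)

lemma integrable_lborel_translate:
  fixes f :: "'a::euclidean_space \<Rightarrow> real"
  assumes "integrable lborel f"
  shows "integrable lborel (\<lambda>x. f (x + t))"
  using integrable_lborel_affine[OF assms, of 1 t] by (simp add: add.commute)

lemma line_FTC:
  fixes f :: "real ^ 'n::finite \<Rightarrow> real"
  assumes "\<And>x. f differentiable (at x)" and "\<And>i. continuous_on UNIV (partial i f)"
  shows "f (x + h) - f x = (\<integral>t. indicator {0..1} t * (\<Sum>i\<in>UNIV. h $ i * partial i f (x + t *\<^sub>R h)) \<partial>lborel)"
proof -
  have "(\<integral>t. indicator {0..1::real} t *\<^sub>R (\<Sum>i\<in>UNIV. h $ i * partial i f (x + t *\<^sub>R h)) \<partial>lborel)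
      = f (x + 1 *\<^sub>R h) - f (x + 0 *\<^sub>R h)"
  proof (rule integral_FTC_atLeastAtMost)
    fix t :: real
    show "((\<lambda>t. f (x + t *\<^sub>R h)) has_vector_derivative
        (\<Sum>i\<in>UNIV. h $ i * partial i f (x + t *\<^sub>R h))) (at t within {0..1})"
      by (rule has_real_derivative_line[OF assms(1), THEN
            has_real_derivative_iff_has_vector_derivative[THEN iffD1]])
  next
    show "continuous_on {0..1} (\<lambda>t. \<Sum>i\<in>UNIV. h $ i * partial i f (x + t *\<^sub>R h))"
      by (intro continuous_intros continuous_on_compose2[OF assms(2)]) auto
  qed simp
  then show ?thesis by simp
qed

lemma continuous_compact_supp_integrable:
  fixes f :: "'a::euclidean_space \<Rightarrow> real"
  assumes "continuous_on UNIV f" "compact K" "\<And>x. x \<notin> K \<Longrightarrow> f x = 0"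
  shows "integrable lborel f"
proof -
  have "integrable lborel (\<lambda>x. indicator K x *\<^sub>R f x)"
    by (rule borel_integrable_compact) (use assms(2) continuous_on_subset[OF assms(1)] in auto)
  moreover have "(\<lambda>x. indicator K x *\<^sub>R f x) = f"
    using assms(3) by (auto simp: indicator_def fun_eq_iff)
  ultimately show ?thesis by simp
qed

text \<open>Averaging the fundamental theorem of calculus over all translates along the
  \<open>i\<close>-th axis avoids iterated integrals over the coordinates.\<close>

lemma integral_partial_eq_0:
  fixes f :: "real ^ 'n::finite \<Rightarrow> real"
  assumes diff: "\<And>x. f differentiable (at x)" and cont: "continuous_on UNIV (partial i f)"
    and K: "compact K" "\<And>x. x \<notin> K \<Longrightarrow> f x = 0" "\<And>x. x \<notin> K \<Longrightarrow> partial i f x = 0"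
  shows "(\<integral>x. partial i f x \<partial>lborel) = 0"
proof -
  let ?e = "axis i 1 :: real ^ 'n" and ?g = "partial i f"
  have fc: "continuous_on UNIV f"
    by (meson continuous_at_imp_continuous_on differentiable_imp_continuous_within diff)
  have f_int: "integrable lborel f" and g_int: "integrable lborel ?g"
    using continuous_compact_supp_integrable[OF _ K(1)] fc cont K by auto
  have [measurable]: "f \<in> borel_measurable borel" "?g \<in> borel_measurable borel"
    using f_int g_int by auto
  let ?h = "\<lambda>t x. indicator {0..1::real} t * ?g (x + t *\<^sub>R ?e)"
  have FTC: "f (x + ?e) - f x = (\<integral>t. ?h t x \<partial>lborel)" for x
  proof -
    have "(\<integral>t. indicator {0..1::real} t *\<^sub>R ?g (x + t *\<^sub>R ?e) \<partial>lborel)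
      = f (x + 1 *\<^sub>R ?e) - f (x + 0 *\<^sub>R ?e)"
    proof (rule integral_FTC_atLeastAtMost)
      fix t :: real
      show "((\<lambda>t. f (x + t *\<^sub>R ?e)) has_vector_derivative ?g (x + t *\<^sub>R ?e)) (at t within {0..1})"
        by (rule has_real_derivative_axis[OF diff, THEN
              has_real_derivative_iff_has_vector_derivative[THEN iffD1]])
    next
      show "continuous_on {0..1} (\<lambda>t. ?g (x + t *\<^sub>R ?e))"
        by (intro continuous_intros continuous_on_compose2[OF cont]) auto
    qed simp
    then show ?thesis by simp
  qed
  have abs_tr: "(\<integral>x. \<bar>?g (x + s)\<bar> \<partial>lborel) = (\<integral>x. \<bar>?g x\<bar> \<partial>lborel)" for s
    by (rule integral_lborel_translate[of "\<lambda>x. \<bar>?g x\<bar>"]) auto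
  have "integrable (lborel \<Otimes>\<^sub>M lborel) (\<lambda>(t, x). ?h t x)"
  proof (rule lborel_pair.Fubini_integrable)
    show "integrable lborel (\<lambda>t. \<integral>x. norm (case (t, x) of (t, x) \<Rightarrow> ?h t x) \<partial>lborel)"
      by (simp add: abs_mult abs_tr)
    show "AE t in lborel. integrable lborel (\<lambda>x. case (t, x) of (t, x) \<Rightarrow> ?h t x)"
      by (auto intro!: AE_I2 integrable_mult_right integrable_lborel_translate g_int)
  qed measurable
  from lborel_pair.Fubini_integral[OF this]
  have "(\<integral>x. (\<integral>t. ?h t x \<partial>lborel) \<partial>lborel) = (\<integral>t. (\<integral>x. ?h t x \<partial>lborel) \<partial>lborel)" .
  \<comment> \<open>By translation invariance the inner integral does not depend on
    \<open>t\<close>, so averaging over the unit interval changes nothing.\<close>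
  also have "\<dots> = (\<integral>t. indicator {0..1::real} t * (\<integral>x. ?g x \<partial>lborel) \<partial>lborel)"
    by (simp add: integral_lborel_translate)
  also have "\<dots> = (\<integral>x. ?g x \<partial>lborel)" by simp
  finally have "(\<integral>x. ?g x \<partial>lborel) = (\<integral>x. f (x + ?e) - f x \<partial>lborel)"
    by (simp add: FTC)
  also have "\<dots> = 0"
    by (simp add: integrable_lborel_translate f_int integral_lborel_translate)
  finally show ?thesis .
qed

text \<open>Young's inequality with exponents \<open>p\<close> and \<open>p / (p - 1)\<close>, read
  geometrically: the convex function \<open>t powr p\<close> lies above its tangent at
  \<open>s\<close>. The free parameter \<open>s\<close> is optimised in Hoelder's
  inequality.\<close>

lemma powr_tangent:
  fixes p s t :: real
  assumes "1 < p" "0 \<le> t" "0 \<le> s"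
  shows "p * s powr (p - 1) * t \<le> t powr p + (p - 1) * s powr p"
proof -
  let ?q = "p / (p - 1)"
  have "t * s powr (p - 1) \<le> t powr p / p + (s powr (p - 1)) powr ?q / ?q"
    by (rule Youngs_inequality) (use assms in \<open>auto simp: field_simps\<close>)
  moreover have "(s powr (p - 1)) powr ?q = s powr p"
    using assms by (simp add: powr_powr)
  ultimately show ?thesis using assms by (simp add: field_simps)
qed

text \<open>The dual weight \<open>\<nu>\<close> may vanish, so that the lemma applies to a dual weight cut off outside
  a ball.\<close>

lemma weighted_holder:
  fixes f w \<nu> :: "'a \<Rightarrow> real"
  assumes p: "1 < p"
    and [measurable]: "f \<in> borel_measurable M"
    and f0: "\<And>x. 0 \<le> f x" and nu0: "\<And>x. 0 \<le> \<nu> x"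
    and fz: "\<And>x. \<nu> x = 0 \<Longrightarrow> f x = 0"
    and w: "\<And>x. 0 < \<nu> x \<Longrightarrow> w x = \<nu> x powr (1 - p)"
    and nu_int: "integrable M \<nu>" and fw_int: "integrable M (\<lambda>x. f x powr p * w x)"
  shows "integrable M f"
    and "(\<integral>x. f x \<partial>M) powr p \<le> (\<integral>x. f x powr p * w x \<partial>M) * (\<integral>x. \<nu> x \<partial>M) powr (p - 1)"
proof -
  have eq: "f x powr p * w x = (f x / \<nu> x) powr p * \<nu> x" for x
  proof (cases "\<nu> x = 0")
    case False
    with nu0[of x] have n: "0 < \<nu> x" by linarith
    then have "(f x / \<nu> x) powr p * \<nu> x = f x powr p * (\<nu> x powr 1 / \<nu> x powr p)"
      by (simp add: powr_divide f0)
    also have "\<dots> = f x powr p * w x" by (simp add: w[OF n] powr_diff)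
    finally show ?thesis ..
  qed (simp add: fz)
  \<comment> \<open>The tangent inequality for the density \<open>f / \<nu>\<close>, multiplied by
    \<nu>. With \<open>s = 1\<close> it yields integrability, with the optimal \<open>s\<close> the
    estimate.\<close>
  have tan: "p * s powr (p - 1) * f x \<le> f x powr p * w x + (p - 1) * s powr p * \<nu> x"
    if "0 \<le> s" for s x
  proof (cases "\<nu> x = 0")
    case False
    with nu0[of x] have n: "0 < \<nu> x" by linarith
    have "p * s powr (p - 1) * (f x / \<nu> x) \<le> (f x / \<nu> x) powr p + (p - 1) * s powr p"
      by (rule powr_tangent) (use p that f0 n in auto)
    from mult_right_mono[OF this, of "\<nu> x"] n show ?thesis
      unfolding eq by (simp add: algebra_simps)
  qed (simp add: fz)
  show f_int: "integrable M f"
  proof (rule Bochner_Integration.integrable_bound)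
    show "integrable M (\<lambda>x. (f x powr p * w x + (p - 1) * \<nu> x) / p)"
      using nu_int fw_int by auto
    show "AE x in M. norm (f x) \<le> norm ((f x powr p * w x + (p - 1) * \<nu> x) / p)"
    proof (rule AE_I2)
      fix x
      have "p * f x \<le> f x powr p * w x + (p - 1) * \<nu> x" using tan[of 1 x] by simp
      then have "f x \<le> (f x powr p * w x + (p - 1) * \<nu> x) / p"
        using p by (simp add: field_simps)
      also have "\<dots> \<le> \<bar>(f x powr p * w x + (p - 1) * \<nu> x) / p\<bar>" by (rule abs_ge_self)
      finally show "norm (f x) \<le> norm ((f x powr p * w x + (p - 1) * \<nu> x) / p)"
        using f0[of x] by simp
    qed
  qed simp
  let ?F = "\<integral>x. f x \<partial>M" and ?N = "\<integral>x. \<nu> x \<partial>M" and ?E = "\<integral>x. f x powr p * w x \<partial>M"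
  have F0: "0 \<le> ?F" and N0: "0 \<le> ?N" by (auto intro!: integral_nonneg_AE simp: f0 nu0)
  have E0: "0 \<le> ?E" unfolding eq by (auto intro!: integral_nonneg_AE simp: nu0)
  show "?F powr p \<le> ?E * ?N powr (p - 1)"
  proof (cases "?N = 0")
    case True
    then have "AE x in M. \<nu> x = 0"
      using integral_nonneg_eq_0_iff_AE[OF nu_int] nu0 by auto
    then have "AE x in M. f x = 0" by eventually_elim (rule fz)
    then have "?F = 0" by (rule integral_eq_zero_AE)
    with p True show ?thesis by simp
  next
    case False
    with N0 have N: "0 < ?N" by linarith
    \<comment> \<open>The optimal tangent point is the mean of \<open>f / \<nu>\<close> with respect
      to \<nu>, as in the proof of Jensen's inequality.\<close>
    let ?s = "?F / ?N"
    have s0: "0 \<le> ?s" using F0 N by simp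
    have "p * ?s powr (p - 1) * ?F = (\<integral>x. p * ?s powr (p - 1) * f x \<partial>M)"
      by simp
    also have "\<dots> \<le> (\<integral>x. f x powr p * w x + (p - 1) * ?s powr p * \<nu> x \<partial>M)"
      by (intro integral_mono) (use tan[OF s0] f_int fw_int nu_int in auto)
    also have "\<dots> = ?E + (p - 1) * ?s powr p * ?N"
      using fw_int nu_int by simp
    finally have A: "p * ?s powr (p - 1) * ?F \<le> ?E + (p - 1) * ?s powr p * ?N" .
    have "?s powr (p - 1) * ?F = ?s powr p * ?N"
    proof (cases "?F = 0")
      case False
      then have "0 < ?s" using F0 N by (simp add: less_le)
      then have "?s powr p = ?s powr (p - 1) * ?s"
        by (metis add.commute diff_add_cancel less_imp_le powr_add powr_one)
      then show ?thesis using N by simp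
    qed (use p in simp)
    with A have "?s powr p * ?N \<le> ?E" by (simp add: algebra_simps)
    then have "?s powr p * ?N * ?N powr (p - 1) \<le> ?E * ?N powr (p - 1)"
      by (rule mult_right_mono) simp
    moreover have "?s powr p * ?N * ?N powr (p - 1) = ?F powr p"
    proof -
      have "?N * ?N powr (p - 1) = ?N powr p"
        using N by (metis add.commute diff_add_cancel less_imp_le powr_add powr_one)
      then show ?thesis using N F0 by (simp add: powr_divide mult.assoc)
    qed
    ultimately show ?thesis by simp
  qed
qed

text \<open>Density argument along \<open>integrable_induct\<close>. For an indicator,
  \<open>A\<close> is squeezed between a compact \<open>K\<close> and an open \<open>U\<close> with
  small difference; a sufficiently short shift keeps \<open>K\<close> inside \<open>U\<close> and so
  changes the indicator only on \<open>U - K\<close> or its translate.\<close>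

lemma translation_continuous_L1:
  fixes u :: "'a::euclidean_space \<Rightarrow> real"
  assumes "integrable lborel u" and "0 < e"
  shows "\<exists>d>0. \<forall>h. norm h < d \<longrightarrow> (\<integral>\<^sup>+x. ennreal \<bar>u (x + h) - u x\<bar> \<partial>lborel) \<le> ennreal e"
  using assms
proof (induction arbitrary: e rule: integrable_induct)
  case (base A c)
  \<comment> \<open>Inner regularity is applied to a finite measure, Lebesgue measure restricted to
    \<open>A\<close>.\<close>
  let ?M = "density lborel (indicator A)"
  have A[measurable]: "A \<in> sets borel" using base by simp
  have MX: "emeasure ?M X = emeasure lborel (A \<inter> X)" if "X \<in> sets borel" for X
    using that by (simp add: emeasure_restricted)
  \<comment> \<open>The final bound is \<open>4 * \<eta>\<close> times the absolute value of
    \<open>c\<close>; the summand 1 in the denominator covers \<open>c = 0\<close>.\<close>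
  define \<eta> where "\<eta> = e / (4 * (\<bar>c\<bar> + 1))"
  have \<eta>: "0 < \<eta>" using base by (simp add: \<eta>_def)
  obtain K where K: "K \<subseteq> A" "compact K" "emeasure lborel A \<le> emeasure lborel K + ennreal \<eta>"
  proof -
    have S: "emeasure ?M A = (SUP K \<in> {K. K \<subseteq> A \<and> compact K}. emeasure ?M K)"
    proof (rule inner_regular)
      show "sets ?M = sets borel" by simp
      show "emeasure ?M (space ?M) \<noteq> \<infinity>" using base(2) MX[of UNIV] by simp
    qed (rule A)
    have fin: "emeasure ?M A < \<infinity>" using base(2) MX[OF A] by simp
    have "\<exists>K\<in>{K. K \<subseteq> A \<and> compact K}. emeasure ?M A \<le> emeasure ?M K + ennreal \<eta>"
    proof (cases "emeasure ?M A = 0")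
      case True
      then have "emeasure ?M A \<le> emeasure ?M {} + ennreal \<eta>" by simp
      then show ?thesis by (intro bexI[of _ "{}"]) simp_all
    next
      case False
      have "emeasure ?M A - ennreal \<eta> < emeasure ?M A"
        by (intro ennreal_between zero_less_iff_neq_zero[THEN iffD2] False)
           (use fin \<eta> in auto)
      from less_SUP_iff[THEN iffD1, OF ord_less_eq_trans[OF this S]]
      obtain K where "K \<in> {K. K \<subseteq> A \<and> compact K}" "emeasure ?M A - ennreal \<eta> < emeasure ?M K"
        by blast
      moreover from this(2) have "emeasure ?M A \<le> emeasure ?M K + ennreal \<eta>"
        by (metis add.commute ennreal_minus_le_iff less_imp_le)
      ultimately show ?thesis by blast
    qed
    then obtain K where K: "K \<subseteq> A" "compact K" "emeasure ?M A \<le> emeasure ?M K + ennreal \<eta>" by auto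
    moreover have "K \<in> sets borel" using K by (simp add: borel_compact)
    ultimately have "emeasure lborel A \<le> emeasure lborel K + ennreal \<eta>"
      using MX[of A] MX[of K] by (simp add: Int_absorb1)
    with K that show thesis by blast
  qed
  obtain U where U: "open U" "A \<subseteq> U" "emeasure lebesgue (U - A) < ennreal \<eta>"
    by (rule sets_lebesgue_outer_open[of A \<eta>]) (use \<eta> A in auto)
  have [measurable]: "K \<in> sets borel" "U \<in> sets borel"
    using K U by (auto simp: borel_compact)
  have UK: "emeasure lborel (U - K) \<le> ennreal (2 * \<eta>)"
  proof -
    have "emeasure lborel A = emeasure lborel K + emeasure lborel (A - K)"
      by (subst plus_emeasure) (use K(1) in \<open>auto simp: Un_absorb1\<close>)
    with K(3) have "emeasure lborel K + emeasure lborel (A - K) \<le> emeasure lborel K + ennreal \<eta>"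
      by simp
    moreover have "emeasure lborel K \<noteq> \<infinity>"
      using emeasure_bounded_finite[OF compact_imp_bounded[OF K(2)]] by simp
    ultimately have 1: "emeasure lborel (A - K) \<le> ennreal \<eta>"
      by (simp add: ennreal_add_left_cancel_le)
    have "emeasure lborel (U - K) \<le> emeasure lborel ((U - A) \<union> (A - K))"
      by (rule emeasure_mono) auto
    also have "\<dots> \<le> emeasure lborel (U - A) + emeasure lborel (A - K)"
      by (rule emeasure_subadditive) auto
    also have "\<dots> \<le> ennreal \<eta> + ennreal \<eta>"
      using U(3) 1 by (intro add_mono) auto
    finally show ?thesis using \<eta> by (simp flip: ennreal_plus)
  qed
  obtain d where d: "d > 0" "(\<Union>x\<in>K. ball x d) \<subseteq> U"
    using compact_subset_open_imp_ball_epsilon_subset[OF K(2) U(1)] K(1) U(2) by blast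
  show ?case
  proof (intro exI[of _ d] conjI allI impI)
    fix h :: 'a assume h: "norm h < d"
    \<comment> \<open>Say \<open>x\<close> is in \<open>A\<close> and \<open>x + h\<close> is not:
      either \<open>x\<close> is outside \<open>K\<close>, hence in \<open>U - K\<close>, or
      \<open>x + h\<close> is in \<open>U\<close> but not in \<open>A\<close>, hence in
      \<open>U - K\<close>. The other case is symmetric.\<close>
    have pw: "\<bar>indicator A (x + h) *\<^sub>R c - indicator A x *\<^sub>R c\<bar>
        \<le> \<bar>c\<bar> * (indicator (U - K) x + indicator (U - K) (x + h))" for x
    proof -
      have "x + h \<in> ball x d" "x \<in> ball (x + h) d" using h by (simp_all add: dist_norm)
      then have "x \<in> K \<Longrightarrow> x + h \<in> U" "x + h \<in> K \<Longrightarrow> x \<in> U"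
        using d(2) by blast+
      then show ?thesis using K(1) U(2) by (auto simp: indicator_def)
    qed
    have "(\<integral>\<^sup>+x. ennreal \<bar>indicator A (x + h) *\<^sub>R c - indicator A x *\<^sub>R c\<bar> \<partial>lborel)
      \<le> (\<integral>\<^sup>+x. ennreal \<bar>c\<bar> * (indicator (U - K) x + indicator (U - K) (x + h)) \<partial>lborel)"
    proof (rule nn_integral_mono)
      fix x
      have "ennreal \<bar>indicator A (x + h) *\<^sub>R c - indicator A x *\<^sub>R c\<bar>
        \<le> ennreal (\<bar>c\<bar> * (indicator (U - K) x + indicator (U - K) (x + h)))"
        by (rule ennreal_leI[OF pw])
      then show "ennreal \<bar>indicator A (x + h) *\<^sub>R c - indicator A x *\<^sub>R c\<bar>
        \<le> ennreal \<bar>c\<bar> * (indicator (U - K) x + indicator (U - K) (x + h))"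
        by (simp add: ennreal_mult' ennreal_indicator)
    qed
    also have "\<dots> = ennreal \<bar>c\<bar> * ((\<integral>\<^sup>+x. indicator (U - K) x \<partial>lborel)
         + (\<integral>\<^sup>+x. indicator (U - K) (x + h) \<partial>lborel))"
      by (simp add: nn_integral_cmult nn_integral_add)
    also have "\<dots> = ennreal \<bar>c\<bar> * (emeasure lborel (U - K) + emeasure lborel (U - K))"
      by (subst nn_integral_lborel_translate) auto
    also have "\<dots> \<le> ennreal \<bar>c\<bar> * (ennreal (2 * \<eta>) + ennreal (2 * \<eta>))"
      by (intro mult_left_mono add_mono UK) auto
    also have "\<dots> = ennreal (\<bar>c\<bar> * (4 * \<eta>))"
      using \<eta> by (simp flip: ennreal_plus ennreal_mult')
    also have "\<dots> \<le> ennreal e"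
    proof (rule ennreal_leI)
      have "\<bar>c\<bar> * (4 * \<eta>) = e * (\<bar>c\<bar> / (\<bar>c\<bar> + 1))" by (simp add: \<eta>_def field_simps)
      also have "\<dots> \<le> e * 1" using base by (intro mult_left_mono) auto
      finally show "\<bar>c\<bar> * (4 * \<eta>) \<le> e" by simp
    qed
    finally show "(\<integral>\<^sup>+x. ennreal \<bar>indicator A (x + h) *\<^sub>R c - indicator A x *\<^sub>R c\<bar> \<partial>lborel) \<le> ennreal e" .
  qed (use d in auto)
next
  case (add f g)
  have [measurable]: "f \<in> borel_measurable borel" "g \<in> borel_measurable borel" using add by auto
  obtain d1 where d1: "d1 > 0" "\<And>h. norm h < d1 \<Longrightarrow> (\<integral>\<^sup>+x. ennreal \<bar>f (x + h) - f x\<bar> \<partial>lborel) \<le> ennreal (e / 2)"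
    using add.IH(1)[of "e / 2"] add.prems by auto
  obtain d2 where d2: "d2 > 0" "\<And>h. norm h < d2 \<Longrightarrow> (\<integral>\<^sup>+x. ennreal \<bar>g (x + h) - g x\<bar> \<partial>lborel) \<le> ennreal (e / 2)"
    using add.IH(2)[of "e / 2"] add.prems by auto
  show ?case
  proof (intro exI[of _ "min d1 d2"] conjI allI impI)
    fix h :: 'a assume h: "norm h < min d1 d2"
    have "(\<integral>\<^sup>+x. ennreal \<bar>f (x + h) + g (x + h) - (f x + g x)\<bar> \<partial>lborel)
      \<le> (\<integral>\<^sup>+x. ennreal \<bar>f (x + h) - f x\<bar> + ennreal \<bar>g (x + h) - g x\<bar> \<partial>lborel)"
      by (intro nn_integral_mono) (simp flip: ennreal_plus add: ennreal_leI)
    also have "\<dots> = (\<integral>\<^sup>+x. ennreal \<bar>f (x + h) - f x\<bar> \<partial>lborel) + (\<integral>\<^sup>+x. ennreal \<bar>g (x + h) - g x\<bar> \<partial>lborel)"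
      by (simp add: nn_integral_add)
    also have "\<dots> \<le> ennreal (e / 2) + ennreal (e / 2)"
      using h by (intro add_mono d1 d2) auto
    also have "\<dots> = ennreal e" using add.prems by (simp flip: ennreal_plus)
    finally show "(\<integral>\<^sup>+x. ennreal \<bar>f (x + h) + g (x + h) - (f x + g x)\<bar> \<partial>lborel) \<le> ennreal e" .
  qed (use d1 d2 in auto)
next
  case (lim f s)
  have sm[measurable]: "f \<in> borel_measurable borel" "\<And>i. s i \<in> borel_measurable borel" using lim by auto
  \<comment> \<open>The induction rule bounds \<open>s i\<close> by \<open>2 * f\<close> in absolute
    value, hence the majorant with factor 3.\<close>
  have "(\<lambda>i. \<integral>x. \<bar>s i x - f x\<bar> \<partial>lborel) \<longlonglongrightarrow> (\<integral>x. 0 \<partial>(lborel :: 'a measure))"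
  proof (rule integral_dominated_convergence[where w = "\<lambda>x. 3 * \<bar>f x\<bar>"
          and s = "\<lambda>i x. \<bar>s i x - f x\<bar>" and f = "\<lambda>_. 0"])
    show "AE x in lborel. (\<lambda>i. \<bar>s i x - f x\<bar>) \<longlonglongrightarrow> 0"
    proof (rule AE_I2)
      fix x
      have "(\<lambda>i. s i x - f x) \<longlonglongrightarrow> f x - f x" by (intro tendsto_intros lim) simp
      then show "(\<lambda>i. \<bar>s i x - f x\<bar>) \<longlonglongrightarrow> 0" by (simp add: tendsto_rabs_zero)
    qed
    show "AE x in lborel. norm \<bar>s i x - f x\<bar> \<le> 3 * \<bar>f x\<bar>" for i
    proof (rule AE_I2)
      fix x
      show "norm \<bar>s i x - f x\<bar> \<le> 3 * \<bar>f x\<bar>" using lim.hyps(3)[of x i] by simp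
    qed
    show "integrable lborel (\<lambda>x. 3 * \<bar>f x\<bar>)" using lim.hyps(4) by auto
  qed auto
  then have "eventually (\<lambda>i. (\<integral>x. \<bar>s i x - f x\<bar> \<partial>lborel) < e / 3) sequentially"
    using lim.prems by (intro order_tendstoD(2)) auto
  then obtain i where i: "(\<integral>x. \<bar>s i x - f x\<bar> \<partial>lborel) < e / 3"
    by (auto simp: eventually_sequentially)
  have nn: "(\<integral>\<^sup>+x. ennreal \<bar>s i x - f x\<bar> \<partial>lborel) \<le> ennreal (e / 3)"
    using i lim by (subst nn_integral_eq_integral) (auto intro!: ennreal_leI)
  have nn': "(\<integral>\<^sup>+x. ennreal \<bar>s i (x + h) - f (x + h)\<bar> \<partial>lborel) \<le> ennreal (e / 3)" for h
    using nn nn_integral_lborel_translate[of "\<lambda>x. ennreal \<bar>s i x - f x\<bar>" h] by simp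
  obtain d where d: "d > 0" "\<And>h. norm h < d \<Longrightarrow> (\<integral>\<^sup>+x. ennreal \<bar>s i (x + h) - s i x\<bar> \<partial>lborel) \<le> ennreal (e / 3)"
    using lim.IH[of "e / 3" i] lim.prems by auto
  show ?case
  proof (intro exI[of _ d] conjI allI impI)
    fix h :: 'a assume h: "norm h < d"
    have "(\<integral>\<^sup>+x. ennreal \<bar>f (x + h) - f x\<bar> \<partial>lborel)
      \<le> (\<integral>\<^sup>+x. ennreal \<bar>s i (x + h) - f (x + h)\<bar> + (ennreal \<bar>s i (x + h) - s i x\<bar> + ennreal \<bar>s i x - f x\<bar>) \<partial>lborel)"
      by (intro nn_integral_mono) (simp flip: ennreal_plus add: ennreal_leI)
    also have "\<dots> = (\<integral>\<^sup>+x. ennreal \<bar>s i (x + h) - f (x + h)\<bar> \<partial>lborel) +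
        ((\<integral>\<^sup>+x. ennreal \<bar>s i (x + h) - s i x\<bar> \<partial>lborel) + (\<integral>\<^sup>+x. ennreal \<bar>s i x - f x\<bar> \<partial>lborel))"
      by (simp add: nn_integral_add)
    also have "\<dots> \<le> ennreal (e / 3) + (ennreal (e / 3) + ennreal (e / 3))"
      by (intro add_mono nn nn' d h)
    also have "\<dots> = ennreal e" using lim.prems by (simp flip: ennreal_plus)
    finally show "(\<integral>\<^sup>+x. ennreal \<bar>f (x + h) - f x\<bar> \<partial>lborel) \<le> ennreal e" .
  qed (use d in auto)
qed

text \<open>The parameter \<open>a\<close> is the reciprocal of the mollification length: the
  approximation improves as \<open>a\<close> tends to infinity, and with
  \<open>a = (m + 1) / h\<close> the kernel is \<open>scaled_kernel\<close>.\<close>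

definition mollify :: "(real ^ 'n::finite \<Rightarrow> real) \<Rightarrow> real \<Rightarrow> (real ^ 'n \<Rightarrow> real) \<Rightarrow> real ^ 'n \<Rightarrow> real" where
  "mollify \<psi> a u y = (\<integral>x. u x * (a ^ CARD('n) * \<psi> (a *\<^sub>R (y - x))) \<partial>lborel)"

lemma borel_measurable_mollify [measurable]:
  assumes [measurable]: "u \<in> borel_measurable borel" "\<psi> \<in> borel_measurable borel"
  shows "mollify \<psi> a u \<in> borel_measurable borel"
  unfolding mollify_def by measurable

lemma mollify_substitution:
  fixes \<psi> :: "real ^ 'n::finite \<Rightarrow> real"
  assumes [measurable]: "u \<in> borel_measurable borel" "\<psi> \<in> borel_measurable borel" and a: "0 < a"
  shows "mollify \<psi> a u y = (\<integral>w. u (y - w /\<^sub>R a) * \<psi> w \<partial>lborel)"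
proof -
  have "(\<integral>x. u x * (a ^ CARD('n) * \<psi> (a *\<^sub>R (y - x))) \<partial>lborel) =
     \<bar>- inverse a\<bar> ^ DIM(real ^ 'n) * (\<integral>w. u (y + (- inverse a) *\<^sub>R w) *
        (a ^ CARD('n) * \<psi> (a *\<^sub>R (y - (y + (- inverse a) *\<^sub>R w)))) \<partial>lborel)"
    by (rule integral_lborel_affine) (use a in auto)
  also have "\<dots> = (\<integral>w. u (y - w /\<^sub>R a) * \<psi> w \<partial>lborel)"
    unfolding integral_mult_right_zero[symmetric]
    using a by (intro Bochner_Integration.integral_cong refl) (simp add: power_inverse field_simps)
  finally show ?thesis by (simp add: mollify_def)
qed

lemma bounded_compact_supp:
  fixes f :: "'a::euclidean_space \<Rightarrow> real"
  assumes "continuous_on UNIV f" "compact K" "\<And>x. x \<notin> K \<Longrightarrow> f x = 0"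
  shows "\<exists>B>0. \<forall>x. \<bar>f x\<bar> \<le> B"
proof -
  have "bounded (f ` K)"
    by (intro compact_imp_bounded compact_continuous_image assms(2) continuous_on_subset[OF assms(1)]) auto
  then obtain B where B: "B > 0" "\<forall>y\<in>f ` K. norm y \<le> B" using bounded_pos by blast
  then have "\<bar>f x\<bar> \<le> B" for x by (cases "x \<in> K") (auto simp: assms(3))
  with B(1) show ?thesis by blast
qed

lemma integrable_mult_bounded:
  fixes u g :: "'a \<Rightarrow> real"
  assumes u: "integrable M u" and [measurable]: "g \<in> borel_measurable M" and B: "\<And>x. \<bar>g x\<bar> \<le> B"
  shows "integrable M (\<lambda>x. u x * g x)"
proof (rule Bochner_Integration.integrable_bound)
  show "integrable M (\<lambda>x. B * u x)" using u by simp
  have [measurable]: "u \<in> borel_measurable M" using u by simp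
  show "(\<lambda>x. u x * g x) \<in> borel_measurable M" by measurable
  have "\<bar>u x\<bar> * \<bar>g x\<bar> \<le> \<bar>B\<bar> * \<bar>u x\<bar>" for x
    using mult_left_mono[OF order_trans[OF B abs_ge_self], of "\<bar>u x\<bar>" x] by (simp add: mult.commute)
  then show "AE x in M. norm (u x * g x) \<le> norm (B * u x)" by (simp add: abs_mult)
qed

text \<open>After \<open>mollify_substitution\<close> a mollification is a mean of translates of
  \<open>u\<close>. Tonelli's theorem bounds its L1 norm, and that of its difference from
  \<open>u\<close>, by \<open>J\<close> times a bound that is uniform over the translations by
  \<open>w / a\<close> with \<open>norm w \<le> \<rho>\<close>. As \<psi> may change sign, its L1
  norm \<open>J\<close> appears instead of 1.\<close>

lemma
  fixes \<psi> :: "real ^ 'n::finite \<Rightarrow> real"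
  assumes u: "integrable lborel u"
    and psi: "continuous_on UNIV \<psi>" "\<And>x. \<rho> < norm x \<Longrightarrow> \<psi> x = 0"
    and int1: "(\<integral>x. \<psi> x \<partial>lborel) = 1"
  shows integrable_mollify: "0 < a \<Longrightarrow> integrable lborel (mollify \<psi> a u)"
    and mollify_tendsto_L1: "filterlim \<alpha> at_top sequentially \<Longrightarrow>
      (\<lambda>k. \<integral>y. \<bar>mollify \<psi> (\<alpha> k) u y - u y\<bar> \<partial>lborel) \<longlonglongrightarrow> 0"
proof -
  have [measurable]: "u \<in> borel_measurable borel" "\<psi> \<in> borel_measurable borel"
    using u borel_measurable_continuous_onI[OF psi(1)] by auto
  have zero: "x \<notin> cball 0 \<rho> \<Longrightarrow> \<psi> x = 0" for x by (simp add: psi(2))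
  have psi_int: "integrable lborel \<psi>"
    by (rule continuous_compact_supp_integrable[OF psi(1) compact_cball zero])
  obtain B where B: "\<And>x. \<bar>\<psi> x\<bar> \<le> B"
    using bounded_compact_supp[OF psi(1) compact_cball zero] by blast
  define J where "J = (\<integral>w. \<bar>\<psi> w\<bar> \<partial>lborel)"
  have J: "(\<integral>\<^sup>+w. ennreal \<bar>\<psi> w\<bar> \<partial>lborel) = ennreal J" "0 \<le> J"
    unfolding J_def using psi_int by (auto intro!: nn_integral_eq_integral)
  have ui: "integrable lborel (\<lambda>w. u (y - w /\<^sub>R a) * \<psi> w)" if "0 < a" for a y
    using integrable_mult_bounded[OF integrable_lborel_affine[OF u, of "- inverse a" y] _ B] that by simp
  \<comment> \<open>Shared by both claims: \<open>g y w\<close> is a translate of \<open>u\<close>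
    for integrability, and a translate minus \<open>u\<close> for convergence.\<close>
  have tonelli: "(\<integral>\<^sup>+y. ennreal \<bar>\<integral>w. g y w * \<psi> w \<partial>lborel\<bar> \<partial>lborel) \<le> ennreal (J * c)"
    if [measurable]: "case_prod g \<in> borel_measurable (borel \<Otimes>\<^sub>M borel)"
      and gi: "\<And>y. integrable lborel (\<lambda>w. g y w * \<psi> w)"
      and c: "\<And>w. norm w \<le> \<rho> \<Longrightarrow> (\<integral>\<^sup>+y. ennreal \<bar>g y w\<bar> \<partial>lborel) \<le> ennreal c" and "0 \<le> c" for g c
  proof -
    have "(\<integral>\<^sup>+y. ennreal \<bar>\<integral>w. g y w * \<psi> w \<partial>lborel\<bar> \<partial>lborel)
       \<le> (\<integral>\<^sup>+y. (\<integral>\<^sup>+w. ennreal \<bar>g y w\<bar> * ennreal \<bar>\<psi> w\<bar> \<partial>lborel) \<partial>lborel)"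
    proof (rule nn_integral_mono)
      fix y show "ennreal \<bar>\<integral>w. g y w * \<psi> w \<partial>lborel\<bar> \<le> (\<integral>\<^sup>+w. ennreal \<bar>g y w\<bar> * ennreal \<bar>\<psi> w\<bar> \<partial>lborel)"
        using integral_norm_bound_ennreal[OF gi[of y]] by (simp add: abs_mult ennreal_mult')
    qed
    also have "\<dots> = (\<integral>\<^sup>+w. (\<integral>\<^sup>+y. ennreal \<bar>g y w\<bar> * ennreal \<bar>\<psi> w\<bar> \<partial>lborel) \<partial>lborel)"
      by (rule lborel_pair.Fubini') measurable
    also have "\<dots> = (\<integral>\<^sup>+w. (\<integral>\<^sup>+y. ennreal \<bar>g y w\<bar> \<partial>lborel) * ennreal \<bar>\<psi> w\<bar> \<partial>lborel)"
      by (intro nn_integral_cong nn_integral_multc) measurable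
    also have "\<dots> \<le> (\<integral>\<^sup>+w. ennreal c * ennreal \<bar>\<psi> w\<bar> \<partial>lborel)"
    proof (rule nn_integral_mono)
      fix w show "(\<integral>\<^sup>+y. ennreal \<bar>g y w\<bar> \<partial>lborel) * ennreal \<bar>\<psi> w\<bar> \<le> ennreal c * ennreal \<bar>\<psi> w\<bar>"
        by (cases "norm w \<le> \<rho>") (auto intro!: mult_right_mono c simp: psi(2))
    qed
    also have "\<dots> = ennreal c * ennreal J"
      by (subst nn_integral_cmult) (auto simp: J(1))
    also have "\<dots> = ennreal (J * c)"
      using J \<open>0 \<le> c\<close> by (simp add: mult.commute flip: ennreal_mult')
    finally show ?thesis .
  qed
  show mi: "integrable lborel (mollify \<psi> a u)" if a: "0 < a" for a
  proof (rule integrableI_bounded)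
    have tr: "(\<integral>\<^sup>+y. ennreal \<bar>u (y - w /\<^sub>R a)\<bar> \<partial>lborel) = ennreal (\<integral>y. \<bar>u y\<bar> \<partial>lborel)" for w
      using nn_integral_lborel_translate[of "\<lambda>y. ennreal \<bar>u y\<bar>" "- (w /\<^sub>R a)"] u
      by (simp add: nn_integral_eq_integral)
    have "(\<integral>\<^sup>+y. ennreal \<bar>\<integral>w. u (y - w /\<^sub>R a) * \<psi> w \<partial>lborel\<bar> \<partial>lborel)
        \<le> ennreal (J * (\<integral>y. \<bar>u y\<bar> \<partial>lborel))"
      by (rule tonelli) (use ui[OF a] tr in auto)
    then show "(\<integral>\<^sup>+y. ennreal (norm (mollify \<psi> a u y)) \<partial>lborel) < \<infinity>"
      using a by (simp add: mollify_substitution) (meson ennreal_less_top le_less_trans)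
  qed measurable
  show "(\<lambda>k. \<integral>y. \<bar>mollify \<psi> (\<alpha> k) u y - u y\<bar> \<partial>lborel) \<longlonglongrightarrow> 0"
    if \<alpha>: "filterlim \<alpha> at_top sequentially"
  proof (rule LIMSEQ_I)
    fix e :: real assume e: "0 < e"
    obtain d where d: "d > 0"
      "\<And>h. norm h < d \<Longrightarrow> (\<integral>\<^sup>+x. ennreal \<bar>u (x + h) - u x\<bar> \<partial>lborel) \<le> ennreal (e / (2 * (J + 1)))"
      using translation_continuous_L1[OF u, of "e / (2 * (J + 1))"] e J by auto
    have "eventually (\<lambda>k. max 1 ((\<bar>\<rho>\<bar> + 1) / d) \<le> \<alpha> k) sequentially"
      using \<alpha> unfolding filterlim_at_top by blast
    then obtain k0 where k0: "\<And>k. k \<ge> k0 \<Longrightarrow> max 1 ((\<bar>\<rho>\<bar> + 1) / d) \<le> \<alpha> k"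
      by (auto simp: eventually_sequentially)
    show "\<exists>k0. \<forall>k\<ge>k0. norm ((\<integral>y. \<bar>mollify \<psi> (\<alpha> k) u y - u y\<bar> \<partial>lborel) - 0) < e"
    proof (intro exI[of _ k0] allI impI)
      fix k assume "k \<ge> k0"
      with k0 have a: "1 \<le> \<alpha> k" "(\<bar>\<rho>\<bar> + 1) / d \<le> \<alpha> k" by auto
      have a0: "0 < \<alpha> k" using a by linarith
      have small: "norm (w /\<^sub>R \<alpha> k) < d" if "norm w \<le> \<rho>" for w :: "real ^ 'n"
      proof -
        have "\<bar>\<rho>\<bar> + 1 \<le> \<alpha> k * d" using a(2) d(1) by (simp add: pos_divide_le_eq)
        with that have "norm w < \<alpha> k * d" by linarith
        then have "norm w / \<alpha> k < d" using a0 by (simp add: pos_divide_less_eq mult.commute)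
        then show ?thesis using a0 by (simp add: divide_inverse mult.commute)
      qed
      have eq: "mollify \<psi> (\<alpha> k) u y - u y = (\<integral>w. (u (y - w /\<^sub>R \<alpha> k) - u y) * \<psi> w \<partial>lborel)" for y
      proof -
        have "(\<integral>w. (u (y - w /\<^sub>R \<alpha> k) - u y) * \<psi> w \<partial>lborel)
          = (\<integral>w. u (y - w /\<^sub>R \<alpha> k) * \<psi> w \<partial>lborel) - (\<integral>w. u y * \<psi> w \<partial>lborel)"
          unfolding left_diff_distrib
          by (intro Bochner_Integration.integral_diff ui[OF a0]) (use psi_int in auto)
        then show ?thesis using int1 by (simp add: mollify_substitution a0)
      qed
      have "(\<integral>\<^sup>+y. ennreal \<bar>mollify \<psi> (\<alpha> k) u y - u y\<bar> \<partial>lborel) \<le> ennreal (J * (e / (2 * (J + 1))))"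
        unfolding eq
      proof (rule tonelli)
        show "integrable lborel (\<lambda>w. (u (y - w /\<^sub>R \<alpha> k) - u y) * \<psi> w)" for y
          unfolding left_diff_distrib
          by (intro Bochner_Integration.integrable_diff ui[OF a0]) (use psi_int in auto)
        show "(\<integral>\<^sup>+y. ennreal \<bar>u (y - w /\<^sub>R \<alpha> k) - u y\<bar> \<partial>lborel) \<le> ennreal (e / (2 * (J + 1)))"
          if "norm w \<le> \<rho>" for w
          using d(2)[of "- (w /\<^sub>R \<alpha> k)"] small[OF that] by simp
      qed (use e J in auto)
      moreover have "J * (e / (2 * (J + 1))) < e"
      proof -
        have "J * (e / (2 * (J + 1))) = e * (J / (2 * (J + 1)))" by simp
        also have "\<dots> < e * 1" using e J by (intro mult_strict_left_mono) (auto simp: field_simps)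
        finally show ?thesis by simp
      qed
      moreover have "(\<integral>\<^sup>+y. ennreal \<bar>mollify \<psi> (\<alpha> k) u y - u y\<bar> \<partial>lborel)
          = ennreal (\<integral>y. \<bar>mollify \<psi> (\<alpha> k) u y - u y\<bar> \<partial>lborel)"
        using mi[OF a0] u by (intro nn_integral_eq_integral) auto
      ultimately have "(\<integral>y. \<bar>mollify \<psi> (\<alpha> k) u y - u y\<bar> \<partial>lborel) < e"
        using e J by (auto simp: ennreal_le_iff)
      then show "norm ((\<integral>y. \<bar>mollify \<psi> (\<alpha> k) u y - u y\<bar> \<partial>lborel) - 0) < e" by simp
    qed
  qed
qed

section \<open>Averages in weighted spaces\<close>

text \<open>An indicator with radius and centre as arguments: by \<open>near_measurable\<close> it
  is jointly measurable in all three, as Tonelli's theorem requires when the centre of the ball is a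
  variable of integration.\<close>

definition near :: "real \<Rightarrow> 'a::metric_space \<Rightarrow> 'a \<Rightarrow> real" where
  "near t y x = indicator (ball y t) x"

lemma near_alt: "near t y x = (if dist y x < t then 1 else 0)"
  by (simp add: near_def indicator_def)

lemma near_nonneg [simp]: "0 \<le> near t y x"
  by (simp add: near_def)

lemma near_le_1 [simp]: "near t y x \<le> 1"
  by (simp add: near_alt)

lemma near_measurable [measurable (raw)]:
  fixes f g :: "'b \<Rightarrow> 'a::{metric_space, second_countable_topology}"
  assumes [measurable]: "f \<in> borel_measurable M" "g \<in> borel_measurable M" "h \<in> borel_measurable M"
  shows "(\<lambda>w. near (h w) (f w) (g w)) \<in> borel_measurable M"
  unfolding near_alt by measurable

lemma integrable_near:
  fixes y :: "'a::euclidean_space"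
  shows "integrable lborel (near t y)"
proof -
  have "integrable lborel (indicator (ball y t) :: 'a \<Rightarrow> real)"
    using emeasure_bounded_finite[OF bounded_ball, of y t] by (intro integrable_real_indicator) auto
  then show ?thesis by (simp add: near_def[abs_def])
qed

definition bvol :: "'n::finite itself \<Rightarrow> real \<Rightarrow> real" where
  "bvol _ t = unit_ball_vol (real CARD('n)) * t ^ CARD('n)"

lemma measure_ball_vec:
  fixes y :: "real ^ 'n::finite"
  shows "0 \<le> t \<Longrightarrow> measure lborel (ball y t) = bvol TYPE('n) t"
  by (simp add: content_ball bvol_def)

lemma integral_near:
  fixes y :: "real ^ 'n::finite"
  shows "0 \<le> t \<Longrightarrow> (\<integral>x. near t y x \<partial>lborel) = bvol TYPE('n) t"
  by (simp add: near_def measure_ball_vec)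

lemma bvol_pos: "0 < t \<Longrightarrow> 0 < bvol TYPE('n::finite) t"
  by (simp add: bvol_def)

lemma bvol_nonneg: "0 \<le> t \<Longrightarrow> 0 \<le> bvol TYPE('n::finite) t"
  by (simp add: bvol_def)

lemma bvol_mult: "bvol TYPE('n::finite) (s * t) = s ^ CARD('n) * bvol TYPE('n) t"
  by (simp add: bvol_def power_mult_distrib)

text \<open>Tonelli's theorem is applied to Borel functions, so weights are replaced by strictly positive
  Borel representatives; \<open>A\<close> is any upper bound for the characteristic.\<close>

locale borel_Ap_weight =
  fixes p A :: real and \<omega> :: "real ^ 'n::finite \<Rightarrow> real"
  assumes p: "1 < p"
    and weight_measurable [measurable]: "\<omega> \<in> borel_measurable borel"
    and weight_pos: "\<And>x. 0 < \<omega> x"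
    and weight_integrable: "\<And>x s. 0 < s \<Longrightarrow> integrable lborel (\<lambda>y. near s x y * \<omega> y)"
    and dual_integrable: "\<And>x s. 0 < s \<Longrightarrow> integrable lborel (\<lambda>y. near s x y * \<omega> y powr (1 / (1 - p)))"
    and Ap_bound: "\<And>x s. 0 < s \<Longrightarrow> (\<integral>y. near s x y * \<omega> y \<partial>lborel) *
      (\<integral>y. near s x y * \<omega> y powr (1 / (1 - p)) \<partial>lborel) powr (p - 1) \<le> A * bvol TYPE('n) s powr p"
begin

abbreviation dual :: "real ^ 'n \<Rightarrow> real" where
  "dual y \<equiv> \<omega> y powr (1 / (1 - p))"

lemma dual_powr: "dual y powr (1 - p) = \<omega> y"
  using p weight_pos[of y] by (simp add: powr_powr)

lemma A_nonneg: "0 \<le> A"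
proof -
  have "0 \<le> (\<integral>y. near 1 0 y * \<omega> y \<partial>lborel) * (\<integral>y. near 1 0 y * dual y \<partial>lborel) powr (p - 1)"
    using weight_pos by (intro mult_nonneg_nonneg integral_nonneg_AE) (auto simp: less_imp_le)
  also have "\<dots> \<le> A * bvol TYPE('n) 1 powr p" by (rule Ap_bound) simp
  finally show ?thesis using bvol_pos[where 'n='n, of 1] by (simp add: zero_le_mult_iff)
qed

lemma ball_holder:
  assumes [measurable]: "f \<in> borel_measurable borel" and f0: "\<And>x. 0 \<le> f x"
    and int: "integrable lborel (\<lambda>x. f x powr p * \<omega> x)" and s: "0 < s"
  shows "integrable lborel (\<lambda>y. near s x y * f y)"
    and "(\<integral>y. near s x y * f y \<partial>lborel) powr p \<le>
      (\<integral>y. near s x y * (f y powr p * \<omega> y) \<partial>lborel) * (\<integral>y. near s x y * dual y \<partial>lborel) powr (p - 1)"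
proof -
  have eq: "(near s x y * f y) powr p * \<omega> y = near s x y * (f y powr p * \<omega> y)" for y
    using p by (simp add: near_alt)
  have int': "integrable lborel (\<lambda>y. near s x y * (f y powr p * \<omega> y))"
    using integrable_mult_bounded[OF int, of "near s x" 1] by (simp add: mult.commute)
  have d: "0 < near s x y * dual y \<Longrightarrow> \<omega> y = (near s x y * dual y) powr (1 - p)" for y
    by (auto simp: near_alt dual_powr split: if_splits)
  have z: "near s x y * dual y = 0 \<Longrightarrow> near s x y * f y = 0" for y
    using weight_pos[of y] by simp
  note H = weighted_holder[of p "\<lambda>y. near s x y * f y" lborel "\<lambda>y. near s x y * dual y" \<omega>, OF p]
  show "integrable lborel (\<lambda>y. near s x y * f y)"
    by (rule H(1)) (use f0 d z int' dual_integrable[OF s] in \<open>auto simp: eq\<close>)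
  show "(\<integral>y. near s x y * f y \<partial>lborel) powr p \<le>
      (\<integral>y. near s x y * (f y powr p * \<omega> y) \<partial>lborel) * (\<integral>y. near s x y * dual y \<partial>lborel) powr (p - 1)"
    unfolding eq[symmetric]
    by (rule H(2)) (use f0 d z int' dual_integrable[OF s] in \<open>auto simp: eq\<close>)
qed

text \<open>Hoelder's inequality on each ball produces the factor \<open>D t y powr (p - 1)\<close>.
  After exchanging the integrals, \<open>x\<close> is fixed and \<open>y\<close> runs over
  \<open>ball x t\<close>, where \<open>ball y t\<close> lies in \<open>ball x (2 * t)\<close>;
  enlarging the integrals of \<omega> and of the dual weight to this ball yields the
  \<open>A_p\<close> product. Only one averaging operator of fixed radius is bounded here, whereas
  the maximal function involves all radii at once.\<close>

lemma ball_average: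
  assumes f[measurable]: "f \<in> borel_measurable borel" and f0: "\<And>x. 0 \<le> f x"
    and int: "integrable lborel (\<lambda>x. f x powr p * \<omega> x)" and t: "0 < t"
  shows "(\<integral>\<^sup>+y. ennreal ((\<integral>x. near t y x * f x \<partial>lborel) powr p * \<omega> y) \<partial>lborel)
    \<le> ennreal (A * bvol TYPE('n) (2 * t) powr p * (\<integral>x. f x powr p * \<omega> x \<partial>lborel))"
proof -
  let ?g = "\<lambda>x. f x powr p * \<omega> x"
  define D where "D s y = (\<integral>x. near s y x * dual x \<partial>lborel)" for s and y :: "real ^ 'n"
  have [measurable]: "D s \<in> borel_measurable borel" for s unfolding D_def by measurable
  have w0: "0 \<le> \<omega> y" for y using weight_pos[of y] by simp
  have D0: "0 \<le> D s y" for s y unfolding D_def by (auto intro!: integral_nonneg_AE)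
  have int': "integrable lborel (\<lambda>x. near t y x * ?g x)" for y
    using integrable_mult_bounded[OF int, of "near t y" 1] by (simp add: mult.commute)
  have "(\<integral>\<^sup>+y. ennreal ((\<integral>x. near t y x * f x \<partial>lborel) powr p * \<omega> y) \<partial>lborel)
    \<le> (\<integral>\<^sup>+y. (\<integral>\<^sup>+x. ennreal (near t y x * ?g x) * ennreal (D t y powr (p - 1) * \<omega> y) \<partial>lborel) \<partial>lborel)"
  proof (rule nn_integral_mono)
    fix y
    have "(\<integral>x. near t y x * f x \<partial>lborel) powr p * \<omega> y \<le>
      (\<integral>x. near t y x * ?g x \<partial>lborel) * (D t y powr (p - 1) * \<omega> y)"
      using mult_right_mono[OF ball_holder(2)[OF f f0 int t, of y] w0[of y]]
      by (simp add: D_def mult.assoc)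
    then have "ennreal ((\<integral>x. near t y x * f x \<partial>lborel) powr p * \<omega> y) \<le>
       ennreal (\<integral>x. near t y x * ?g x \<partial>lborel) * ennreal (D t y powr (p - 1) * \<omega> y)"
      using w0[of y] by (subst ennreal_mult[symmetric]) (auto intro!: ennreal_leI integral_nonneg_AE simp: w0)
    also have "ennreal (\<integral>x. near t y x * ?g x \<partial>lborel) = (\<integral>\<^sup>+x. ennreal (near t y x * ?g x) \<partial>lborel)"
      using int' w0 by (intro nn_integral_eq_integral[symmetric]) auto
    finally show "ennreal ((\<integral>x. near t y x * f x \<partial>lborel) powr p * \<omega> y)
      \<le> (\<integral>\<^sup>+x. ennreal (near t y x * ?g x) * ennreal (D t y powr (p - 1) * \<omega> y) \<partial>lborel)"
      by (subst nn_integral_multc) auto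
  qed
  also have "\<dots> = (\<integral>\<^sup>+x. (\<integral>\<^sup>+y. ennreal (near t y x * ?g x) * ennreal (D t y powr (p - 1) * \<omega> y) \<partial>lborel) \<partial>lborel)"
    by (rule lborel_pair.Fubini') measurable
  also have "\<dots> \<le> (\<integral>\<^sup>+x. ennreal (A * bvol TYPE('n) (2 * t) powr p) * ennreal (?g x) \<partial>lborel)"
  proof (rule nn_integral_mono)
    fix x
    have le: "near t y x * D t y powr (p - 1) \<le> near (2 * t) x y * D (2 * t) x powr (p - 1)" for y
    proof (cases "dist y x < t")
      case True
      have "near t y v \<le> near (2 * t) x v" for v
        using True dist_triangle[of x v y] by (auto simp: near_alt dist_commute)
      then have "D t y \<le> D (2 * t) x"
        unfolding D_def using dual_integrable t
        by (intro integral_mono) (auto intro!: mult_right_mono)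
      then have "D t y powr (p - 1) \<le> D (2 * t) x powr (p - 1)"
        using D0 p by (intro powr_mono2) auto
      moreover have "dist x y < 2 * t" using True t by (simp add: dist_commute)
      ultimately show ?thesis using True by (simp add: near_alt)
    qed (simp add: near_alt)
    have "(\<integral>\<^sup>+y. ennreal (near t y x * ?g x) * ennreal (D t y powr (p - 1) * \<omega> y) \<partial>lborel)
      \<le> (\<integral>\<^sup>+y. ennreal (?g x * D (2 * t) x powr (p - 1)) * ennreal (near (2 * t) x y * \<omega> y) \<partial>lborel)"
    proof (rule nn_integral_mono)
      fix y
      have "near t y x * ?g x * (D t y powr (p - 1) * \<omega> y)
        \<le> ?g x * D (2 * t) x powr (p - 1) * (near (2 * t) x y * \<omega> y)"
        using mult_right_mono[OF le[of y], of "?g x * \<omega> y"] w0 by (simp add: mult_ac)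
      then show "ennreal (near t y x * ?g x) * ennreal (D t y powr (p - 1) * \<omega> y) \<le>
          ennreal (?g x * D (2 * t) x powr (p - 1)) * ennreal (near (2 * t) x y * \<omega> y)"
        by (simp add: w0 ennreal_leI flip: ennreal_mult)
    qed
    also have "\<dots> = ennreal (?g x * D (2 * t) x powr (p - 1)) * ennreal (\<integral>y. near (2 * t) x y * \<omega> y \<partial>lborel)"
      using weight_integrable[of "2 * t" x] t
      by (subst nn_integral_cmult) (auto simp: nn_integral_eq_integral w0)
    also have "\<dots> = ennreal (?g x * ((\<integral>y. near (2 * t) x y * \<omega> y \<partial>lborel) * D (2 * t) x powr (p - 1)))"
      using w0 by (subst ennreal_mult[symmetric]) (auto intro!: integral_nonneg_AE simp: mult_ac)
    also have "\<dots> \<le> ennreal (?g x * (A * bvol TYPE('n) (2 * t) powr p))"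
      unfolding D_def using Ap_bound[of "2 * t" x] t w0 by (intro ennreal_leI mult_left_mono) auto
    also have "\<dots> = ennreal (A * bvol TYPE('n) (2 * t) powr p) * ennreal (?g x)"
      using w0 A_nonneg by (simp add: mult.commute flip: ennreal_mult)
    finally show "(\<integral>\<^sup>+y. ennreal (near t y x * ?g x) * ennreal (D t y powr (p - 1) * \<omega> y) \<partial>lborel)
      \<le> ennreal (A * bvol TYPE('n) (2 * t) powr p) * ennreal (?g x)" .
  qed
  also have "\<dots> = ennreal (A * bvol TYPE('n) (2 * t) powr p) * ennreal (\<integral>x. ?g x \<partial>lborel)"
    using int w0 by (subst nn_integral_cmult) (auto simp: nn_integral_eq_integral)
  also have "\<dots> = ennreal (A * bvol TYPE('n) (2 * t) powr p * (\<integral>x. ?g x \<partial>lborel))"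
    using w0 A_nonneg by (subst ennreal_mult[symmetric]) (auto intro!: integral_nonneg_AE)
  finally show ?thesis .
qed

end

text \<open>The fundamental theorem of calculus is applied to the smooth kernel for fixed
  \<open>x\<close>, and Fubini's theorem exchanges \<open>x\<close> with the position
  \<open>t\<close> on the segment. At each \<open>t\<close> the kernel is a test function in
  \<open>S\<close>, by the hypothesis \<open>seg\<close>, so the weak derivative identity replaces
  \<open>u\<close> by its gradient.\<close>

lemma mollify_line:
  fixes \<psi> :: "real ^ 'n::finite \<Rightarrow> real"
  assumes u: "integrable lborel u" and g: "\<And>i. integrable lborel (g i)"
    and psi: "smooth \<psi>" "\<And>x. r < norm x \<Longrightarrow> \<psi> x = 0"
    and weak: "\<And>i \<phi>. test_function S \<phi> \<Longrightarrow>
      (\<integral>x. u x * partial i \<phi> x \<partial>lborel) = - (\<integral>x. g i x * \<phi> x \<partial>lborel)"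
    and a: "0 < a"
    and seg: "\<And>t. 0 \<le> t \<Longrightarrow> t \<le> 1 \<Longrightarrow> cball (y + t *\<^sub>R h) (r / a) \<subseteq> S"
  shows "mollify \<psi> a u (y + h) - mollify \<psi> a u y =
    (\<integral>t. indicator {0..1} t * (\<Sum>i\<in>UNIV. h $ i * mollify \<psi> a (g i) (y + t *\<^sub>R h)) \<partial>lborel)"
proof -
  let ?c = "a ^ CARD('n)"
  have [measurable]: "u \<in> borel_measurable borel" using u by simp
  have pc: "continuous_on UNIV \<psi>" "\<And>i. continuous_on UNIV (partial i \<psi>)"
    by (intro smooth_continuous_on smooth_partial psi)+
  have [measurable]: "\<psi> \<in> borel_measurable borel" "\<And>i. partial i \<psi> \<in> borel_measurable borel"
    using pc borel_measurable_continuous_onI by blast+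
  have zero: "x \<notin> cball 0 r \<Longrightarrow> \<psi> x = 0" for x by (simp add: psi(2))
  have sup: "supp \<psi> \<subseteq> cball 0 r"
    unfolding supp_def by (rule closure_minimal) (use zero in blast, simp)
  have zero': "x \<notin> cball 0 r \<Longrightarrow> partial i \<psi> x = 0" for i x
    by (rule zero_outside_supp) (use supp_partial[of i \<psi>] sup in blast)
  obtain B where B: "\<And>x. \<bar>\<psi> x\<bar> \<le> B"
    using bounded_compact_supp[OF pc(1) compact_cball zero] by blast
  have "\<exists>B. \<forall>x. \<bar>partial i \<psi> x\<bar> \<le> B" for i
    using bounded_compact_supp[OF pc(2) compact_cball zero'] by blast
  then obtain B' where B': "\<And>i x. \<bar>partial i \<psi> x\<bar> \<le> B' i" by metis
  let ?k = "\<lambda>y x. ?c * \<psi> (a *\<^sub>R (y - x))"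
  let ?q = "\<lambda>t x. \<Sum>i\<in>UNIV. h $ i * (?c * a * partial i \<psi> (a *\<^sub>R (y + t *\<^sub>R h - x)))"
  have aff: "a *\<^sub>R (y - x) = a *\<^sub>R y + (- a *\<^sub>R x)" for x y :: "real ^ 'n"
    by (simp add: algebra_simps)
  have k_int: "integrable lborel (\<lambda>x. u x * ?k y x)" for y
    by (rule integrable_mult_bounded[OF u, where B = "?c * B"]) (use a B in \<open>auto simp: abs_mult\<close>)
  have FTC: "?k (y + h) x - ?k y x = (\<integral>t. indicator {0..1} t * ?q t x \<partial>lborel)" for x
    using line_FTC[of "\<lambda>y. ?k y x" y h]
      partial_affine[OF smooth_differentiable[OF psi(1)], where a=a and b="- a *\<^sub>R x" and c="?c"]
    by (simp add: aff fun_eq_iff continuous_intros continuous_on_compose2[OF pc(2)])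
  have qB: "\<bar>?q t x\<bar> \<le> (\<Sum>i\<in>UNIV. \<bar>h $ i\<bar> * (?c * a * B' i))" for t x
    using a B' by (intro order_trans[OF sum_abs] sum_mono) (auto simp: abs_mult intro!: mult_left_mono)
  have uq: "integrable lborel (\<lambda>x. u x * ?q t x)" for t
    by (rule integrable_mult_bounded[OF u _ qB]) measurable
  have uq_abs: "(\<integral>x. \<bar>u x * ?q t x\<bar> \<partial>lborel) \<le> (\<Sum>i\<in>UNIV. \<bar>h $ i\<bar> * (?c * a * B' i)) * (\<integral>x. \<bar>u x\<bar> \<partial>lborel)" for t
  proof -
    let ?C = "\<Sum>i\<in>UNIV. \<bar>h $ i\<bar> * (?c * a * B' i)"
    have "(\<integral>x. \<bar>u x * ?q t x\<bar> \<partial>lborel) \<le> (\<integral>x. ?C * \<bar>u x\<bar> \<partial>lborel)"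
    proof (rule integral_mono)
      show "integrable lborel (\<lambda>x. \<bar>u x * ?q t x\<bar>)" by (rule integrable_abs[OF uq])
      show "integrable lborel (\<lambda>x. ?C * \<bar>u x\<bar>)" using u by auto
      show "\<bar>u x * ?q t x\<bar> \<le> ?C * \<bar>u x\<bar>" for x
        unfolding abs_mult[of "u x"] mult.commute[of ?C] by (rule mult_left_mono[OF qB]) simp
    qed
    then show ?thesis by simp
  qed
  have fub: "integrable (lborel \<Otimes>\<^sub>M lborel) (\<lambda>(t, x). indicator {0..1::real} t * (u x * ?q t x))"
  proof (rule lborel_pair.Fubini_integrable)
    let ?C = "(\<Sum>i\<in>UNIV. \<bar>h $ i\<bar> * (?c * a * B' i)) * (\<integral>x. \<bar>u x\<bar> \<partial>lborel)"
    show "integrable lborel (\<lambda>t. \<integral>x. norm (case (t, x) of (t, x) \<Rightarrow> indicator {0..1::real} t * (u x * ?q t x)) \<partial>lborel)"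
    proof (rule Bochner_Integration.integrable_bound[of _ "\<lambda>t. indicator {0..1::real} t * ?C"])
      show "AE t in lborel. norm (\<integral>x. norm (case (t, x) of (t, x) \<Rightarrow> indicator {0..1::real} t * (u x * ?q t x)) \<partial>lborel)
         \<le> norm (indicator {0..1::real} t * ?C)"
      proof (rule AE_I2)
        fix t :: real
        show "norm (\<integral>x. norm (case (t, x) of (t, x) \<Rightarrow> indicator {0..1::real} t * (u x * ?q t x)) \<partial>lborel)
         \<le> norm (indicator {0..1::real} t * ?C)"
          using uq_abs[of t] by (cases "t \<in> {0..1}") auto
      qed
    qed auto
    show "AE t in lborel. integrable lborel (\<lambda>x. case (t, x) of (t, x) \<Rightarrow> indicator {0..1::real} t * (u x * ?q t x))"
      using uq by (intro AE_I2) auto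
  qed measurable
  have inner: "(\<integral>x. u x * ?q t x \<partial>lborel) = (\<Sum>i\<in>UNIV. h $ i * mollify \<psi> a (g i) (y + t *\<^sub>R h))"
    if t: "0 \<le> t" "t \<le> 1" for t
  proof -
    let ?y = "y + t *\<^sub>R h"
    have one: "(\<integral>x. u x * (?c * a * partial i \<psi> (a *\<^sub>R (?y - x))) \<partial>lborel) = mollify \<psi> a (g i) ?y" for i
    proof -
      have tf: "test_function S (\<lambda>x. ?k ?y x)"
        by (rule test_function_kernel[OF psi a seg[OF t]])
      have aff': "a *\<^sub>R (?y - x) = (- a) *\<^sub>R x + a *\<^sub>R ?y" for x
        by (simp add: algebra_simps)
      \<comment> \<open>Differentiating the kernel in \<open>x\<close> instead of \<open>y\<close>
        changes the sign, which cancels the sign in the weak derivative.\<close>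
      have "partial i (\<lambda>x. ?k ?y x) x = - (?c * a * partial i \<psi> (a *\<^sub>R (?y - x)))" for x
        using partial_affine(2)[OF smooth_differentiable[OF psi(1)], where a="- a" and b="a *\<^sub>R ?y" and c="?c"]
        unfolding aff' by simp
      with weak[OF tf, of i] show ?thesis by (simp add: mollify_def)
    qed
    have ii: "integrable lborel (\<lambda>x. u x * (?c * a * partial i \<psi> (a *\<^sub>R (?y - x))))" for i
      by (rule integrable_mult_bounded[OF u, where B = "?c * a * B' i"])
         (use a B' in \<open>auto simp: abs_mult\<close>)
    have "(\<integral>x. u x * ?q t x \<partial>lborel) =
      (\<integral>x. (\<Sum>i\<in>UNIV. h $ i * (u x * (?c * a * partial i \<psi> (a *\<^sub>R (?y - x))))) \<partial>lborel)"
      by (simp add: sum_distrib_left mult_ac)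
    also have "\<dots> = (\<Sum>i\<in>UNIV. h $ i * (\<integral>x. u x * (?c * a * partial i \<psi> (a *\<^sub>R (?y - x))) \<partial>lborel))"
      using ii by (subst Bochner_Integration.integral_sum) auto
    finally show ?thesis by (simp add: one)
  qed
  have "mollify \<psi> a u (y + h) - mollify \<psi> a u y = (\<integral>x. u x * (?k (y + h) x - ?k y x) \<partial>lborel)"
    unfolding mollify_def right_diff_distrib
    by (rule Bochner_Integration.integral_diff[symmetric]) (rule k_int)+
  also have "\<dots> = (\<integral>x. (\<integral>t. indicator {0..1} t * (u x * ?q t x) \<partial>lborel) \<partial>lborel)"
    unfolding FTC integral_mult_right_zero[symmetric] by (simp only: mult.left_commute)
  also have "\<dots> = (\<integral>t. (\<integral>x. indicator {0..1} t * (u x * ?q t x) \<partial>lborel) \<partial>lborel)"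
    using lborel_pair.Fubini_integral[OF fub] by simp
  also have "\<dots> = (\<integral>t. indicator {0..1} t * (\<Sum>i\<in>UNIV. h $ i * mollify \<psi> a (g i) (y + t *\<^sub>R h)) \<partial>lborel)"
  proof (rule Bochner_Integration.integral_cong[OF refl])
    fix t :: real
    show "(\<integral>x. indicator {0..1} t * (u x * ?q t x) \<partial>lborel) =
        indicator {0..1} t * (\<Sum>i\<in>UNIV. h $ i * mollify \<psi> a (g i) (y + t *\<^sub>R h))"
      by (cases "t \<in> {0..1}") (auto simp: inner)
  qed
  finally show ?thesis .
qed

section \<open>The weighted Poincare inequality\<close>

text \<open>For non-integrable \<open>f\<close> the left side is 0 by convention.\<close>

lemma ennreal_abs_integral_le:
  fixes f :: "'a \<Rightarrow> real"
  shows "ennreal \<bar>\<integral>x. f x \<partial>M\<bar> \<le> (\<integral>\<^sup>+x. ennreal \<bar>f x\<bar> \<partial>M)"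
proof (cases "integrable M f")
  case True
  from integral_norm_bound_ennreal[OF this] show ?thesis by simp
qed (simp add: not_integrable_integral_eq)

lemma nn_integral_indicator_0_1: "(\<integral>\<^sup>+t. ennreal (indicator {0<..1::real} t) \<partial>lborel) = 1"
  by (simp add: ennreal_indicator)

context borel_Ap_weight
begin

text \<open>In the proof, \<open>F a\<close> dominates the mollified gradient, \<open>H a t y\<close> is its average over the ball of
  radius \<open>2 R t\<close> around \<open>y\<close> up to a constant factor, and \<open>G a y\<close> is the integral of these averages
  over \<open>t\<close>. The mollification is removed along an almost everywhere convergent subsequence by
  Fatou's lemma, so the mollified gradients need not converge.\<close>

lemma poincare_ball_average:
  fixes u \<psi> :: "real ^ 'n \<Rightarrow> real" and g :: "'n \<Rightarrow> real ^ 'n \<Rightarrow> real"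
  assumes S: "open S" "S \<subseteq> ball z R" and \<rho>: "0 < \<rho>" "\<rho> \<le> R"
    and star: "\<And>y y' t. y \<in> S \<Longrightarrow> y' \<in> cball z \<rho> \<Longrightarrow> 0 \<le> t \<Longrightarrow> t \<le> 1 \<Longrightarrow> y + t *\<^sub>R (y' - y) \<in> S"
    and u: "integrable lborel u" and g: "\<And>i. integrable lborel (g i)"
    and weak: "\<And>i \<phi>. test_function S \<phi> \<Longrightarrow>
      (\<integral>x. u x * partial i \<phi> x \<partial>lborel) = - (\<integral>x. g i x * \<phi> x \<partial>lborel)"
    and fw: "integrable lborel (\<lambda>x. (\<Sum>i\<in>UNIV. \<bar>g i x\<bar>) powr p * \<omega> x)"
    and psi: "smooth \<psi>" "\<And>x. r < norm x \<Longrightarrow> \<psi> x = 0" "(\<integral>x. \<psi> x \<partial>lborel) = 1"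
    and M: "\<And>x. \<bar>\<psi> x\<bar> \<le> M" and r: "0 < r"
  shows "(\<integral>\<^sup>+y. ennreal (indicator S y *
        (\<bar>u y - (\<integral>y. near \<rho> z y * u y \<partial>lborel) / bvol TYPE('n) \<rho>\<bar> powr p * \<omega> y)) \<partial>lborel)
    \<le> ennreal ((2 * R / bvol TYPE('n) \<rho>) powr p * (A * bvol TYPE('n) (4 * R) powr p) *
        (A * (M * bvol TYPE('n) (4 * r)) powr p) *
        (\<integral>x. (\<Sum>i\<in>UNIV. \<bar>g i x\<bar>) powr p * \<omega> x \<partial>lborel))"
proof -
  let ?n = "CARD('n)"
  let ?V = "bvol TYPE('n)"
  define f where "f x = (\<Sum>i\<in>UNIV. \<bar>g i x\<bar>)" for x
  define E where "E = (\<integral>x. f x powr p * \<omega> x \<partial>lborel)"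
  define F where "F a y = a ^ ?n * M * (\<integral>x. near (2 * r / a) y x * f x \<partial>lborel)" for a y
  define H where "H a t y = inverse (t ^ ?n) * (\<integral>w. near (2 * R * t) y w * F a w \<partial>lborel)" for a t y
  define G where "G a y = (\<integral>t. indicator {0<..1} t * H a t y \<partial>lborel)" for a y
  define c where "c = (\<integral>y. near \<rho> z y * u y \<partial>lborel) / ?V \<rho>"
  define avg where "avg a = (\<integral>y. near \<rho> z y * mollify \<psi> a u y \<partial>lborel) / ?V \<rho>" for a
  have R: "0 < R" using \<rho> by linarith
  have M0: "0 \<le> M" using M[of 0] by linarith
  have w0: "0 \<le> \<omega> x" for x using weight_pos[of x] by simp
  have V\<rho>: "0 < ?V \<rho>" using \<rho> by (simp add: bvol_pos)
  have pc: "continuous_on UNIV \<psi>" by (rule smooth_continuous_on[OF psi(1)])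
  have [measurable]: "u \<in> borel_measurable borel" "\<And>i. g i \<in> borel_measurable borel"
    using u g by auto
  have [measurable]: "\<psi> \<in> borel_measurable borel"
    by (rule borel_measurable_continuous_onI[OF pc])
  have [measurable]: "f \<in> borel_measurable borel" unfolding f_def by measurable
  have f0: "0 \<le> f x" for x unfolding f_def by (auto intro!: sum_nonneg)
  have f_int: "integrable lborel f"
    unfolding f_def[abs_def] using g by auto
  have fw': "integrable lborel (\<lambda>x. f x powr p * \<omega> x)" using fw by (simp add: f_def)
  have E0: "0 \<le> E" unfolding E_def using w0 by (auto intro!: integral_nonneg_AE)

  \<comment> \<open>Weighted bounds for the dominating averages\<close>
  have F_measurable[measurable]: "F a \<in> borel_measurable borel" for a unfolding F_def by measurable
  have near_f: "integrable lborel (\<lambda>x. near s y x * f x)" for s y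
    using integrable_mult_bounded[OF f_int, of "near s y" 1] by (simp add: mult.commute)
  have F0: "0 \<le> F a y" if "0 < a" for a y
    unfolding F_def using that M0 f0 by (intro mult_nonneg_nonneg integral_nonneg_AE) auto
  have F_le: "F a y \<le> a ^ ?n * M * (\<integral>x. f x \<partial>lborel)" if "0 < a" for a y
    unfolding F_def using that M0 f0 f_int near_f
    by (intro mult_left_mono integral_mono) (auto intro: mult_left_le_one_le)
  have F_nn: "(\<integral>\<^sup>+y. ennreal (F a y powr p * \<omega> y) \<partial>lborel) \<le> ennreal (A * (M * ?V (4 * r)) powr p * E)"
    if a: "0 < a" for a
  proof -
    have "(\<integral>\<^sup>+y. ennreal (F a y powr p * \<omega> y) \<partial>lborel) =
      (\<integral>\<^sup>+y. ennreal ((a ^ ?n * M) powr p) * ennreal ((\<integral>x. near (2 * r / a) y x * f x \<partial>lborel) powr p * \<omega> y) \<partial>lborel)"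
    proof (intro nn_integral_cong)
      fix y
      have "0 \<le> (\<integral>x. near (2 * r / a) y x * f x \<partial>lborel)"
        using f0 by (intro integral_nonneg_AE) auto
      then show "ennreal (F a y powr p * \<omega> y) = ennreal ((a ^ ?n * M) powr p) *
          ennreal ((\<integral>x. near (2 * r / a) y x * f x \<partial>lborel) powr p * \<omega> y)"
        using a M0 w0 by (simp add: F_def powr_mult mult.assoc flip: ennreal_mult)
    qed
    also have "\<dots> \<le> ennreal ((a ^ ?n * M) powr p) * ennreal (A * ?V (2 * (2 * r / a)) powr p * E)"
    proof (subst nn_integral_cmult)
      have "(\<integral>\<^sup>+y. ennreal ((\<integral>x. near (2 * r / a) y x * f x \<partial>lborel) powr p * \<omega> y) \<partial>lborel)
        \<le> ennreal (A * ?V (2 * (2 * r / a)) powr p * E)"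
        unfolding E_def by (rule ball_average) (use a r f0 fw' in auto)
      then show "ennreal ((a ^ ?n * M) powr p) *
          (\<integral>\<^sup>+y. ennreal ((\<integral>x. near (2 * r / a) y x * f x \<partial>lborel) powr p * \<omega> y) \<partial>lborel)
        \<le> ennreal ((a ^ ?n * M) powr p) * ennreal (A * ?V (2 * (2 * r / a)) powr p * E)"
        by (rule mult_left_mono) simp
    qed measurable
    also have "\<dots> = ennreal (A * ((a ^ ?n * M) powr p * ?V (2 * (2 * r / a)) powr p) * E)"
      using A_nonneg E0 by (simp add: mult_ac flip: ennreal_mult)
    \<comment> \<open>The kernel has height \<open>a^n M\<close> on a ball of radius proportional to
      \<open>1 / a\<close>: the powers of \<open>a\<close> cancel, and the bound is uniform in the
      mollification.\<close>
    also have "(a ^ ?n * M) powr p * ?V (2 * (2 * r / a)) powr p = (M * ?V (4 * r)) powr p"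
    proof -
      have "?V (2 * (2 * r / a)) = inverse a ^ ?n * ?V (4 * r)"
        unfolding bvol_mult[symmetric] by (simp add: divide_inverse mult_ac)
      then have "(a ^ ?n * M) * ?V (2 * (2 * r / a)) = M * ?V (4 * r)"
        using a by (simp add: field_simps)
      moreover have "(a ^ ?n * M) powr p * ?V (2 * (2 * r / a)) powr p = ((a ^ ?n * M) * ?V (2 * (2 * r / a))) powr p"
        by (rule powr_mult[symmetric])
      ultimately show ?thesis by (simp only:)
    qed
    finally show ?thesis .
  qed
  have F_int: "integrable lborel (\<lambda>y. F a y powr p * \<omega> y)" if a: "0 < a" for a
    by (rule integrableI_bounded) (use F_nn[OF a] w0 in \<open>auto simp: le_less_trans[OF _ ennreal_less_top]\<close>)
  have F_E: "(\<integral>y. F a y powr p * \<omega> y \<partial>lborel) \<le> A * (M * ?V (4 * r)) powr p * E" if a: "0 < a" for a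
    using F_nn[OF a] F_int[OF a] w0 A_nonneg E0
    by (subst (asm) nn_integral_eq_integral) (auto simp: ennreal_le_iff)
  have H_measurable[measurable]: "(\<lambda>(t, y). H a t y) \<in> borel_measurable (borel \<Otimes>\<^sub>M borel)" for a
    unfolding H_def by measurable
  have near_F_int: "integrable lborel (\<lambda>w. near s y w * F a w)" if "0 < a" for s y a
    using integrable_mult_bounded[OF integrable_near, of "F a"] F_le[OF that] F0[OF that] by (auto simp: abs_of_nonneg)
  have H0: "0 \<le> H a t y" if "0 < a" "0 < t" for a t y
    unfolding H_def using F0[OF that(1)] that(2) by (intro mult_nonneg_nonneg integral_nonneg_AE) auto
  have H_le: "H a t y \<le> ?V (2 * R) * (a ^ ?n * M * (\<integral>x. f x \<partial>lborel))" if a: "0 < a" and t: "0 < t" for a t y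
  proof -
    let ?b = "a ^ ?n * M * (\<integral>x. f x \<partial>lborel)"
    have "(\<integral>w. near (2 * R * t) y w * F a w \<partial>lborel) \<le> (\<integral>w. near (2 * R * t) y w * ?b \<partial>lborel)"
      using near_F_int[OF a] integrable_near[of "2 * R * t" y] F_le[OF a]
      by (intro integral_mono) (auto intro!: mult_left_mono)
    also have "\<dots> = ?V (t * (2 * R)) * ?b"
      using R t by (simp add: integral_near mult_ac)
    finally have "H a t y \<le> inverse (t ^ ?n) * (?V (t * (2 * R)) * ?b)"
      unfolding H_def using t by (intro mult_left_mono) auto
    then show ?thesis unfolding bvol_mult using t by (simp add: field_simps)
  qed
  have ind_int: "integrable lborel (\<lambda>t. indicator {0<..1::real} t * q t)"
    if [measurable]: "q \<in> borel_measurable borel" and B: "\<And>t. 0 < t \<Longrightarrow> \<bar>q t\<bar> \<le> B" for q :: "real \<Rightarrow> real" and B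
  proof (rule Bochner_Integration.integrable_bound[of _ "\<lambda>t. indicator {0<..1::real} t * B"])
    show "AE t in lborel. norm (indicator {0<..1} t * q t) \<le> norm (indicator {0<..1} t * B)"
    proof (rule AE_I2)
      fix t :: real
      show "norm (indicator {0<..1} t * q t) \<le> norm (indicator {0<..1} t * B)"
        using B[of t] by (auto simp: indicator_def)
    qed
  qed auto
  have H_int: "integrable lborel (\<lambda>t. indicator {0<..1} t * H a t y)" if a: "0 < a" for a y
    by (rule ind_int[where B = "?V (2 * R) * (a ^ ?n * M * (\<integral>x. f x \<partial>lborel))"]) (use H_le[OF a] H0[OF a] in \<open>auto simp: abs_of_nonneg\<close>)
  have Hp_int: "integrable lborel (\<lambda>t. indicator {0<..1} t * H a t y powr p)" if a: "0 < a" for a y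
    by (rule ind_int[where B = "(?V (2 * R) * (a ^ ?n * M * (\<integral>x. f x \<partial>lborel))) powr p"]) (use H_le[OF a] H0[OF a] p in \<open>auto intro!: powr_mono2\<close>)
  have G_measurable[measurable]: "G a \<in> borel_measurable borel" for a unfolding G_def by measurable
  have G0: "0 \<le> G a y" if "0 < a" for a y
    unfolding G_def using H0[OF that] by (intro integral_nonneg_AE AE_I2) (auto simp: indicator_def)
  \<comment> \<open>Jensen's inequality on the unit interval, as the case of
    \<open>weighted_holder\<close> in which both weights equal 1 there.\<close>
  have jensen: "G a y powr p \<le> (\<integral>t. indicator {0<..1} t * H a t y powr p \<partial>lborel)" if a: "0 < a" for a y
  proof -
    have eq: "(indicator {0<..1} t * H a t y) powr p * 1 = indicator {0<..1} t * H a t y powr p" for t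
      using p by (simp add: indicator_def)
    have "G a y powr p \<le> (\<integral>t. (indicator {0<..1} t * H a t y) powr p * 1 \<partial>lborel) * (\<integral>t. indicator {0<..1::real} t \<partial>lborel) powr (p - 1)"
      unfolding G_def
    proof (rule weighted_holder(2)[OF p])
      show "0 \<le> indicator {0<..1} t * H a t y" for t
        using H0[OF a, of t y] by (auto simp: indicator_def)
      show "integrable lborel (\<lambda>t. (indicator {0<..1} t * H a t y) powr p * 1)"
        unfolding eq by (rule Hp_int[OF a])
      show "indicator {0<..1} t * H a t y = 0" if "indicator {0<..1} t = (0::real)" for t
        using that by simp
      show "1 = indicator {0<..1} t powr (1 - p)" if "0 < (indicator {0<..1} t :: real)" for t :: real
        using that by (auto simp: indicator_def split: if_splits)
    qed auto
    then show ?thesis unfolding eq by simp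
  qed
  have G_nn: "(\<integral>\<^sup>+y. ennreal (G a y powr p * \<omega> y) \<partial>lborel)
      \<le> ennreal ((A * ?V (4 * R) powr p) * (A * (M * ?V (4 * r)) powr p) * E)" if a: "0 < a" for a
  proof -
    let ?EF = "\<integral>y. F a y powr p * \<omega> y \<partial>lborel"
    have EF0: "0 \<le> ?EF" using w0 by (auto intro!: integral_nonneg_AE)
    have "(\<integral>\<^sup>+y. ennreal (G a y powr p * \<omega> y) \<partial>lborel) \<le>
      (\<integral>\<^sup>+y. (\<integral>\<^sup>+t. ennreal (indicator {0<..1} t * H a t y powr p) * ennreal (\<omega> y) \<partial>lborel) \<partial>lborel)"
    proof (rule nn_integral_mono)
      fix y
      have "G a y powr p * \<omega> y \<le> (\<integral>t. indicator {0<..1} t * H a t y powr p \<partial>lborel) * \<omega> y"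
        by (rule mult_right_mono[OF jensen[OF a] w0])
      then have "ennreal (G a y powr p * \<omega> y) \<le> ennreal (\<integral>t. indicator {0<..1} t * H a t y powr p \<partial>lborel) * ennreal (\<omega> y)"
        using w0 by (subst ennreal_mult[symmetric]) (auto intro!: ennreal_leI integral_nonneg_AE)
      also have "\<dots> = (\<integral>\<^sup>+t. ennreal (indicator {0<..1} t * H a t y powr p) \<partial>lborel) * ennreal (\<omega> y)"
        using Hp_int[OF a] by (subst nn_integral_eq_integral) auto
      also have "\<dots> = (\<integral>\<^sup>+t. ennreal (indicator {0<..1} t * H a t y powr p) * ennreal (\<omega> y) \<partial>lborel)"
        by (rule nn_integral_multc[symmetric]) measurable
      finally show "ennreal (G a y powr p * \<omega> y) \<le> \<dots>" .
    qed
    also have "\<dots> = (\<integral>\<^sup>+t. (\<integral>\<^sup>+y. ennreal (indicator {0<..1} t * H a t y powr p) * ennreal (\<omega> y) \<partial>lborel) \<partial>lborel)"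
      by (rule lborel_pair.Fubini') measurable
    also have "\<dots> \<le> (\<integral>\<^sup>+t. ennreal (A * ?V (4 * R) powr p * ?EF) * ennreal (indicator {0<..1::real} t) \<partial>lborel)"
    proof (rule nn_integral_mono)
      fix t :: real
      show "(\<integral>\<^sup>+y. ennreal (indicator {0<..1} t * H a t y powr p) * ennreal (\<omega> y) \<partial>lborel)
        \<le> ennreal (A * ?V (4 * R) powr p * ?EF) * ennreal (indicator {0<..1} t)"
      proof (cases "t \<in> {0<..1}")
        case True
        then have t: "0 < t" by simp
        have "(\<integral>\<^sup>+y. ennreal (H a t y powr p) * ennreal (\<omega> y) \<partial>lborel) =
          (\<integral>\<^sup>+y. ennreal (inverse (t ^ ?n) powr p) *
            ennreal ((\<integral>w. near (2 * R * t) y w * F a w \<partial>lborel) powr p * \<omega> y) \<partial>lborel)"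
        proof (rule nn_integral_cong)
          fix y
          have "0 \<le> (\<integral>w. near (2 * R * t) y w * F a w \<partial>lborel)"
            using F0[OF a] by (intro integral_nonneg_AE) auto
          then show "ennreal (H a t y powr p) * ennreal (\<omega> y) = ennreal (inverse (t ^ ?n) powr p) *
            ennreal ((\<integral>w. near (2 * R * t) y w * F a w \<partial>lborel) powr p * \<omega> y)"
            using t w0 by (simp add: H_def powr_mult mult.assoc flip: ennreal_mult)
        qed
        also have "\<dots> \<le> ennreal (inverse (t ^ ?n) powr p) * ennreal (A * ?V (2 * (2 * R * t)) powr p * ?EF)"
        proof (subst nn_integral_cmult)
          have "(\<integral>\<^sup>+y. ennreal ((\<integral>w. near (2 * R * t) y w * F a w \<partial>lborel) powr p * \<omega> y) \<partial>lborel)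
            \<le> ennreal (A * ?V (2 * (2 * R * t)) powr p * ?EF)"
            by (rule ball_average) (use t R F0[OF a] F_int[OF a] in auto)
          then show "ennreal (inverse (t ^ ?n) powr p) *
              (\<integral>\<^sup>+y. ennreal ((\<integral>w. near (2 * R * t) y w * F a w \<partial>lborel) powr p * \<omega> y) \<partial>lborel)
            \<le> ennreal (inverse (t ^ ?n) powr p) * ennreal (A * ?V (2 * (2 * R * t)) powr p * ?EF)"
            by (rule mult_left_mono) simp
        qed measurable
        also have "\<dots> = ennreal (A * (inverse (t ^ ?n) powr p * ?V (2 * (2 * R * t)) powr p) * ?EF)"
          using A_nonneg EF0 by (simp add: mult_ac flip: ennreal_mult)
        \<comment> \<open>The normalisation \<open>t^-n\<close> of \<open>H\<close> meets the volume
          of a ball of radius \<open>4 R t\<close>, so the bound is the same for all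
          \<open>t\<close>.\<close>
        also have "inverse (t ^ ?n) powr p * ?V (2 * (2 * R * t)) powr p = ?V (4 * R) powr p"
        proof -
          have "?V (2 * (2 * R * t)) = t ^ ?n * ?V (4 * R)"
            unfolding bvol_mult[symmetric] by (simp add: mult_ac)
          then have "inverse (t ^ ?n) * ?V (2 * (2 * R * t)) = ?V (4 * R)" using t by simp
          moreover have "inverse (t ^ ?n) powr p * ?V (2 * (2 * R * t)) powr p = (inverse (t ^ ?n) * ?V (2 * (2 * R * t))) powr p"
            by (rule powr_mult[symmetric])
          ultimately show ?thesis by simp
        qed
        finally show ?thesis using True by simp
      qed simp
    qed
    also have "\<dots> = ennreal (A * ?V (4 * R) powr p * ?EF)"
      by (subst nn_integral_cmult) (auto simp: nn_integral_indicator_0_1)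
    also have "\<dots> \<le> ennreal ((A * ?V (4 * R) powr p) * (A * (M * ?V (4 * r)) powr p) * E)"
      using mult_left_mono[OF F_E[OF a], of "A * ?V (4 * R) powr p"] A_nonneg
      by (intro ennreal_leI) (simp add: mult.assoc)
    finally show ?thesis .
  qed

  \<comment> \<open>Pointwise bound for the mollified function\<close>
  have moll_g: "(\<Sum>i\<in>UNIV. \<bar>mollify \<psi> a (g i) y\<bar>) \<le> F a y" if a: "0 < a" for a y
  proof -
    \<comment> \<open>\<open>near\<close> is an open ball, while \<psi> vanishes only for
      \<open>norm x > r\<close>; the radius \<open>2 * r / a\<close> covers the boundary as
      well.\<close>
    have pz: "a ^ ?n * \<bar>\<psi> (a *\<^sub>R (y - x))\<bar> \<le> a ^ ?n * M * near (2 * r / a) y x" for x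
    proof (cases "dist y x < 2 * r / a")
      case True
      then show ?thesis using M[of "a *\<^sub>R (y - x)"] a by (simp add: near_alt)
    next
      case False
      then have "2 * r \<le> a * norm (y - x)"
        using a by (simp add: dist_norm pos_divide_le_eq mult.commute not_less)
      then have "r < norm (a *\<^sub>R (y - x))" using r a by simp
      with psi(2) show ?thesis using False by (simp add: near_alt)
    qed
    have gi: "integrable lborel (\<lambda>x. g i x * (a ^ ?n * \<psi> (a *\<^sub>R (y - x))))" for i
      by (rule integrable_mult_bounded[OF g, where B = "a ^ ?n * M"]) (use a M in \<open>auto simp: abs_mult\<close>)
    have gi': "integrable lborel (\<lambda>x. \<bar>g i x\<bar> * (a ^ ?n * M * near (2 * r / a) y x))" for i
      by (rule integrable_mult_bounded[OF integrable_abs[OF g], where B = "a ^ ?n * M"])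
         (use a M0 in \<open>auto simp: abs_mult intro!: mult_left_le\<close>)
    have "(\<Sum>i\<in>UNIV. \<bar>mollify \<psi> a (g i) y\<bar>)
      \<le> (\<Sum>i\<in>UNIV. \<integral>x. \<bar>g i x\<bar> * (a ^ ?n * M * near (2 * r / a) y x) \<partial>lborel)"
    proof (rule sum_mono)
      fix i
      have "\<bar>mollify \<psi> a (g i) y\<bar> \<le> (\<integral>x. \<bar>g i x * (a ^ ?n * \<psi> (a *\<^sub>R (y - x)))\<bar> \<partial>lborel)"
        unfolding mollify_def by (rule integral_abs_bound)
      also have "\<dots> \<le> (\<integral>x. \<bar>g i x\<bar> * (a ^ ?n * M * near (2 * r / a) y x) \<partial>lborel)"
      proof (rule integral_mono)
        show "integrable lborel (\<lambda>x. \<bar>g i x * (a ^ ?n * \<psi> (a *\<^sub>R (y - x)))\<bar>)"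
          by (rule integrable_abs[OF gi])
        show "\<bar>g i x * (a ^ ?n * \<psi> (a *\<^sub>R (y - x)))\<bar> \<le> \<bar>g i x\<bar> * (a ^ ?n * M * near (2 * r / a) y x)" for x
          using mult_left_mono[OF pz[of x], of "\<bar>g i x\<bar>"] a by (simp add: abs_mult)
      qed (rule gi')
      finally show "\<bar>mollify \<psi> a (g i) y\<bar> \<le> \<dots>" .
    qed
    also have "\<dots> = (\<integral>x. (\<Sum>i\<in>UNIV. \<bar>g i x\<bar> * (a ^ ?n * M * near (2 * r / a) y x)) \<partial>lborel)"
      using gi' by (subst Bochner_Integration.integral_sum) auto
    also have "\<dots> = F a y"
      unfolding F_def f_def integral_mult_right_zero[symmetric]
      by (simp add: sum_distrib_left sum_distrib_right mult_ac)
    finally show ?thesis .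
  qed
  have line: "ennreal \<bar>mollify \<psi> a u (y + h) - mollify \<psi> a u y\<bar>
      \<le> (\<integral>\<^sup>+t. ennreal (norm h * (indicator {0<..1} t * F a (y + t *\<^sub>R h))) \<partial>lborel)"
    if a: "0 < a" and seg: "\<And>t. 0 \<le> t \<Longrightarrow> t \<le> 1 \<Longrightarrow> cball (y + t *\<^sub>R h) (r / a) \<subseteq> S" for a y h
  proof -
    have eq: "mollify \<psi> a u (y + h) - mollify \<psi> a u y =
        (\<integral>t. indicator {0..1} t * (\<Sum>i\<in>UNIV. h $ i * mollify \<psi> a (g i) (y + t *\<^sub>R h)) \<partial>lborel)"
      by (rule mollify_line[where S = S and r = r]) (fact u g psi weak a seg)+
    have "ennreal \<bar>mollify \<psi> a u (y + h) - mollify \<psi> a u y\<bar> \<le>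
      (\<integral>\<^sup>+t. ennreal \<bar>indicator {0..1} t * (\<Sum>i\<in>UNIV. h $ i * mollify \<psi> a (g i) (y + t *\<^sub>R h))\<bar> \<partial>lborel)"
      unfolding eq by (rule ennreal_abs_integral_le)
    also have "\<dots> \<le> (\<integral>\<^sup>+t. ennreal (norm h * (indicator {0<..1} t * F a (y + t *\<^sub>R h))) \<partial>lborel)"
    proof (rule nn_integral_mono_AE)
      \<comment> \<open>The point \<open>t = 0\<close>, where the factor
        \<open>inverse (t ^ n)\<close> of \<open>H\<close> has no meaning, is dropped here.\<close>
      have "AE t in lborel. t \<noteq> (0::real)" by (rule AE_lborel_singleton)
      then show "AE t in lborel. ennreal \<bar>indicator {0..1} t * (\<Sum>i\<in>UNIV. h $ i * mollify \<psi> a (g i) (y + t *\<^sub>R h))\<bar>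
          \<le> ennreal (norm h * (indicator {0<..1} t * F a (y + t *\<^sub>R h)))"
      proof eventually_elim
        case (elim t)
        have "\<bar>\<Sum>i\<in>UNIV. h $ i * mollify \<psi> a (g i) (y + t *\<^sub>R h)\<bar>
          \<le> (\<Sum>i\<in>UNIV. norm h * \<bar>mollify \<psi> a (g i) (y + t *\<^sub>R h)\<bar>)"
          using component_le_norm_cart[of h]
          by (intro order_trans[OF sum_abs] sum_mono) (auto simp: abs_mult intro!: mult_right_mono)
        also have "\<dots> \<le> norm h * F a (y + t *\<^sub>R h)"
          unfolding sum_distrib_left[symmetric] by (intro mult_left_mono moll_g[OF a]) simp
        finally show ?case using elim by (intro ennreal_leI) (auto simp: indicator_def)
      qed
    qed
    finally show ?thesis .
  qed
  have mi: "integrable lborel (mollify \<psi> a u)" if "0 < a" for a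
    by (rule integrable_mollify[OF u pc psi(2,3) that])
  have near_int: "integrable lborel (\<lambda>y. near \<rho> z y * v y)" if "integrable lborel v" for v
    using integrable_mult_bounded[OF that, of "near \<rho> z" 1] by (simp add: mult.commute)
  have point: "\<bar>mollify \<psi> a u y - avg a\<bar> \<le> (2 * R / ?V \<rho>) * G a y"
    if a: "0 < a" and y: "y \<in> S"
      and seg: "\<And>y' t. y' \<in> cball z \<rho> \<Longrightarrow> 0 \<le> t \<Longrightarrow> t \<le> 1 \<Longrightarrow> cball (y + t *\<^sub>R (y' - y)) (r / a) \<subseteq> S" for a y
  proof -
    let ?m = "mollify \<psi> a u"
    have "?V \<rho> * (avg a - ?m y) = (\<integral>y'. near \<rho> z y' * (?m y' - ?m y) \<partial>lborel)"
    proof -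
      have "(\<integral>y'. near \<rho> z y' * (?m y' - ?m y) \<partial>lborel)
        = (\<integral>y'. near \<rho> z y' * ?m y' \<partial>lborel) - (\<integral>y'. near \<rho> z y' * ?m y \<partial>lborel)"
        unfolding right_diff_distrib using near_int[OF mi[OF a]] integrable_near[of \<rho> z]
        by (intro Bochner_Integration.integral_diff) auto
      also have "\<dots> = (\<integral>y'. near \<rho> z y' * ?m y' \<partial>lborel) - ?V \<rho> * ?m y"
        using \<rho> by (simp add: integral_near)
      also have "\<dots> = ?V \<rho> * (avg a - ?m y)"
        using V\<rho> by (simp add: avg_def right_diff_distrib)
      finally show ?thesis ..
    qed
    moreover have "?V \<rho> * \<bar>?m y - avg a\<bar> = \<bar>?V \<rho> * (avg a - ?m y)\<bar>"
      using V\<rho> by (simp add: abs_mult abs_minus_commute)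
    ultimately have "ennreal (?V \<rho> * \<bar>?m y - avg a\<bar>) = ennreal \<bar>\<integral>y'. near \<rho> z y' * (?m y' - ?m y) \<partial>lborel\<bar>"
      by simp
    also have "\<dots> \<le> (\<integral>\<^sup>+y'. ennreal \<bar>near \<rho> z y' * (?m y' - ?m y)\<bar> \<partial>lborel)"
      by (rule ennreal_abs_integral_le)
    also have "\<dots> \<le> (\<integral>\<^sup>+y'. (\<integral>\<^sup>+t. ennreal (2 * R * (near \<rho> z y' * (indicator {0<..1} t * F a (y + t *\<^sub>R (y' - y))))) \<partial>lborel) \<partial>lborel)"
    proof (rule nn_integral_mono)
      fix y'
      show "ennreal \<bar>near \<rho> z y' * (?m y' - ?m y)\<bar>
        \<le> (\<integral>\<^sup>+t. ennreal (2 * R * (near \<rho> z y' * (indicator {0<..1} t * F a (y + t *\<^sub>R (y' - y))))) \<partial>lborel)"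
      proof (cases "dist z y' < \<rho>")
        case True
        have "dist z y < R" using y S(2) by auto
        then have nh: "norm (y' - y) \<le> 2 * R"
          using True \<rho> dist_triangle[of y' y z] by (simp add: dist_norm norm_minus_commute)
        have "ennreal \<bar>?m (y + (y' - y)) - ?m y\<bar> \<le>
          (\<integral>\<^sup>+t. ennreal (norm (y' - y) * (indicator {0<..1} t * F a (y + t *\<^sub>R (y' - y)))) \<partial>lborel)"
          by (rule line[OF a seg]) (use True in auto)
        also have "\<dots> \<le> (\<integral>\<^sup>+t. ennreal (2 * R * (indicator {0<..1} t * F a (y + t *\<^sub>R (y' - y)))) \<partial>lborel)"
          using nh F0[OF a] by (intro nn_integral_mono ennreal_leI mult_right_mono) auto
        finally show ?thesis using True by (simp add: near_alt)
      qed (simp add: near_alt)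
    qed
    also have "\<dots> = (\<integral>\<^sup>+t. (\<integral>\<^sup>+y'. ennreal (2 * R * (near \<rho> z y' * (indicator {0<..1} t * F a (y + t *\<^sub>R (y' - y))))) \<partial>lborel) \<partial>lborel)"
      by (rule lborel_pair.Fubini') measurable
    also have "\<dots> \<le> (\<integral>\<^sup>+t. ennreal (2 * R) * ennreal (indicator {0<..1} t * H a t y) \<partial>lborel)"
    proof (rule nn_integral_mono)
      fix t :: real
      show "(\<integral>\<^sup>+y'. ennreal (2 * R * (near \<rho> z y' * (indicator {0<..1} t * F a (y + t *\<^sub>R (y' - y))))) \<partial>lborel)
        \<le> ennreal (2 * R) * ennreal (indicator {0<..1} t * H a t y)"
      proof (cases "t \<in> {0<..1}")
        case True
        then have t: "0 < t" by simp
        let ?q = "\<lambda>w. ennreal (near (2 * R * t) y w * F a w)"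
        have "(\<integral>\<^sup>+y'. ennreal (2 * R * (near \<rho> z y' * F a (y + t *\<^sub>R (y' - y)))) \<partial>lborel)
          \<le> (\<integral>\<^sup>+y'. ennreal (2 * R) * ?q ((y - t *\<^sub>R y) + t *\<^sub>R y') \<partial>lborel)"
        proof (rule nn_integral_mono)
          fix y'
          \<comment> \<open>Both \<open>y\<close> and \<open>y'\<close> lie in
            \<open>ball z R\<close>, so \<open>y + t (y' - y)\<close> is within \<open>2 R t\<close>
            of \<open>y\<close>: the cut-off around \<open>z\<close> is traded for one that shrinks
            with \<open>t\<close>.\<close>
          have "near \<rho> z y' \<le> near (2 * R * t) y (y + t *\<^sub>R (y' - y))"
          proof (cases "dist z y' < \<rho>")
            case True
            have "dist z y < R" using y S(2) by auto
            then have "norm (y' - y) < 2 * R"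
              using True \<rho> dist_triangle[of y' y z] by (simp add: dist_norm norm_minus_commute)
            then have "dist y (y + t *\<^sub>R (y' - y)) < 2 * R * t" using t by (simp add: dist_norm)
            then show ?thesis by (simp add: near_alt)
          qed (simp add: near_alt)
          then have "near \<rho> z y' * F a (y + t *\<^sub>R (y' - y)) \<le> near (2 * R * t) y (y + t *\<^sub>R (y' - y)) * F a (y + t *\<^sub>R (y' - y))"
            by (rule mult_right_mono[OF _ F0[OF a]])
          then have "2 * R * (near \<rho> z y' * F a (y + t *\<^sub>R (y' - y))) \<le>
              2 * R * (near (2 * R * t) y (y + t *\<^sub>R (y' - y)) * F a (y + t *\<^sub>R (y' - y)))"
            by (rule mult_left_mono) (use R in simp)
          moreover have eq: "(y - t *\<^sub>R y) + t *\<^sub>R y' = y + t *\<^sub>R (y' - y)" by (simp add: algebra_simps)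
          ultimately show "ennreal (2 * R * (near \<rho> z y' * F a (y + t *\<^sub>R (y' - y)))) \<le>
             ennreal (2 * R) * ?q ((y - t *\<^sub>R y) + t *\<^sub>R y')"
            unfolding eq using R F0[OF a] by (simp add: ennreal_leI flip: ennreal_mult)
        qed
        also have "\<dots> = ennreal (2 * R) * (\<integral>\<^sup>+y'. ?q ((y - t *\<^sub>R y) + t *\<^sub>R y') \<partial>lborel)"
          by (rule nn_integral_cmult) measurable
        \<comment> \<open>Change of variables \<open>w = y + t (y' - y)\<close>; its Jacobian
          \<open>t^n\<close> is compensated by the normalisation of \<open>H\<close>.\<close>
        also have "(\<integral>\<^sup>+y'. ?q ((y - t *\<^sub>R y) + t *\<^sub>R y') \<partial>lborel) = ennreal (H a t y)"
        proof -
          have "ennreal (H a t y) = ennreal (inverse (t ^ ?n)) * (\<integral>\<^sup>+w. ?q w \<partial>lborel)"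
            unfolding H_def using t near_F_int[OF a] F0[OF a]
            by (subst nn_integral_eq_integral)
               (auto simp: ennreal_mult intro!: integral_nonneg_AE)
          also have "\<dots> = ennreal (inverse (t ^ ?n)) * (ennreal (t ^ ?n) * (\<integral>\<^sup>+y'. ?q ((y - t *\<^sub>R y) + t *\<^sub>R y') \<partial>lborel))"
            using t by (subst nn_integral_lborel_affine[of ?q t "y - t *\<^sub>R y"]) auto
          also have "\<dots> = (\<integral>\<^sup>+y'. ?q ((y - t *\<^sub>R y) + t *\<^sub>R y') \<partial>lborel)"
            using t by (simp add: mult.assoc[symmetric] flip: ennreal_mult)
          finally show ?thesis ..
        qed
        finally show ?thesis using True by simp
      qed simp
    qed
    also have "\<dots> = ennreal (2 * R) * ennreal (G a y)"
    proof -
      have "(\<integral>\<^sup>+t. ennreal (indicator {0<..1} t * H a t y) \<partial>lborel) = ennreal (G a y)"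
        unfolding G_def
      proof (rule nn_integral_eq_integral[OF H_int[OF a]], rule AE_I2)
        fix t :: real
        show "0 \<le> indicator {0<..1} t * H a t y"
          using H0[OF a, of t y] by (cases "t \<in> {0<..1}") auto
      qed
      then show ?thesis by (subst nn_integral_cmult) auto
    qed
    also have "\<dots> = ennreal (2 * R * G a y)" using R G0[OF a] by (simp add: ennreal_mult)
    finally have "?V \<rho> * \<bar>?m y - avg a\<bar> \<le> 2 * R * G a y"
      using R G0[OF a] by (simp add: ennreal_le_iff)
    then show ?thesis using V\<rho> by (simp add: field_simps)
  qed

  \<comment> \<open>Removing the mollification\<close>
  define \<alpha> where "\<alpha> k = real k + 1" for k
  have \<alpha>0: "0 < \<alpha> k" for k by (simp add: \<alpha>_def)
  have \<alpha>_lim: "filterlim \<alpha> at_top sequentially"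
    unfolding \<alpha>_def by (rule filterlim_at_top_mono[OF filterlim_real_sequentially]) auto
  have L1: "(\<lambda>k. \<integral>y. \<bar>mollify \<psi> (\<alpha> k) u y - u y\<bar> \<partial>lborel) \<longlonglongrightarrow> 0"
    by (rule mollify_tendsto_L1[OF u pc psi(2,3) \<alpha>_lim])
  have mu: "integrable lborel (\<lambda>y. mollify \<psi> (\<alpha> k) u y - u y)" for k
    using mi[OF \<alpha>0] u by auto
  from tendsto_L1_AE_subseq[of lborel "\<lambda>k y. mollify \<psi> (\<alpha> k) u y - u y", OF mu] L1
  obtain s where s: "strict_mono s"
    and AE: "AE y in lborel. (\<lambda>k. mollify \<psi> (\<alpha> (s k)) u y - u y) \<longlonglongrightarrow> 0" by auto
  have avg_lim: "(\<lambda>k. avg (\<alpha> k)) \<longlonglongrightarrow> c"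
  proof -
    have "(\<lambda>k. (\<integral>y. near \<rho> z y * mollify \<psi> (\<alpha> k) u y \<partial>lborel) - (\<integral>y. near \<rho> z y * u y \<partial>lborel)) \<longlonglongrightarrow> 0"
    proof (rule Lim_null_comparison[OF always_eventually L1], rule allI)
      fix k
      have "(\<integral>y. near \<rho> z y * mollify \<psi> (\<alpha> k) u y \<partial>lborel) - (\<integral>y. near \<rho> z y * u y \<partial>lborel)
        = (\<integral>y. near \<rho> z y * (mollify \<psi> (\<alpha> k) u y - u y) \<partial>lborel)"
        unfolding right_diff_distrib
        by (intro Bochner_Integration.integral_diff[symmetric] near_int mi u \<alpha>0)
      also have "norm \<dots> \<le> (\<integral>y. norm (near \<rho> z y * (mollify \<psi> (\<alpha> k) u y - u y)) \<partial>lborel)"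
        by (rule integral_norm_bound)
      also have "\<dots> \<le> (\<integral>y. \<bar>mollify \<psi> (\<alpha> k) u y - u y\<bar> \<partial>lborel)"
      proof (rule integral_mono)
        show "integrable lborel (\<lambda>y. norm (near \<rho> z y * (mollify \<psi> (\<alpha> k) u y - u y)))"
          by (rule integrable_norm[OF near_int[OF mu]])
        show "integrable lborel (\<lambda>y. \<bar>mollify \<psi> (\<alpha> k) u y - u y\<bar>)"
          by (rule integrable_abs[OF mu])
      qed (auto simp: abs_mult intro!: mult_left_le_one_le)
      finally show "norm ((\<integral>y. near \<rho> z y * mollify \<psi> (\<alpha> k) u y \<partial>lborel) - (\<integral>y. near \<rho> z y * u y \<partial>lborel))
        \<le> (\<integral>y. \<bar>mollify \<psi> (\<alpha> k) u y - u y\<bar> \<partial>lborel)" .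
    qed
    then have "(\<lambda>k. \<integral>y. near \<rho> z y * mollify \<psi> (\<alpha> k) u y \<partial>lborel) \<longlonglongrightarrow> (\<integral>y. near \<rho> z y * u y \<partial>lborel)"
      by (rule LIM_zero_cancel)
    then show ?thesis unfolding avg_def c_def using V\<rho> by (intro tendsto_divide) auto
  qed
  let ?C = "(A * ?V (4 * R) powr p) * (A * (M * ?V (4 * r)) powr p) * E"
  let ?T = "\<lambda>k y. ennreal ((2 * R / ?V \<rho>) powr p) * ennreal (G (\<alpha> (s k)) y powr p * \<omega> y)"
  have ev: "eventually (\<lambda>k. ennreal (\<bar>mollify \<psi> (\<alpha> (s k)) u y - avg (\<alpha> (s k))\<bar> powr p * \<omega> y) \<le> ?T k y) sequentially"
    if y: "y \<in> S" for y
  proof -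
    \<comment> \<open>The segments from \<open>y\<close> to the ball fill a compact subset of
      \<open>S\<close>, so one radius \<open>e\<close> surrounds all of them, and the kernels fit in
      once \<open>r / \<alpha> (s k) \<le> e\<close>. How large \<open>k\<close> must be depends on
      \<open>y\<close>, which Fatou's lemma tolerates.\<close>
    let ?K = "(\<lambda>(t, y'). y + t *\<^sub>R (y' - y)) ` ({0..1} \<times> cball z \<rho>)"
    have "compact ?K"
      by (intro compact_continuous_image compact_Times) (auto intro!: continuous_intros simp: case_prod_unfold)
    moreover have "?K \<subseteq> S" using star[OF y] by auto
    ultimately obtain e where e: "0 < e" "(\<Union>x\<in>?K. cball x e) \<subseteq> S"
      using compact_subset_open_imp_cball_epsilon_subset[OF _ S(1)] by metis
    have "eventually (\<lambda>k. r / e \<le> \<alpha> (s k)) sequentially"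
      using filterlim_compose[OF \<alpha>_lim filterlim_subseq[OF s]] unfolding filterlim_at_top by blast
    then show ?thesis
    proof eventually_elim
      case (elim k)
      let ?a = "\<alpha> (s k)"
      have re: "r / ?a \<le> e" using elim e \<alpha>0[of "s k"] by (simp add: field_simps)
      have "\<bar>mollify \<psi> ?a u y - avg ?a\<bar> \<le> (2 * R / ?V \<rho>) * G ?a y"
      proof (rule point[OF \<alpha>0 y])
        fix y' and t :: real assume "y' \<in> cball z \<rho>" "0 \<le> t" "t \<le> 1"
        then have "y + t *\<^sub>R (y' - y) \<in> ?K" by force
        then have "cball (y + t *\<^sub>R (y' - y)) e \<subseteq> S" using e(2) by blast
        then show "cball (y + t *\<^sub>R (y' - y)) (r / ?a) \<subseteq> S" using re by (meson order_trans subset_cball)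
      qed
      then have "\<bar>mollify \<psi> ?a u y - avg ?a\<bar> powr p \<le> (2 * R / ?V \<rho>) powr p * G ?a y powr p"
        using p R V\<rho> G0[OF \<alpha>0] by (subst powr_mult[symmetric]) (auto intro!: powr_mono2)
      from mult_right_mono[OF this w0[of y]] show ?case
        using w0[of y] by (simp add: mult.assoc ennreal_leI flip: ennreal_mult)
    qed
  qed
  have "(\<integral>\<^sup>+y. ennreal (indicator S y * (\<bar>u y - c\<bar> powr p * \<omega> y)) \<partial>lborel) \<le> (\<integral>\<^sup>+y. liminf (\<lambda>k. ?T k y) \<partial>lborel)"
  proof (rule nn_integral_mono_AE)
    show "AE y in lborel. ennreal (indicator S y * (\<bar>u y - c\<bar> powr p * \<omega> y)) \<le> liminf (\<lambda>k. ?T k y)"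
      using AE
    proof eventually_elim
      case (elim y)
      show ?case
      proof (cases "y \<in> S")
        case True
        have "(\<lambda>k. (mollify \<psi> (\<alpha> (s k)) u y - u y) - avg (\<alpha> (s k)) + u y) \<longlonglongrightarrow> 0 - c + u y"
          by (intro tendsto_intros elim LIMSEQ_subseq_LIMSEQ[OF avg_lim s, unfolded comp_def])
        then have "(\<lambda>k. mollify \<psi> (\<alpha> (s k)) u y - avg (\<alpha> (s k))) \<longlonglongrightarrow> u y - c" by (simp add: algebra_simps)
        then have "(\<lambda>k. ennreal (\<bar>mollify \<psi> (\<alpha> (s k)) u y - avg (\<alpha> (s k))\<bar> powr p * \<omega> y))
          \<longlonglongrightarrow> ennreal (\<bar>u y - c\<bar> powr p * \<omega> y)"
          using p by (intro tendsto_ennrealI tendsto_mult tendsto_const tendsto_powr' tendsto_rabs) auto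
        then have "ennreal (\<bar>u y - c\<bar> powr p * \<omega> y) =
           liminf (\<lambda>k. ennreal (\<bar>mollify \<psi> (\<alpha> (s k)) u y - avg (\<alpha> (s k))\<bar> powr p * \<omega> y))"
          by (intro lim_imp_Liminf[symmetric]) auto
        also have "\<dots> \<le> liminf (\<lambda>k. ?T k y)" by (rule Liminf_mono[OF ev[OF True]])
        finally show ?thesis using True by simp
      qed simp
    qed
  qed
  also have "\<dots> \<le> liminf (\<lambda>k. \<integral>\<^sup>+y. ?T k y \<partial>lborel)"
    by (rule nn_integral_liminf) measurable
  also have "\<dots> \<le> liminf (\<lambda>k. ennreal ((2 * R / ?V \<rho>) powr p * ?C))"
  proof (rule Liminf_mono[OF always_eventually], rule allI)
    fix k
    have "(\<integral>\<^sup>+y. ?T k y \<partial>lborel) = ennreal ((2 * R / ?V \<rho>) powr p) * (\<integral>\<^sup>+y. ennreal (G (\<alpha> (s k)) y powr p * \<omega> y) \<partial>lborel)"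
      by (rule nn_integral_cmult) measurable
    also have "\<dots> \<le> ennreal ((2 * R / ?V \<rho>) powr p) * ennreal ?C"
      by (intro mult_left_mono G_nn \<alpha>0) auto
    also have "\<dots> = ennreal ((2 * R / ?V \<rho>) powr p * ?C)"
      using A_nonneg E0 by (simp add: ennreal_mult)
    finally show "(\<integral>\<^sup>+y. ?T k y \<partial>lborel) \<le> ennreal ((2 * R / ?V \<rho>) powr p * ?C)" .
  qed
  also have "\<dots> = ennreal ((2 * R / ?V \<rho>) powr p * ?C)" by (simp add: Liminf_const)
  finally show ?thesis by (simp add: c_def E_def f_def mult.assoc)
qed

end

text \<open>Comparison with the largest summand. For \<open>p > 1\<close> convexity would give a
  better power of \<open>card I\<close>, but the constants are not tracked that closely.\<close>

lemma powr_sum_le: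
  fixes a :: "'a \<Rightarrow> real"
  assumes I: "finite I" and a: "\<And>i. i \<in> I \<Longrightarrow> 0 \<le> a i" and p: "0 < p"
  shows "(\<Sum>i\<in>I. a i) powr p \<le> real (card I) powr p * (\<Sum>i\<in>I. a i powr p)"
proof (cases "I = {}")
  case False
  obtain j where j: "j \<in> I" "\<And>i. i \<in> I \<Longrightarrow> a i \<le> a j"
  proof -
    have "Max (a ` I) \<in> a ` I" using I False by simp
    then obtain j where "j \<in> I" "Max (a ` I) = a j" by auto
    then show thesis using that I by (metis Max_ge finite_imageI imageI)
  qed
  have "(\<Sum>i\<in>I. a i) \<le> real (card I) * a j"
    using sum_mono[of I a "\<lambda>_. a j"] j by simp
  then have "(\<Sum>i\<in>I. a i) powr p \<le> (real (card I) * a j) powr p"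
    using p a by (intro powr_mono2) (auto intro!: sum_nonneg)
  also have "\<dots> = real (card I) powr p * a j powr p" by (rule powr_mult)
  also have "a j powr p \<le> (\<Sum>i\<in>I. a i powr p)"
    using j(1) I by (intro member_le_sum) auto
  finally show ?thesis by (simp add: mult_left_mono)
qed simp

lemma powr_add_le:
  fixes a b p :: real
  assumes "0 \<le> a" "0 \<le> b" "0 < p"
  shows "(a + b) powr p \<le> 2 powr p * (a powr p + b powr p)"
  using powr_sum_le[of "UNIV :: bool set" "\<lambda>i. if i then a else b" p] assms
  by (simp add: UNIV_bool add.commute)

lemma power_powr: "0 \<le> h \<Longrightarrow> (h ^ k) powr p = (h powr p) ^ k" for h p :: real
  by (induction k) (auto simp: powr_mult)

context borel_Ap_weight
begin

text \<open>The \<open>p\<close>-th power of the weighted norm: sums over multi-indices stay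
  additive, and the root is taken only at the very end.\<close>

definition energy :: "(real ^ 'n \<Rightarrow> real) \<Rightarrow> real" where
  "energy f = (\<integral>x. \<bar>f x\<bar> powr p * \<omega> x \<partial>lborel)"

abbreviation mass :: "real \<Rightarrow> real ^ 'n \<Rightarrow> real" where
  "mass s x \<equiv> (\<integral>y. near s x y * \<omega> y \<partial>lborel)"

lemma energy_nonneg: "0 \<le> energy f"
  unfolding energy_def using weight_pos by (auto intro!: integral_nonneg_AE simp: less_imp_le)

lemma mass_nonneg: "0 \<le> mass s x"
  using weight_pos by (auto intro!: integral_nonneg_AE simp: less_imp_le)

text \<open>Hoelder's inequality against the dual weight embeds the weighted space over a ball into
  L1, which is where mollification and weak derivatives live.\<close>

lemma supported_integrable:
  assumes [measurable]: "f \<in> borel_measurable borel" and supp: "\<And>x. x \<notin> ball z R \<Longrightarrow> f x = 0"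
    and int: "integrable lborel (\<lambda>x. \<bar>f x\<bar> powr p * \<omega> x)" and R: "0 < R"
  shows "integrable lborel f"
proof -
  have "integrable lborel (\<lambda>x. near R z x * \<bar>f x\<bar>)"
    by (rule ball_holder(1)) (use int R in auto)
  moreover have "(\<lambda>x. near R z x * \<bar>f x\<bar>) = (\<lambda>x. \<bar>f x\<bar>)"
  proof
    fix x show "near R z x * \<bar>f x\<bar> = \<bar>f x\<bar>"
      using supp[of x] by (cases "x \<in> ball z R") (auto simp: near_alt)
  qed
  ultimately have "integrable lborel (\<lambda>x. \<bar>f x\<bar>)" by simp
  then show ?thesis by (subst (asm) integrable_abs_iff) auto
qed

text \<open>Hoelder's inequality leaves a power of the integral of the dual weight, and the factor
  \<open>mass\<close> completes it to the \<open>A_p\<close> product. The left side is the energy of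
  the constant \<open>\<integral> f \<theta>\<close> on the ball, which is how means are measured
  below.\<close>

lemma kernel_bound:
  assumes [measurable]: "f \<in> borel_measurable borel" "\<theta> \<in> borel_measurable borel"
    and supp: "\<And>x. x \<notin> ball z R \<Longrightarrow> f x = 0"
    and int: "integrable lborel (\<lambda>x. \<bar>f x\<bar> powr p * \<omega> x)" and R: "0 < R"
    and B: "\<And>x. x \<in> ball z R \<Longrightarrow> \<bar>\<theta> x\<bar> \<le> B"
  shows "\<bar>\<integral>x. f x * \<theta> x \<partial>lborel\<bar> powr p * mass R z \<le> A * (B * bvol TYPE('n) R) powr p * energy f"
proof -
  have B0: "0 \<le> B" using B[of z] R by auto
  have w0: "0 \<le> \<omega> x" for x using weight_pos[of x] by simp
  let ?F = "\<integral>x. near R z x * \<bar>f x\<bar> \<partial>lborel"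
  have F: "integrable lborel (\<lambda>x. near R z x * \<bar>f x\<bar>)"
    and hold: "?F powr p \<le> (\<integral>x. near R z x * (\<bar>f x\<bar> powr p * \<omega> x) \<partial>lborel) * (\<integral>x. near R z x * dual x \<partial>lborel) powr (p - 1)"
    using ball_holder[of "\<lambda>x. \<bar>f x\<bar>", OF _ _ int R] by auto
  have near_le: "(\<integral>x. near R z x * (\<bar>f x\<bar> powr p * \<omega> x) \<partial>lborel) \<le> energy f"
    unfolding energy_def
  proof (rule integral_mono[OF _ int])
    show "integrable lborel (\<lambda>x. near R z x * (\<bar>f x\<bar> powr p * \<omega> x))"
      using integrable_mult_bounded[OF int, of "near R z" 1] by (simp add: mult.commute)
    show "near R z x * (\<bar>f x\<bar> powr p * \<omega> x) \<le> \<bar>f x\<bar> powr p * \<omega> x" for x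
      using w0[of x] by (intro mult_left_le_one_le) auto
  qed
  have "\<bar>\<integral>x. f x * \<theta> x \<partial>lborel\<bar> \<le> (\<integral>x. \<bar>f x * \<theta> x\<bar> \<partial>lborel)"
    by (rule integral_abs_bound)
  also have "\<dots> \<le> (\<integral>x. B * (near R z x * \<bar>f x\<bar>) \<partial>lborel)"
  proof (rule Bochner_Integration.integral_mono')
    show "integrable lborel (\<lambda>x. B * (near R z x * \<bar>f x\<bar>))" using F by simp
    show "\<bar>f x * \<theta> x\<bar> \<le> B * (near R z x * \<bar>f x\<bar>)" for x
      using supp[of x] mult_left_mono[OF B[of x], of "\<bar>f x\<bar>"]
      by (cases "x \<in> ball z R") (auto simp: near_alt abs_mult mult.commute)
    show "0 \<le> B * (near R z x * \<bar>f x\<bar>)" for x using B0 by simp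
  qed
  also have "\<dots> = B * ?F" by simp
  finally have "\<bar>\<integral>x. f x * \<theta> x \<partial>lborel\<bar> powr p \<le> (B * ?F) powr p"
    using p by (intro powr_mono2) auto
  also have "\<dots> = B powr p * ?F powr p" by (rule powr_mult)
  also have "\<dots> \<le> B powr p * (energy f * (\<integral>x. near R z x * dual x \<partial>lborel) powr (p - 1))"
    by (intro mult_left_mono order_trans[OF hold] mult_right_mono near_le) auto
  finally have "\<bar>\<integral>x. f x * \<theta> x \<partial>lborel\<bar> powr p * mass R z \<le>
     B powr p * (energy f * (\<integral>x. near R z x * dual x \<partial>lborel) powr (p - 1)) * mass R z"
    by (rule mult_right_mono[OF _ mass_nonneg])
  also have "\<dots> = B powr p * energy f * (mass R z * (\<integral>x. near R z x * dual x \<partial>lborel) powr (p - 1))"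
    by (simp add: mult_ac)
  also have "\<dots> \<le> B powr p * energy f * (A * bvol TYPE('n) R powr p)"
    by (intro mult_left_mono Ap_bound R mult_nonneg_nonneg energy_nonneg) simp
  also have "\<dots> = A * (B * bvol TYPE('n) R) powr p * energy f"
    by (simp add: powr_mult mult_ac)
  finally show ?thesis .
qed

text \<open>Exchanges the ball mean of the Poincare inequality for the mean against \<theta>. Since
  \<theta> has integral 1 and vanishes off \<open>S\<close>, the two means differ by the integral of
  \<open>(u - ?uB) * \<theta>\<close>, and \<open>kernel_bound\<close> estimates this again by the
  energy of \<open>u - ?uB\<close> on \<open>S\<close>. Two triangle inequalities for
  \<open>p\<close>-th powers give \<open>4 powr p\<close>.\<close>

lemma poincare_kernel:
  fixes u \<psi> \<theta> :: "real ^ 'n \<Rightarrow> real" and g :: "'n \<Rightarrow> real ^ 'n \<Rightarrow> real"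
  assumes K0_def: "K0 = (2 * C * bvol TYPE('n) (4 * C) / bvol TYPE('n) c) powr p * A * (A * (M * bvol TYPE('n) (4 * r)) powr p)"
    and S: "open S" "S \<subseteq> ball z (C * h)" and c: "0 < c" "c \<le> C" and h: "0 < h"
    and star: "\<And>y y' t. y \<in> S \<Longrightarrow> y' \<in> cball z (c * h) \<Longrightarrow> 0 \<le> t \<Longrightarrow> t \<le> 1 \<Longrightarrow> y + t *\<^sub>R (y' - y) \<in> S"
    and u: "u \<in> borel_measurable borel" "\<And>x. x \<notin> S \<Longrightarrow> u x = 0" "integrable lborel (\<lambda>x. \<bar>u x\<bar> powr p * \<omega> x)"
    and g: "\<And>i. g i \<in> borel_measurable borel" "\<And>i x. x \<notin> S \<Longrightarrow> g i x = 0"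
      "\<And>i. integrable lborel (\<lambda>x. \<bar>g i x\<bar> powr p * \<omega> x)"
    and weak: "\<And>i \<phi>. test_function S \<phi> \<Longrightarrow>
      (\<integral>x. u x * partial i \<phi> x \<partial>lborel) = - (\<integral>x. g i x * \<phi> x \<partial>lborel)"
    and psi: "smooth \<psi>" "\<And>x. r < norm x \<Longrightarrow> \<psi> x = 0" "(\<integral>x. \<psi> x \<partial>lborel) = 1"
    and M: "\<And>x. \<bar>\<psi> x\<bar> \<le> M" and r: "0 < r"
    and chi: "\<theta> \<in> borel_measurable borel" "\<And>x. \<bar>\<theta> x\<bar> \<le> B / h ^ CARD('n)" "\<And>x. x \<notin> S \<Longrightarrow> \<theta> x = 0"
      "(\<integral>x. \<theta> x \<partial>lborel) = 1"
  shows "energy u \<le> (2 powr p + 4 powr p * (A * (B * bvol TYPE('n) C) powr p)) *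
      (K0 * real CARD('n) powr p * (h powr p * (\<Sum>i\<in>UNIV. energy (g i))))
    + 4 powr p * (\<bar>\<integral>x. u x * \<theta> x \<partial>lborel\<bar> powr p * mass (C * h) z)"
proof -
  let ?V = "bvol TYPE('n)"
  note [measurable] = u(1) g(1) chi(1)
  have C: "0 < C" using c by linarith
  have R: "0 < C * h" using C h by simp
  have w0: "0 \<le> \<omega> x" for x using weight_pos[of x] by simp
  have out: "x \<notin> S" if "x \<notin> ball z (C * h)" for x using S(2) that by blast
  have [measurable]: "S \<in> sets borel" using S(1) by simp
  have u_int: "integrable lborel u"
    by (rule supported_integrable[OF u(1) _ u(3) R]) (use u(2) out in blast)
  have g_int: "integrable lborel (g i)" for i
    by (rule supported_integrable[OF g(1) _ g(3) R]) (use g(2) out in blast)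
  have gs_le: "(\<Sum>i\<in>UNIV. \<bar>g i x\<bar>) powr p * \<omega> x \<le> real CARD('n) powr p * (\<Sum>i\<in>UNIV. \<bar>g i x\<bar> powr p * \<omega> x)" for x
    using mult_right_mono[OF powr_sum_le[of UNIV "\<lambda>i. \<bar>g i x\<bar>" p] w0[of x]] p
    by (simp add: sum_distrib_right mult.assoc)
  have gs_int: "integrable lborel (\<lambda>x. real CARD('n) powr p * (\<Sum>i\<in>UNIV. \<bar>g i x\<bar> powr p * \<omega> x))"
    using g(3) by auto
  have fw: "integrable lborel (\<lambda>x. (\<Sum>i\<in>UNIV. \<bar>g i x\<bar>) powr p * \<omega> x)"
  proof (rule Bochner_Integration.integrable_bound[OF gs_int])
    show "AE x in lborel. norm ((\<Sum>i\<in>UNIV. \<bar>g i x\<bar>) powr p * \<omega> x) \<le> norm (real CARD('n) powr p * (\<Sum>i\<in>UNIV. \<bar>g i x\<bar> powr p * \<omega> x))"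
    proof (rule AE_I2)
      fix x
      have "0 \<le> (\<Sum>i\<in>UNIV. \<bar>g i x\<bar>) powr p * \<omega> x" using w0[of x] by simp
      then show "norm ((\<Sum>i\<in>UNIV. \<bar>g i x\<bar>) powr p * \<omega> x) \<le> norm (real CARD('n) powr p * (\<Sum>i\<in>UNIV. \<bar>g i x\<bar> powr p * \<omega> x))"
        using gs_le[of x] by simp
    qed
  qed measurable
  let ?uB = "(\<integral>y. near (c * h) z y * u y \<partial>lborel) / ?V (c * h)"
  let ?G = "\<integral>x. (\<Sum>i\<in>UNIV. \<bar>g i x\<bar>) powr p * \<omega> x \<partial>lborel"
  let ?f = "\<lambda>y. indicator S y * (u y - ?uB)"
  have f_eq: "\<bar>?f y\<bar> powr p * \<omega> y = indicator S y * (\<bar>u y - ?uB\<bar> powr p * \<omega> y)" for y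
    using p by (auto simp: indicator_def)
  have G_le: "?G \<le> real CARD('n) powr p * (\<Sum>i\<in>UNIV. energy (g i))"
  proof -
    have "?G \<le> (\<integral>x. real CARD('n) powr p * (\<Sum>i\<in>UNIV. \<bar>g i x\<bar> powr p * \<omega> x) \<partial>lborel)"
      by (rule integral_mono[OF fw gs_int gs_le])
    also have "\<dots> = real CARD('n) powr p * (\<Sum>i\<in>UNIV. energy (g i))"
      unfolding energy_def using g(3) by (simp add: Bochner_Integration.integral_sum)
    finally show ?thesis .
  qed
  have K0: "0 \<le> K0" unfolding K0_def using A_nonneg by auto
  have nn: "(\<integral>\<^sup>+y. ennreal (\<bar>?f y\<bar> powr p * \<omega> y) \<partial>lborel) \<le> ennreal (K0 * h powr p * ?G)"
  proof -
    have "(\<integral>\<^sup>+y. ennreal (\<bar>?f y\<bar> powr p * \<omega> y) \<partial>lborel) \<le>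
      ennreal ((2 * (C * h) / ?V (c * h)) powr p * (A * ?V (4 * (C * h)) powr p) * (A * (M * ?V (4 * r)) powr p) * ?G)"
      unfolding f_eq
      by (rule poincare_ball_average[OF S _ _ star u_int g_int weak fw psi M r]) (use c h in auto)
    also have "(2 * (C * h) / ?V (c * h)) powr p * (A * ?V (4 * (C * h)) powr p) * (A * (M * ?V (4 * r)) powr p) * ?G
       = ((2 * (C * h) / ?V (c * h)) * ?V (4 * (C * h))) powr p * A * (A * (M * ?V (4 * r)) powr p) * ?G"
      by (subst powr_mult[of _ "?V (4 * (C * h))"]) (simp only: mult_ac)
    \<comment> \<open>Both volumes scale with \<open>h^n\<close>, so only the length
      \<open>2 C h\<close> keeps a factor \<open>h\<close>.\<close>
    also have "(2 * (C * h) / ?V (c * h)) * ?V (4 * (C * h)) = (2 * C * ?V (4 * C) / ?V c) * h"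
    proof -
      have "?V (c * h) = h ^ CARD('n) * ?V c" "?V (4 * (C * h)) = h ^ CARD('n) * ?V (4 * C)"
        unfolding bvol_mult[symmetric] by (simp_all add: mult_ac)
      then show ?thesis using h by simp
    qed
    also have "((2 * C * ?V (4 * C) / ?V c) * h) powr p = (2 * C * ?V (4 * C) / ?V c) powr p * h powr p"
      by (rule powr_mult)
    finally show ?thesis unfolding K0_def by (simp only: mult_ac)
  qed
  have f_int: "integrable lborel (\<lambda>y. \<bar>?f y\<bar> powr p * \<omega> y)"
    by (rule integrableI_bounded) (use nn w0 in \<open>auto simp: le_less_trans[OF _ ennreal_less_top]\<close>)
  have D_le: "energy ?f \<le> K0 * real CARD('n) powr p * (h powr p * (\<Sum>i\<in>UNIV. energy (g i)))"
  proof -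
    have G0: "0 \<le> ?G" using w0 by (auto intro!: integral_nonneg_AE)
    have "energy ?f \<le> K0 * h powr p * ?G"
      unfolding energy_def using nn f_int w0 K0 G0
      by (subst (asm) nn_integral_eq_integral) (auto simp: ennreal_le_iff)
    also have "\<dots> \<le> K0 * h powr p * (real CARD('n) powr p * (\<Sum>i\<in>UNIV. energy (g i)))"
      using K0 by (intro mult_left_mono G_le) auto
    finally show ?thesis by (simp add: mult_ac)
  qed
  have split: "energy u \<le> 2 powr p * (energy ?f + \<bar>?uB\<bar> powr p * mass (C * h) z)"
  proof -
    have "energy u \<le> (\<integral>y. 2 powr p * (\<bar>?f y\<bar> powr p * \<omega> y + \<bar>?uB\<bar> powr p * (near (C * h) z y * \<omega> y)) \<partial>lborel)"
      unfolding energy_def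
    proof (rule integral_mono[OF u(3)])
      show "integrable lborel (\<lambda>y. 2 powr p * (\<bar>?f y\<bar> powr p * \<omega> y + \<bar>?uB\<bar> powr p * (near (C * h) z y * \<omega> y)))"
        using f_int weight_integrable[OF R] by auto
      show "\<bar>u y\<bar> powr p * \<omega> y \<le> 2 powr p * (\<bar>?f y\<bar> powr p * \<omega> y + \<bar>?uB\<bar> powr p * (near (C * h) z y * \<omega> y))" for y
      proof (cases "y \<in> S")
        case True
        then have nr: "near (C * h) z y = 1" using S(2) by (auto simp: near_alt)
        have "\<bar>a\<bar> powr p \<le> 2 powr p * (\<bar>a - b\<bar> powr p + \<bar>b\<bar> powr p)" for a b :: real
        proof -
          have "\<bar>a\<bar> powr p \<le> (\<bar>a - b\<bar> + \<bar>b\<bar>) powr p"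
            using p by (intro powr_mono2) auto
          also have "\<dots> \<le> 2 powr p * (\<bar>a - b\<bar> powr p + \<bar>b\<bar> powr p)"
            using p by (intro powr_add_le) auto
          finally show ?thesis .
        qed
        from mult_right_mono[OF this[of "u y" ?uB] w0[of y]] show ?thesis
          unfolding nr using True by (simp add: distrib_right distrib_left mult.assoc)
      next
        case False
        then show ?thesis using u(2) w0[of y] p by simp
      qed
    qed
    also have "\<dots> = 2 powr p * (energy ?f + \<bar>?uB\<bar> powr p * mass (C * h) z)"
      unfolding energy_def using f_int weight_integrable[OF R] by simp
    finally show ?thesis .
  qed
  have chi_bd: "integrable lborel (\<lambda>x. v x * \<theta> x)" if "integrable lborel v" for v
    by (rule integrable_mult_bounded[OF that _ chi(2)]) measurable
  \<comment> \<open>A non-integrable function would have integral 0, not 1.\<close>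
  have chi_int: "integrable lborel \<theta>"
    using chi(4) not_integrable_integral_eq[of lborel \<theta>] by fastforce
  have f\<theta>: "(\<integral>x. ?f x * \<theta> x \<partial>lborel) = (\<integral>x. u x * \<theta> x \<partial>lborel) - ?uB"
  proof -
    have "(\<integral>x. ?f x * \<theta> x \<partial>lborel) = (\<integral>x. u x * \<theta> x - ?uB * \<theta> x \<partial>lborel)"
      using u(2) chi(3) by (intro Bochner_Integration.integral_cong refl) (auto simp: indicator_def algebra_simps)
    also have "\<dots> = (\<integral>x. u x * \<theta> x \<partial>lborel) - ?uB * (\<integral>x. \<theta> x \<partial>lborel)"
      using chi_bd[OF u_int] chi_int by simp
    finally show ?thesis by (simp add: chi(4))
  qed
  have B: "0 \<le> B"
  proof -
    have "0 \<le> B / h ^ CARD('n)" using chi(2)[of 0] by linarith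
    then have "0 \<le> B / h ^ CARD('n) * h ^ CARD('n)"
      by (rule mult_nonneg_nonneg) (use h in simp)
    then show ?thesis using h by simp
  qed
  have kb: "\<bar>\<integral>x. ?f x * \<theta> x \<partial>lborel\<bar> powr p * mass (C * h) z \<le> A * (B * ?V C) powr p * energy ?f"
  proof -
    have "\<bar>\<integral>x. ?f x * \<theta> x \<partial>lborel\<bar> powr p * mass (C * h) z
      \<le> A * (B / h ^ CARD('n) * ?V (C * h)) powr p * energy ?f"
      by (rule kernel_bound[OF _ _ _ f_int R chi(2)]) (use out in auto)
    moreover have "B / h ^ CARD('n) * ?V (C * h) = B * ?V C"
      using h by (subst mult.commute[of C]) (simp add: bvol_mult)
    ultimately show ?thesis by simp
  qed
  have "\<bar>?uB\<bar> powr p \<le> 2 powr p * (\<bar>\<integral>x. ?f x * \<theta> x \<partial>lborel\<bar> powr p + \<bar>\<integral>x. u x * \<theta> x \<partial>lborel\<bar> powr p)"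
  proof -
    have "\<bar>?uB\<bar> \<le> \<bar>\<integral>x. ?f x * \<theta> x \<partial>lborel\<bar> + \<bar>\<integral>x. u x * \<theta> x \<partial>lborel\<bar>"
      unfolding f\<theta> by linarith
    then have "\<bar>?uB\<bar> powr p \<le> (\<bar>\<integral>x. ?f x * \<theta> x \<partial>lborel\<bar> + \<bar>\<integral>x. u x * \<theta> x \<partial>lborel\<bar>) powr p"
      using p by (intro powr_mono2) auto
    also have "\<dots> \<le> 2 powr p * (\<bar>\<integral>x. ?f x * \<theta> x \<partial>lborel\<bar> powr p + \<bar>\<integral>x. u x * \<theta> x \<partial>lborel\<bar> powr p)"
      using p by (intro powr_add_le) auto
    finally show ?thesis .
  qed
  then have "\<bar>?uB\<bar> powr p * mass (C * h) z \<le>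
      2 powr p * (\<bar>\<integral>x. ?f x * \<theta> x \<partial>lborel\<bar> powr p + \<bar>\<integral>x. u x * \<theta> x \<partial>lborel\<bar> powr p) * mass (C * h) z"
    by (rule mult_right_mono[OF _ mass_nonneg])
  also have "\<dots> = 2 powr p * (\<bar>\<integral>x. ?f x * \<theta> x \<partial>lborel\<bar> powr p * mass (C * h) z
      + \<bar>\<integral>x. u x * \<theta> x \<partial>lborel\<bar> powr p * mass (C * h) z)"
    by (simp add: algebra_simps)
  also have "\<dots> \<le> 2 powr p * (A * (B * ?V C) powr p * energy ?f
      + \<bar>\<integral>x. u x * \<theta> x \<partial>lborel\<bar> powr p * mass (C * h) z)"
    by (intro mult_left_mono add_right_mono kb) simp
  finally have uB: "\<bar>?uB\<bar> powr p * mass (C * h) z \<le> \<dots>" .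
  have "2 powr p * 2 powr p = (4 :: real) powr p"
    by (simp flip: powr_mult)
  then have four: "2 powr p * (2 powr p * x) = 4 powr p * x" for x :: real
    by (metis mult.assoc)
  have "energy u \<le> 2 powr p * (energy ?f + 2 powr p * (A * (B * ?V C) powr p * energy ?f
      + \<bar>\<integral>x. u x * \<theta> x \<partial>lborel\<bar> powr p * mass (C * h) z))"
    by (intro order_trans[OF split] mult_left_mono add_left_mono uB) simp
  also have "\<dots> = (2 powr p + 4 powr p * (A * (B * ?V C) powr p)) * energy ?f
      + 4 powr p * (\<bar>\<integral>x. u x * \<theta> x \<partial>lborel\<bar> powr p * mass (C * h) z)"
    unfolding distrib_left four by (simp add: algebra_simps)
  also have "\<dots> \<le> (2 powr p + 4 powr p * (A * (B * ?V C) powr p)) *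
      (K0 * real CARD('n) powr p * (h powr p * (\<Sum>i\<in>UNIV. energy (g i))))
    + 4 powr p * (\<bar>\<integral>x. u x * \<theta> x \<partial>lborel\<bar> powr p * mass (C * h) z)"
    using A_nonneg by (intro add_right_mono mult_left_mono D_le) auto
  finally show ?thesis .
qed

end

section \<open>Descending through the orders of differentiation\<close>

lemma mi_add_zero [simp]: "mi_add \<alpha> (\<lambda>_. 0) = \<alpha>"
  by (simp add: mi_add_def)

lemma inj_mi_add: "inj (mi_add \<alpha>)"
  by (auto simp: inj_def mi_add_def fun_eq_iff)

lemma inj_mi_unit: "inj mi_unit"
proof (rule injI)
  fix i j :: 'a assume "mi_unit i = mi_unit j"
  then have "mi_unit i i = mi_unit j i" by simp
  then show "i = j" by (auto simp: mi_unit_def split: if_splits)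
qed

lemma mi_power_zero [simp]: "mi_power y (\<lambda>_. 0) = 1"
  by (simp add: mi_power_def)

lemma mi_fact_zero [simp]: "mi_fact (\<lambda>_. 0) = 1"
  by (simp add: mi_fact_def)

lemma mi_fact_ge_1: "1 \<le> mi_fact \<alpha>"
  unfolding mi_fact_def by (rule prod_ge_1) simp

lemma abs_mi_power_le: "\<bar>mi_power y \<alpha>\<bar> \<le> norm y ^ mi_order \<alpha>"
proof -
  have "\<bar>mi_power y \<alpha>\<bar> = (\<Prod>i\<in>UNIV. \<bar>y $ i\<bar> ^ \<alpha> i)"
    by (simp add: mi_power_def abs_prod power_abs)
  also have "\<dots> \<le> (\<Prod>i\<in>UNIV. norm y ^ \<alpha> i)"
    by (intro prod_mono conjI power_mono component_le_norm_cart) auto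
  finally show ?thesis by (simp add: mi_order_def power_sum)
qed

lemma borel_measurable_mi_power [measurable]: "(\<lambda>x. mi_power (x :: real ^ 'n::finite) \<alpha>) \<in> borel_measurable borel"
proof -
  have "continuous_on UNIV (\<lambda>x :: real ^ 'n. mi_power x \<alpha>)"
    unfolding mi_power_def by (intro continuous_intros)
  then show ?thesis by (rule borel_measurable_continuous_onI)
qed

text \<open>Each member of the family is bounded by those of strictly larger order, so descending
  through the orders leaves only the top order.\<close>

lemma descending_bound:
  fixes e :: "'n::finite multi_index \<Rightarrow> real"
  assumes e0: "\<And>\<alpha>. 0 \<le> e \<alpha>" and L: "0 \<le> L"
    and step: "\<And>\<alpha>. mi_order \<alpha> \<le> m \<Longrightarrow> e \<alpha> \<le> L * (\<Sum>\<kappa> | mi_order \<alpha> < mi_order \<kappa> \<and> mi_order \<kappa> \<le> m + 1. e \<kappa>)"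
    and N: "N = real (card {\<kappa> :: 'n multi_index. mi_order \<kappa> \<le> m + 1})"
    and \<alpha>: "mi_order \<alpha> \<le> m + 1"
  shows "e \<alpha> \<le> (1 + L * N) ^ (m + 1) * (\<Sum>\<kappa> | mi_order \<kappa> = m + 1. e \<kappa>)"
proof -
  let ?T = "\<Sum>\<kappa> | mi_order \<kappa> = m + 1. e \<kappa>"
  have fin: "finite {\<kappa> :: 'n multi_index. mi_order \<kappa> \<le> m + 1}" by (rule finite_multi_index)
  have T0: "0 \<le> ?T" by (intro sum_nonneg e0)
  have N0: "0 \<le> N" by (simp add: N)
  \<comment> \<open>Strong induction on the distance \<open>d\<close> to the top order, since
    \<open>step\<close> refers to all larger orders at once.\<close>
  have main: "e \<alpha> \<le> (1 + L * N) ^ d * ?T" if "mi_order \<alpha> + d = m + 1" for d \<alpha>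
    using that
  proof (induction d arbitrary: \<alpha> rule: less_induct)
    case (less d)
    show ?case
    proof (cases d)
      case 0
      have "e \<alpha> \<le> ?T"
        by (rule member_le_sum) (use less.prems 0 e0 in \<open>auto intro: finite_subset[OF _ fin]\<close>)
      then show ?thesis using 0 by simp
    next
      case (Suc d')
      let ?X = "{\<kappa> :: 'n multi_index. mi_order \<alpha> < mi_order \<kappa> \<and> mi_order \<kappa> \<le> m + 1}"
      have bd: "e \<kappa> \<le> (1 + L * N) ^ d' * ?T" if \<kappa>: "\<kappa> \<in> ?X" for \<kappa>
      proof -
        have "e \<kappa> \<le> (1 + L * N) ^ (m + 1 - mi_order \<kappa>) * ?T"
          by (rule less.IH) (use \<kappa> less.prems in auto)
        also have "\<dots> \<le> (1 + L * N) ^ d' * ?T"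
          using \<kappa> less.prems Suc L N0 T0 by (intro mult_right_mono power_increasing) auto
        finally show ?thesis .
      qed
      have "e \<alpha> \<le> L * (\<Sum>\<kappa>\<in>?X. e \<kappa>)"
        using step[of \<alpha>] less.prems Suc by simp
      also have "\<dots> \<le> L * (\<Sum>\<kappa>\<in>?X. (1 + L * N) ^ d' * ?T)"
        by (intro mult_left_mono sum_mono bd L)
      also have "\<dots> = L * (real (card ?X) * ((1 + L * N) ^ d' * ?T))" by simp
      also have "\<dots> \<le> L * (N * ((1 + L * N) ^ d' * ?T))"
      proof -
        have "card ?X \<le> card {\<kappa> :: 'n multi_index. mi_order \<kappa> \<le> m + 1}"
          by (rule card_mono[OF fin]) auto
        then show ?thesis using L N0 T0 unfolding N
          by (intro mult_left_mono mult_right_mono mult_nonneg_nonneg) auto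
      qed
      also have "\<dots> \<le> (1 + L * N) * ((1 + L * N) ^ d' * ?T)"
        using L N0 T0 by (simp add: distrib_right mult.assoc)
      finally show ?thesis using Suc by (simp add: mult.assoc)
    qed
  qed
  have "e \<alpha> \<le> (1 + L * N) ^ (m + 1 - mi_order \<alpha>) * ?T" by (rule main) (use \<alpha> in simp)
  also have "\<dots> \<le> (1 + L * N) ^ (m + 1) * ?T"
    using L N0 T0 by (intro mult_right_mono power_increasing) auto
  finally show ?thesis .
qed

context borel_Ap_weight
begin

text \<open>In the application \<open>W \<alpha>\<close> is the weak derivative \<open>D\<^sup>\<alpha> (v - Q v)\<close>.\<close>

lemma moment_family_energy:
  fixes \<psi> \<theta> :: "real ^ 'n \<Rightarrow> real" and W :: "'n multi_index \<Rightarrow> real ^ 'n \<Rightarrow> real"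
  assumes K0_def: "K0 = (2 * C * bvol TYPE('n) (4 * C) / bvol TYPE('n) c) powr p * A * (A * (M * bvol TYPE('n) (4 * r)) powr p)"
    and N_def: "N = real (card {\<kappa> :: 'n multi_index. mi_order \<kappa> \<le> m + 1})"
    and L_def: "L = (2 powr p + 4 powr p * (A * (B * bvol TYPE('n) C) powr p)) * (K0 * real CARD('n) powr p)
      + 4 powr p * (N powr p * (A * (B * bvol TYPE('n) C * max 1 C ^ m) powr p))"
    and S: "open S" "S \<subseteq> ball z (C * h)" and c: "0 < c" "c \<le> C" and h: "0 < h"
    and star: "\<And>y y' t. y \<in> S \<Longrightarrow> y' \<in> cball z (c * h) \<Longrightarrow> 0 \<le> t \<Longrightarrow> t \<le> 1 \<Longrightarrow> y + t *\<^sub>R (y' - y) \<in> S"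
    and W: "\<And>\<kappa>. mi_order \<kappa> \<le> m + 1 \<Longrightarrow> W \<kappa> \<in> borel_measurable borel"
      "\<And>\<kappa> x. mi_order \<kappa> \<le> m + 1 \<Longrightarrow> x \<notin> S \<Longrightarrow> W \<kappa> x = 0"
      "\<And>\<kappa>. mi_order \<kappa> \<le> m + 1 \<Longrightarrow> integrable lborel (\<lambda>x. \<bar>W \<kappa> x\<bar> powr p * \<omega> x)"
    and weak: "\<And>\<alpha> i \<phi>. mi_order \<alpha> \<le> m \<Longrightarrow> test_function S \<phi> \<Longrightarrow>
      (\<integral>x. W \<alpha> x * partial i \<phi> x \<partial>lborel) = - (\<integral>x. W (mi_add \<alpha> (mi_unit i)) x * \<phi> x \<partial>lborel)"
    and moment: "\<And>\<alpha>. mi_order \<alpha> \<le> m \<Longrightarrow>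
      (\<Sum>\<beta> | mi_order \<alpha> + mi_order \<beta> \<le> m. \<integral>x. W (mi_add \<alpha> \<beta>) x * (mi_power (z - x) \<beta> / mi_fact \<beta> * \<theta> x) \<partial>lborel) = 0"
    and psi: "smooth \<psi>" "\<And>x. r < norm x \<Longrightarrow> \<psi> x = 0" "(\<integral>x. \<psi> x \<partial>lborel) = 1"
    and M: "\<And>x. \<bar>\<psi> x\<bar> \<le> M" and r: "0 < r"
    and theta: "\<theta> \<in> borel_measurable borel" "\<And>x. \<bar>\<theta> x\<bar> \<le> B / h ^ CARD('n)" "\<And>x. x \<notin> S \<Longrightarrow> \<theta> x = 0"
      "(\<integral>x. \<theta> x \<partial>lborel) = 1"
    and \<alpha>: "mi_order \<alpha> \<le> m + 1"
  shows "(h powr p) ^ mi_order \<alpha> * energy (W \<alpha>)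
    \<le> (1 + L * N) ^ (m + 1) * ((h powr p) ^ (m + 1) * (\<Sum>\<kappa> | mi_order \<kappa> = m + 1. energy (W \<kappa>)))"
proof -
  let ?V = "bvol TYPE('n)" and ?H = "h powr p" and ?D = "max 1 C ^ m"
  let ?L1 = "(2 powr p + 4 powr p * (A * (B * ?V C) powr p)) * (K0 * real CARD('n) powr p)"
  let ?L2 = "N powr p * (A * (B * ?V C * ?D) powr p)"
  \<comment> \<open>The factor \<open>h powr p\<close> per order of differentiation makes all
    energies scale alike, so that a single constant \<open>L\<close> works at every order.\<close>
  define e where "e \<kappa> = ?H ^ mi_order \<kappa> * energy (W \<kappa>)" for \<kappa>
  note [measurable] = theta(1)
  have C: "0 < C" using c by linarith
  have R: "0 < C * h" using C h by simp
  have N0: "0 \<le> N" by (simp add: N_def)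
  have B: "0 \<le> B"
  proof -
    have "0 \<le> B / h ^ CARD('n)" using theta(2)[of 0] by linarith
    then have "0 \<le> B / h ^ CARD('n) * h ^ CARD('n)"
      by (rule mult_nonneg_nonneg) (use h in simp)
    then show ?thesis using h by simp
  qed
  have K0: "0 \<le> K0" unfolding K0_def using A_nonneg by auto
  have L1: "0 \<le> ?L1" using K0 A_nonneg by auto
  have L2: "0 \<le> ?L2" using A_nonneg by auto
  have L: "0 \<le> L" unfolding L_def by (rule add_nonneg_nonneg[OF L1 mult_nonneg_nonneg[OF _ L2]]) simp
  have e0: "0 \<le> e \<kappa>" for \<kappa> unfolding e_def by (simp add: energy_nonneg)
  have fin: "finite {\<kappa> :: 'n multi_index. mi_order \<kappa> \<le> m + 1}" by (rule finite_multi_index)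
  have out: "x \<notin> S" if "x \<notin> ball z (C * h)" for x using S(2) that by blast
  have step: "e \<alpha> \<le> L * (\<Sum>\<kappa> | mi_order \<alpha> < mi_order \<kappa> \<and> mi_order \<kappa> \<le> m + 1. e \<kappa>)"
    if \<alpha>: "mi_order \<alpha> \<le> m" for \<alpha>
  proof -
    let ?X = "{\<kappa> :: 'n multi_index. mi_order \<alpha> < mi_order \<kappa> \<and> mi_order \<kappa> \<le> m + 1}"
    let ?I = "\<lambda>\<beta>. \<integral>x. W (mi_add \<alpha> \<beta>) x * (mi_power (z - x) \<beta> / mi_fact \<beta> * \<theta> x) \<partial>lborel"
    let ?Z = "{\<beta> :: 'n multi_index. mi_order \<alpha> + mi_order \<beta> \<le> m}"
    let ?J = "?Z - {\<lambda>_ :: 'n. 0}"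
    have finX: "finite ?X" by (rule finite_subset[OF _ fin]) auto
    have finJ0: "finite ?Z" by (rule finite_subset[OF _ fin]) auto
    then have finJ: "finite ?J" by simp
    have unit: "mi_order (mi_add \<alpha> (mi_unit i)) = mi_order \<alpha> + 1" for i
      by (simp add: mi_order_add)
    have P: "energy (W \<alpha>) \<le> (2 powr p + 4 powr p * (A * (B * ?V C) powr p)) *
       (K0 * real CARD('n) powr p * (?H * (\<Sum>i\<in>UNIV. energy (W (mi_add \<alpha> (mi_unit i))))))
      + 4 powr p * (\<bar>\<integral>x. W \<alpha> x * \<theta> x \<partial>lborel\<bar> powr p * mass (C * h) z)"
      by (rule poincare_kernel[OF K0_def S c h star _ _ _ _ _ _ weak[OF \<alpha>] psi M r theta])
         (use \<alpha> W unit in auto)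
    \<comment> \<open>The term for \<open>\<beta> = 0\<close> is the mean of
      \<open>W \<alpha>\<close> against \<theta>; the moment identity trades it for the terms in
      \<open>?J\<close>, all of strictly larger order.\<close>
    have "(\<lambda>_ :: 'n. 0) \<in> ?Z" unfolding mem_Collect_eq mi_order_zero add_0_right by (rule \<alpha>)
    then have "?I (\<lambda>_. 0) + (\<Sum>\<beta>\<in>?J. ?I \<beta>) = 0"
      using moment[OF \<alpha>] sum.remove[OF finJ0, of "\<lambda>_. 0" ?I] by linarith
    then have "(\<integral>x. W \<alpha> x * \<theta> x \<partial>lborel) = - (\<Sum>\<beta>\<in>?J. ?I \<beta>)" by simp
    then have "\<bar>\<integral>x. W \<alpha> x * \<theta> x \<partial>lborel\<bar> = \<bar>\<Sum>\<beta>\<in>?J. ?I \<beta>\<bar>" by (simp only: abs_minus_cancel)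
    also have "\<dots> \<le> (\<Sum>\<beta>\<in>?J. \<bar>?I \<beta>\<bar>)" by (rule sum_abs)
    finally have "\<bar>\<integral>x. W \<alpha> x * \<theta> x \<partial>lborel\<bar> \<le> (\<Sum>\<beta>\<in>?J. \<bar>?I \<beta>\<bar>)" .
    then have "\<bar>\<integral>x. W \<alpha> x * \<theta> x \<partial>lborel\<bar> powr p \<le> (\<Sum>\<beta>\<in>?J. \<bar>?I \<beta>\<bar>) powr p"
      using p by (intro powr_mono2) auto
    also have "\<dots> \<le> real (card ?J) powr p * (\<Sum>\<beta>\<in>?J. \<bar>?I \<beta>\<bar> powr p)"
      using p by (intro powr_sum_le finJ) auto
    also have "\<dots> \<le> N powr p * (\<Sum>\<beta>\<in>?J. \<bar>?I \<beta>\<bar> powr p)"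
    proof -
      have "card ?J \<le> card {\<kappa> :: 'n multi_index. mi_order \<kappa> \<le> m + 1}"
        by (rule card_mono[OF fin]) auto
      then show ?thesis using p
        by (intro mult_right_mono powr_mono2 sum_nonneg) (auto simp: N_def)
    qed
    finally have "\<bar>\<integral>x. W \<alpha> x * \<theta> x \<partial>lborel\<bar> powr p * mass (C * h) z
      \<le> N powr p * (\<Sum>\<beta>\<in>?J. \<bar>?I \<beta>\<bar> powr p) * mass (C * h) z"
      by (rule mult_right_mono[OF _ mass_nonneg])
    also have "\<dots> = N powr p * (\<Sum>\<beta>\<in>?J. \<bar>?I \<beta>\<bar> powr p * mass (C * h) z)"
      by (simp add: sum_distrib_right mult.assoc)
    also have "\<dots> \<le> N powr p * (\<Sum>\<beta>\<in>?J. A * (B * ?V C * ?D) powr p * (?H ^ mi_order \<beta> * energy (W (mi_add \<alpha> \<beta>))))"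
    proof (intro mult_left_mono sum_mono)
      fix \<beta> assume "\<beta> \<in> ?J"
      then have \<beta>: "mi_order \<alpha> + mi_order \<beta> \<le> m" by simp
      let ?B = "(C * h) ^ mi_order \<beta> * (B / h ^ CARD('n))"
      have ord: "mi_order (mi_add \<alpha> \<beta>) \<le> m + 1" using \<beta> by (simp add: mi_order_add)
      have "\<bar>?I \<beta>\<bar> powr p * mass (C * h) z \<le> A * (?B * ?V (C * h)) powr p * energy (W (mi_add \<alpha> \<beta>))"
      proof (rule kernel_bound[OF W(1)[OF ord] _ _ W(3)[OF ord] R])
        show "W (mi_add \<alpha> \<beta>) x = 0" if "x \<notin> ball z (C * h)" for x
          using W(2)[OF ord out[OF that]] .
        show "\<bar>mi_power (z - x) \<beta> / mi_fact \<beta> * \<theta> x\<bar> \<le> ?B" if "x \<in> ball z (C * h)" for x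
        proof -
          have "\<bar>mi_power (z - x) \<beta>\<bar> \<le> norm (z - x) ^ mi_order \<beta>" by (rule abs_mi_power_le)
          also have "\<dots> \<le> (C * h) ^ mi_order \<beta>"
            using that by (intro power_mono) (auto simp: dist_norm)
          finally have 1: "\<bar>mi_power (z - x) \<beta>\<bar> \<le> (C * h) ^ mi_order \<beta>" .
          have "\<bar>mi_power (z - x) \<beta>\<bar> / mi_fact \<beta> \<le> \<bar>mi_power (z - x) \<beta>\<bar>"
            using mi_fact_ge_1[of \<beta>] by (simp add: divide_le_eq mult_left_le_one_le mult_le_cancel_left1)
          with 1 have 2: "\<bar>mi_power (z - x) \<beta>\<bar> / mi_fact \<beta> \<le> (C * h) ^ mi_order \<beta>" by linarith
          have "\<bar>mi_power (z - x) \<beta> / mi_fact \<beta> * \<theta> x\<bar> = \<bar>mi_power (z - x) \<beta>\<bar> / mi_fact \<beta> * \<bar>\<theta> x\<bar>"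
            using mi_fact_ge_1[of \<beta>] by (simp add: abs_mult)
          also have "\<dots> \<le> ?B"
            using 2 theta(2)[of x] R by (intro mult_mono) auto
          finally show ?thesis .
        qed
      qed measurable
      also have "\<dots> = A * ((B * ?V C * C ^ mi_order \<beta>) powr p * (?H ^ mi_order \<beta> * energy (W (mi_add \<alpha> \<beta>))))"
      proof -
        have V: "?V (C * h) = h ^ CARD('n) * ?V C" by (subst mult.commute) (simp add: bvol_mult)
        have "?B * ?V (C * h) = (B * ?V C * C ^ mi_order \<beta>) * h ^ mi_order \<beta>"
          unfolding V using h by (simp add: power_mult_distrib)
        moreover have "(h ^ mi_order \<beta>) powr p = ?H ^ mi_order \<beta>" using h by (simp add: power_powr)
        ultimately have F: "(?B * ?V (C * h)) powr p = (B * ?V C * C ^ mi_order \<beta>) powr p * ?H ^ mi_order \<beta>"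
          by (simp only: powr_mult[of _ "h ^ mi_order \<beta>"])
        show ?thesis unfolding F by (simp only: mult.assoc)
      qed
      also have "\<dots> \<le> A * ((B * ?V C * ?D) powr p * (?H ^ mi_order \<beta> * energy (W (mi_add \<alpha> \<beta>))))"
      proof (intro mult_left_mono mult_right_mono powr_mono2 A_nonneg)
        \<comment> \<open>\<open>C\<close> may be smaller than 1, so \<open>max 1 C\<close> is used
          to cover all orders up to \<open>m\<close>.\<close>
        show "C ^ mi_order \<beta> \<le> max 1 C ^ m"
        proof -
          have "C ^ mi_order \<beta> \<le> max 1 C ^ mi_order \<beta>" using C by (intro power_mono) auto
          also have "\<dots> \<le> max 1 C ^ m" using \<beta> by (intro power_increasing) auto
          finally show ?thesis .
        qed
      qed (use B C p energy_nonneg bvol_nonneg[where 'n='n, of C] in auto)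
      finally show "\<bar>?I \<beta>\<bar> powr p * mass (C * h) z
        \<le> A * (B * ?V C * ?D) powr p * (?H ^ mi_order \<beta> * energy (W (mi_add \<alpha> \<beta>)))"
        by (simp only: mult.assoc)
    qed simp
    also have "\<dots> = ?L2 * (\<Sum>\<beta>\<in>?J. ?H ^ mi_order \<beta> * energy (W (mi_add \<alpha> \<beta>)))"
      by (simp add: sum_distrib_left mult.assoc)
    finally have Q: "\<bar>\<integral>x. W \<alpha> x * \<theta> x \<partial>lborel\<bar> powr p * mass (C * h) z \<le> \<dots>" .
    have s1: "?H ^ mi_order \<alpha> * (?H * (\<Sum>i\<in>UNIV. energy (W (mi_add \<alpha> (mi_unit i))))) \<le> (\<Sum>\<kappa>\<in>?X. e \<kappa>)"
    proof -
      \<comment> \<open>Each index of larger order is counted at most once, so the sum over shifted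
        indices is bounded by the sum over \<open>?X\<close>.\<close>
      have inj: "inj (\<lambda>i. mi_add \<alpha> (mi_unit i))"
        using inj_compose[OF inj_mi_add[of \<alpha>] inj_mi_unit] by (simp add: comp_def)
      have "?H ^ mi_order \<alpha> * (?H * (\<Sum>i\<in>UNIV. energy (W (mi_add \<alpha> (mi_unit i))))) = (\<Sum>i\<in>UNIV. e (mi_add \<alpha> (mi_unit i)))"
        unfolding e_def unit by (simp add: sum_distrib_left mult_ac)
      also have "\<dots> = (\<Sum>\<kappa>\<in>range (\<lambda>i. mi_add \<alpha> (mi_unit i)). e \<kappa>)"
        by (simp add: sum.reindex[OF inj])
      also have "\<dots> \<le> (\<Sum>\<kappa>\<in>?X. e \<kappa>)"
        using \<alpha> by (intro sum_mono2 finX e0) (auto simp: unit)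
      finally show ?thesis .
    qed
    have s2: "?H ^ mi_order \<alpha> * (\<Sum>\<beta>\<in>?J. ?H ^ mi_order \<beta> * energy (W (mi_add \<alpha> \<beta>))) \<le> (\<Sum>\<kappa>\<in>?X. e \<kappa>)"
    proof -
      have "?H ^ mi_order \<alpha> * (\<Sum>\<beta>\<in>?J. ?H ^ mi_order \<beta> * energy (W (mi_add \<alpha> \<beta>))) = (\<Sum>\<beta>\<in>?J. e (mi_add \<alpha> \<beta>))"
        unfolding e_def mi_order_add by (simp add: sum_distrib_left power_add mult_ac)
      also have "\<dots> = (\<Sum>\<kappa>\<in>mi_add \<alpha> ` ?J. e \<kappa>)"
        by (simp add: sum.reindex[OF inj_on_subset[OF inj_mi_add]])
      also have "\<dots> \<le> (\<Sum>\<kappa>\<in>?X. e \<kappa>)"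
      proof (intro sum_mono2 finX e0 subsetI)
        fix \<kappa> assume "\<kappa> \<in> mi_add \<alpha> ` ?J"
        then obtain \<beta> where "\<kappa> = mi_add \<alpha> \<beta>" "mi_order \<alpha> + mi_order \<beta> \<le> m" "\<beta> \<noteq> (\<lambda>_. 0)" by auto
        moreover from this(3) have "mi_order \<beta> \<noteq> 0" by (simp only: mi_order_eq_0_iff not_False_eq_True)
        ultimately show "\<kappa> \<in> ?X" by (simp add: mi_order_add)
      qed
      finally show ?thesis .
    qed
    let ?Y = "\<Sum>\<kappa>\<in>?X. e \<kappa>"
    have "e \<alpha> \<le> ?H ^ mi_order \<alpha> * (?L1 * (?H * (\<Sum>i\<in>UNIV. energy (W (mi_add \<alpha> (mi_unit i)))))
      + 4 powr p * (?L2 * (\<Sum>\<beta>\<in>?J. ?H ^ mi_order \<beta> * energy (W (mi_add \<alpha> \<beta>)))))"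
      unfolding e_def
    proof (rule mult_left_mono)
      have "energy (W \<alpha>) \<le> (2 powr p + 4 powr p * (A * (B * ?V C) powr p)) *
         (K0 * real CARD('n) powr p * (?H * (\<Sum>i\<in>UNIV. energy (W (mi_add \<alpha> (mi_unit i))))))
        + 4 powr p * (?L2 * (\<Sum>\<beta>\<in>?J. ?H ^ mi_order \<beta> * energy (W (mi_add \<alpha> \<beta>))))"
        by (rule order_trans[OF P]) (intro add_left_mono mult_left_mono Q, simp)
      then show "energy (W \<alpha>) \<le> ?L1 * (?H * (\<Sum>i\<in>UNIV. energy (W (mi_add \<alpha> (mi_unit i)))))
        + 4 powr p * (?L2 * (\<Sum>\<beta>\<in>?J. ?H ^ mi_order \<beta> * energy (W (mi_add \<alpha> \<beta>))))"
        by (simp only: mult.assoc)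
    qed simp
    also have "\<dots> = ?L1 * (?H ^ mi_order \<alpha> * (?H * (\<Sum>i\<in>UNIV. energy (W (mi_add \<alpha> (mi_unit i))))))
      + 4 powr p * ?L2 * (?H ^ mi_order \<alpha> * (\<Sum>\<beta>\<in>?J. ?H ^ mi_order \<beta> * energy (W (mi_add \<alpha> \<beta>))))"
      by (simp only: distrib_left mult.assoc mult.left_commute)
    also have "\<dots> \<le> ?L1 * ?Y + 4 powr p * ?L2 * ?Y"
      using L1 L2 by (intro add_mono mult_left_mono s1 s2) auto
    also have "\<dots> = L * ?Y" unfolding L_def by (simp only: distrib_right)
    finally show ?thesis .
  qed
  have "e \<alpha> \<le> (1 + L * N) ^ (m + 1) * (\<Sum>\<kappa> | mi_order \<kappa> = m + 1. e \<kappa>)"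
    by (rule descending_bound[OF e0 L step N_def \<alpha>])
  also have "(\<Sum>\<kappa> | mi_order \<kappa> = m + 1. e \<kappa>) = ?H ^ (m + 1) * (\<Sum>\<kappa> | mi_order \<kappa> = m + 1. energy (W \<kappa>))"
    by (simp add: e_def sum_distrib_left)
  finally show ?thesis by (simp add: e_def)
qed

end

section \<open>Weak derivatives and Taylor polynomials\<close>

lemma AE_lborel_negligible:
  assumes "AE x in lborel. P x"
  shows "negligible {x :: 'a::euclidean_space. \<not> P x}"
proof -
  have "AE x in lebesgue. P x" using assms by (rule AE_completion)
  then obtain N where "{x. \<not> P x} \<subseteq> N" "N \<in> null_sets lebesgue"
    unfolding eventually_ae_filter by auto
  then show ?thesis using negligible_iff_null_sets negligible_subset by blast
qed

text \<open>Weak derivatives are merely Lebesgue measurable, while Tonelli's theorem is applied to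
  Borel functions. Extension by 0 outside \<open>S\<close> also turns integrals over
  \<open>S\<close> into integrals over the whole space.\<close>

lemma borel_representative:
  fixes f :: "'a::euclidean_space \<Rightarrow> real"
  assumes "set_borel_measurable lebesgue S f" and [measurable]: "S \<in> sets borel"
  obtains f' where "f' \<in> borel_measurable borel" "\<And>x. x \<notin> S \<Longrightarrow> f' x = 0"
    "negligible {x \<in> S. f x \<noteq> f' x}"
proof -
  obtain g where [measurable]: "g \<in> borel_measurable lborel"
    and ae: "AE x in lborel. indicator S x *\<^sub>R f x = g x"
    using completion_ex_borel_measurable_real assms(1) unfolding set_borel_measurable_def by blast
  show thesis
  proof (rule that[of "\<lambda>x. indicator S x * g x"])
    show "(\<lambda>x. indicator S x * g x) \<in> borel_measurable borel" by measurable
    show "negligible {x \<in> S. f x \<noteq> indicator S x * g x}"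
      by (rule negligible_subset[OF AE_lborel_negligible[OF ae]]) auto
  qed simp
qed

text \<open>If integrability fails, both integrals are 0 by convention, so the second identity is
  unconditional.\<close>

lemma
  fixes f f' :: "'a::euclidean_space \<Rightarrow> real"
  assumes S: "S \<in> sets borel" and f': "f' \<in> borel_measurable borel" "\<And>x. x \<notin> S \<Longrightarrow> f' x = 0"
    and eq: "negligible {x \<in> S. f x \<noteq> f' x}"
  shows absolutely_integrable_rep: "f absolutely_integrable_on S \<longleftrightarrow> integrable lborel f'"
    and LINT_rep: "(LINT x:S|lebesgue. f x) = (\<integral>x. f' x \<partial>lborel)"
proof -
  have ind: "(\<lambda>x. indicator S x *\<^sub>R f' x) = f'"
  proof
    fix x show "indicator S x *\<^sub>R f' x = f' x" by (cases "x \<in> S") (simp_all add: f'(2))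
  qed
  have f'_int: "f' absolutely_integrable_on S \<longleftrightarrow> integrable lborel f'"
    unfolding set_integrable_def ind using f'(1) by (simp add: integrable_completion)
  show int: "f absolutely_integrable_on S \<longleftrightarrow> integrable lborel f'"
    unfolding f'_int[symmetric] by (rule absolutely_integrable_spike_eq[OF eq]) auto
  show "(LINT x:S|lebesgue. f x) = (\<integral>x. f' x \<partial>lborel)"
  proof (cases "integrable lborel f'")
    case True
    have "(LINT x:S|lebesgue. f x) = integral S f"
      using True int by (intro set_lebesgue_integral_eq_integral) simp
    also have "\<dots> = integral S f'" by (rule integral_spike[OF eq]) auto
    also have "\<dots> = (LINT x:S|lebesgue. f' x)"
      using True f'_int by (intro set_lebesgue_integral_eq_integral(2)[symmetric]) simp
    also have "\<dots> = (\<integral>x. f' x \<partial>lborel)"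
      unfolding set_lebesgue_integral_def ind using f'(1) by (simp add: integral_completion)
    finally show ?thesis .
  next
    case False
    with int have "\<not> f absolutely_integrable_on S" by simp
    then have "(LINT x:S|lebesgue. f x) = 0"
      unfolding set_integrable_def set_lebesgue_integral_def by (rule not_integrable_integral_eq)
    with False show ?thesis by (simp add: not_integrable_integral_eq)
  qed
qed

lemma LINT_rep_mult:
  fixes f f' k :: "'a::euclidean_space \<Rightarrow> real"
  assumes S: "S \<in> sets borel" and f'[measurable]: "f' \<in> borel_measurable borel" and z: "\<And>x. x \<notin> S \<Longrightarrow> f' x = 0"
    and eq: "negligible {x \<in> S. f x \<noteq> f' x}" and [measurable]: "k \<in> borel_measurable borel"
  shows "(LINT x:S|lebesgue. f x * k x) = (\<integral>x. f' x * k x \<partial>lborel)"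
  by (rule LINT_rep[OF S]) (use z in \<open>auto intro: negligible_subset[OF eq]\<close>)

lemma absolutely_integrable_imp_locally:
  "f absolutely_integrable_on S \<Longrightarrow> locally_integrable_on f S"
  unfolding locally_integrable_on_def
  by (auto intro: set_integrable_subset simp: lmeasurable_compact fmeasurableD)

text \<open>The fundamental lemma of the calculus of variations: at a point of \<open>S\<close> the
  mollification kernels are eventually test functions in \<open>S\<close>, so the mollifications of
  \<open>f\<close> vanish there, while a subsequence converges to \<open>f\<close> almost
  everywhere.\<close>

lemma vanishing_weakly:
  fixes f \<psi> :: "real ^ 'n::finite \<Rightarrow> real"
  assumes f: "integrable lborel f" and S: "open S"
    and zero: "\<And>\<phi>. test_function S \<phi> \<Longrightarrow> (\<integral>x. f x * \<phi> x \<partial>lborel) = 0"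
    and psi: "smooth \<psi>" "\<And>x. r < norm x \<Longrightarrow> \<psi> x = 0" "(\<integral>x. \<psi> x \<partial>lborel) = 1" and r: "0 < r"
  shows "negligible {x \<in> S. f x \<noteq> 0}"
proof -
  define \<alpha> where "\<alpha> k = real k + 1" for k
  have \<alpha>0: "0 < \<alpha> k" for k by (simp add: \<alpha>_def)
  have \<alpha>_lim: "filterlim \<alpha> at_top sequentially"
    unfolding \<alpha>_def by (rule filterlim_at_top_mono[OF filterlim_real_sequentially]) auto
  have pc: "continuous_on UNIV \<psi>" by (rule smooth_continuous_on[OF psi(1)])
  have L1: "(\<lambda>k. \<integral>y. \<bar>mollify \<psi> (\<alpha> k) f y - f y\<bar> \<partial>lborel) \<longlonglongrightarrow> 0"
    by (rule mollify_tendsto_L1[OF f pc psi(2,3) \<alpha>_lim])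
  have mu: "integrable lborel (\<lambda>y. mollify \<psi> (\<alpha> k) f y - f y)" for k
    using integrable_mollify[OF f pc psi(2,3) \<alpha>0] f by auto
  from tendsto_L1_AE_subseq[of lborel "\<lambda>k y. mollify \<psi> (\<alpha> k) f y - f y", OF mu] L1
  obtain s where s: "strict_mono s"
    and AE: "AE y in lborel. (\<lambda>k. mollify \<psi> (\<alpha> (s k)) f y - f y) \<longlonglongrightarrow> 0" by auto
  have "AE y in lborel. y \<in> S \<longrightarrow> f y = 0"
    using AE
  proof eventually_elim
    case (elim y)
    show ?case
    proof
      assume y: "y \<in> S"
      obtain e where e: "0 < e" "cball y e \<subseteq> S" using S y open_contains_cball by blast
      have "eventually (\<lambda>k. r / e \<le> \<alpha> (s k)) sequentially"
        using filterlim_compose[OF \<alpha>_lim filterlim_subseq[OF s]] unfolding filterlim_at_top by blast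
      then have "eventually (\<lambda>k. mollify \<psi> (\<alpha> (s k)) f y - f y = - f y) sequentially"
      proof eventually_elim
        case (elim k)
        have re: "r / \<alpha> (s k) \<le> e" using elim e \<alpha>0[of "s k"] by (simp add: field_simps)
        have "test_function S (\<lambda>x. \<alpha> (s k) ^ CARD('n) * \<psi> (\<alpha> (s k) *\<^sub>R (y - x)))"
        proof (rule test_function_kernel[OF psi(1,2) \<alpha>0])
          show "cball y (r / \<alpha> (s k)) \<subseteq> S" using e(2) re by (meson order_trans subset_cball)
        qed
        from zero[OF this] show ?case by (simp add: mollify_def)
      qed
      from tendsto_eventually[OF this] elim have "- f y = 0"
        using LIMSEQ_unique by blast
      then show "f y = 0" by simp
    qed
  qed
  from AE_lborel_negligible[OF this] show ?thesis by (rule negligible_subset) auto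
qed

lemma test_function_mono: "test_function D \<phi> \<Longrightarrow> D \<subseteq> D' \<Longrightarrow> test_function D' \<phi>"
  by (auto simp: test_function_def)

lemma test_function_zero: "test_function D \<phi> \<Longrightarrow> x \<notin> D \<Longrightarrow> \<phi> x = 0"
  unfolding test_function_def using zero_outside_supp by blast

lemma test_function_continuous: "test_function D \<phi> \<Longrightarrow> continuous_on UNIV \<phi>"
  unfolding test_function_def using smooth_continuous_on by blast

lemma test_function_borel: "test_function D \<phi> \<Longrightarrow> \<phi> \<in> borel_measurable borel"
  by (intro borel_measurable_continuous_onI test_function_continuous)

lemma test_function_bounded: "test_function D \<phi> \<Longrightarrow> \<exists>B>0. \<forall>x. \<bar>\<phi> x\<bar> \<le> B"
  by (rule bounded_compact_supp[of _ "supp \<phi>"])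
     (auto simp: test_function_continuous test_function_def zero_outside_supp)

text \<open>\<open>weak_deriv\<close> is a choice by \<open>SOME\<close>; uniqueness identifies it
  with any known weak derivative. Only local integrability is available, so the difference is tested
  ball by ball and the null sets are assembled by \<open>locally_negligible_alt\<close>.\<close>

lemma weak_deriv_unique:
  fixes g g' \<psi> :: "real ^ 'n::finite \<Rightarrow> real"
  assumes g: "has_weak_deriv S \<kappa> u g" and g': "has_weak_deriv S \<kappa> u g'" and S: "open S"
    and psi: "smooth \<psi>" "\<And>x. r < norm x \<Longrightarrow> \<psi> x = 0" "(\<integral>x. \<psi> x \<partial>lborel) = 1" and r: "0 < r"
  shows "negligible {x \<in> S. g x \<noteq> g' x}"
proof (rule locally_negligible_alt[THEN iffD2], rule ballI)
  fix x assume x: "x \<in> {x \<in> S. g x \<noteq> g' x}"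
  then obtain e where e: "0 < e" "cball x e \<subseteq> S" using S open_contains_cball by blast
  let ?K = "cball x e"
  have gi: "g absolutely_integrable_on ?K" "g' absolutely_integrable_on ?K"
    using g g' e(2) unfolding has_weak_deriv_def locally_integrable_on_def by auto
  then have d: "(\<lambda>y. g y - g' y) absolutely_integrable_on ?K"
    by (rule set_integral_diff(1))
  then have "set_borel_measurable lebesgue ?K (\<lambda>y. g y - g' y)"
    unfolding set_integrable_def set_borel_measurable_def by (rule borel_measurable_integrable)
  then obtain f where f: "f \<in> borel_measurable borel" "\<And>y. y \<notin> ?K \<Longrightarrow> f y = 0"
    "negligible {y \<in> ?K. g y - g' y \<noteq> f y}"
    by (rule borel_representative) auto
  have f_int: "integrable lborel f"
    using absolutely_integrable_rep[OF _ f] d by simp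
  have "(\<integral>y. f y * \<phi> y \<partial>lborel) = 0" if \<phi>: "test_function (ball x e) \<phi>" for \<phi>
  proof -
    have [measurable]: "\<phi> \<in> borel_measurable borel" by (rule test_function_borel[OF \<phi>])
    obtain B where B: "\<And>x. \<bar>\<phi> x\<bar> \<le> B" using test_function_bounded[OF \<phi>] by blast
    have z: "\<phi> y = 0" if "y \<notin> ?K" for y
      using test_function_zero[OF \<phi>, of y] that by auto
    have int: "(\<lambda>y. q y * \<phi> y) absolutely_integrable_on ?K" if "q absolutely_integrable_on ?K" for q
    proof -
      have "integrable lebesgue (\<lambda>y. (indicator ?K y *\<^sub>R q y) * \<phi> y)"
        by (rule integrable_mult_bounded[OF _ _ B])
           (use that in \<open>auto simp: set_integrable_def intro: measurable_completion\<close>)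
      then show ?thesis by (simp add: set_integrable_def mult.assoc)
    qed
    have restr: "(LINT y:S|lebesgue. q y * \<phi> y) = (LINT y:?K|lebesgue. q y * \<phi> y)" for q
      unfolding set_lebesgue_integral_def
      using z e(2) by (intro Bochner_Integration.integral_cong refl) (auto simp: indicator_def)
    have \<phi>S: "test_function S \<phi>" by (rule test_function_mono[OF \<phi>]) (use e(2) in auto)
    have "(- 1) ^ mi_order \<kappa> * (LINT y:S|lebesgue. g y * \<phi> y) = (- 1) ^ mi_order \<kappa> * (LINT y:S|lebesgue. g' y * \<phi> y)"
      using g g' \<phi>S unfolding has_weak_deriv_def by metis
    then have "(LINT y:S|lebesgue. g y * \<phi> y) = (LINT y:S|lebesgue. g' y * \<phi> y)" by simp
    then have "(LINT y:?K|lebesgue. g y * \<phi> y - g' y * \<phi> y) = 0"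
      using set_integral_diff(2)[OF int[OF gi(1)] int[OF gi(2)]] by (simp add: restr)
    moreover have "(LINT y:?K|lebesgue. (g y - g' y) * \<phi> y) = (\<integral>y. f y * \<phi> y \<partial>lborel)"
      by (rule LINT_rep_mult[OF _ f]) auto
    ultimately show ?thesis by (simp add: left_diff_distrib)
  qed
  from vanishing_weakly[OF f_int open_ball this psi r]
  have "negligible {y \<in> ball x e. f y \<noteq> 0}" by simp
  then have "negligible ({y \<in> ball x e. f y \<noteq> 0} \<union> {y \<in> ?K. g y - g' y \<noteq> f y})"
    using f(3) by (rule negligible_Un)
  then have "negligible ({x \<in> S. g x \<noteq> g' x} \<inter> ball x e)"
    by (rule negligible_subset) auto
  then show "\<exists>U. openin (top_of_set {x \<in> S. g x \<noteq> g' x}) U \<and> x \<in> U \<and> negligible U"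
    using x e by (intro exI[of _ "{x \<in> S. g x \<noteq> g' x} \<inter> ball x e"]) (auto simp: openin_open_Int)
qed

section \<open>Taylor polynomials as explicit polynomials about a point\<close>

definition monomial :: "'n multi_index \<Rightarrow> real ^ 'n::finite \<Rightarrow> real" where
  "monomial \<beta> y = mi_power y \<beta> / mi_fact \<beta>"

lemma monomial_prod: "monomial \<beta> y = (\<Prod>i\<in>UNIV. (y $ i) ^ \<beta> i / fact (\<beta> i))"
  by (simp add: monomial_def mi_power_def mi_fact_def prod_dividef)

lemma continuous_on_monomial: "continuous_on S (monomial \<beta>)"
  unfolding monomial_prod[abs_def] by (intro continuous_intros) auto

lemma borel_measurable_monomial [measurable]: "monomial \<beta> \<in> borel_measurable borel"
  by (rule borel_measurable_continuous_onI[OF continuous_on_monomial])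

lemma monomial_at_0: "monomial \<beta> 0 = (if \<beta> = (\<lambda>_. 0) then 1 else 0)"
proof (cases "\<beta> = (\<lambda>_. 0)")
  case False
  then obtain i where "\<beta> i \<noteq> 0" by auto
  then have "(\<Prod>i\<in>UNIV. ((0 :: real ^ 'a) $ i) ^ \<beta> i / fact (\<beta> i)) = 0"
    by (intro prod_zero) auto
  with False show ?thesis by (simp add: monomial_prod)
qed (simp add: monomial_prod)

text \<open>Dividing powers by factorials absorbs the binomial coefficients; this is why
  \<open>monomial\<close> carries the factor \<open>1 / mi_fact \<beta>\<close>.\<close>

lemma power_fact_binomial:
  fixes x y :: real
  shows "(x + y) ^ n / fact n = (\<Sum>k\<le>n. x ^ k / fact k * (y ^ (n - k) / fact (n - k)))"
proof -
  have "(x + y) ^ n / fact n = (\<Sum>k\<le>n. real (n choose k) * x ^ k * y ^ (n - k) / fact n)"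
    by (simp add: binomial_ring sum_divide_distrib)
  also have "\<dots> = (\<Sum>k\<le>n. x ^ k / fact k * (y ^ (n - k) / fact (n - k)))"
    by (intro sum.cong refl) (simp add: binomial_fact field_simps)
  finally show ?thesis .
qed

lemma monomial_add:
  fixes x y :: "real ^ 'n::finite"
  shows "monomial \<beta> (x + y) = (\<Sum>\<gamma>\<in>PiE UNIV (\<lambda>i. {..\<beta> i}). monomial \<gamma> x * monomial (\<lambda>i. \<beta> i - \<gamma> i) y)"
proof -
  have "monomial \<beta> (x + y) = (\<Prod>i\<in>UNIV. \<Sum>k\<in>{..\<beta> i}. (x $ i) ^ k / fact k * ((y $ i) ^ (\<beta> i - k) / fact (\<beta> i - k)))"
    unfolding monomial_prod vector_add_component by (simp only: power_fact_binomial)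
  also have "\<dots> = (\<Sum>\<gamma>\<in>PiE UNIV (\<lambda>i. {..\<beta> i}). \<Prod>i\<in>UNIV. (x $ i) ^ \<gamma> i / fact (\<gamma> i) * ((y $ i) ^ (\<beta> i - \<gamma> i) / fact (\<beta> i - \<gamma> i)))"
    by (rule prod_sum_PiE) auto
  finally show ?thesis by (simp only: monomial_prod prod.distrib)
qed

text \<open>Substitutes \<open>\<delta> = \<beta> - \<gamma>\<close> in the expansion of
  \<open>monomial_add\<close>. The offset \<open>k\<close> is the order already spent on
  differentiation, and it shortens both sums alike.\<close>

lemma taylor_sum_rearrange:
  fixes x y :: "real ^ 'n::finite" and a :: "'n multi_index \<Rightarrow> real"
  shows "(\<Sum>\<beta> | k + mi_order \<beta> \<le> m. a \<beta> * monomial \<beta> (x + y)) =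
    (\<Sum>\<gamma> | k + mi_order \<gamma> \<le> m. \<Sum>\<delta> | k + mi_order \<gamma> + mi_order \<delta> \<le> m.
       a (mi_add \<gamma> \<delta>) * (monomial \<gamma> x * monomial \<delta> y))"
proof -
  have fin: "finite {\<beta> :: 'n multi_index. j + mi_order \<beta> \<le> m}" for j
    by (rule finite_subset[OF _ finite_multi_index[of m]]) auto
  let ?P = "SIGMA \<gamma>:{\<gamma> :: 'n multi_index. k + mi_order \<gamma> \<le> m}. {\<delta>. k + mi_order \<gamma> + mi_order \<delta> \<le> m}"
  let ?Q = "SIGMA \<beta>:{\<beta> :: 'n multi_index. k + mi_order \<beta> \<le> m}. PiE UNIV (\<lambda>i. {..\<beta> i})"
  have "(\<Sum>\<beta> | k + mi_order \<beta> \<le> m. a \<beta> * monomial \<beta> (x + y)) =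
    (\<Sum>(\<beta>, \<gamma>)\<in>?Q. a \<beta> * (monomial \<gamma> x * monomial (\<lambda>i. \<beta> i - \<gamma> i) y))"
    unfolding monomial_add sum_distrib_left
    by (rule sum.Sigma) (auto intro!: fin finite_PiE)
  also have "\<dots> = (\<Sum>(\<gamma>, \<delta>)\<in>?P. a (mi_add \<gamma> \<delta>) * (monomial \<gamma> x * monomial \<delta> y))"
  proof (rule sum.reindex_bij_witness[where i = "\<lambda>(\<gamma>, \<delta>). (mi_add \<gamma> \<delta>, \<gamma>)" and j = "\<lambda>(\<beta>, \<gamma>). (\<gamma>, \<lambda>i. \<beta> i - \<gamma> i)"])
    fix w :: "'n multi_index \<times> 'n multi_index" assume "w \<in> ?Q"
    then obtain \<beta> \<gamma> where w: "w = (\<beta>, \<gamma>)" "k + mi_order \<beta> \<le> m" "\<And>i. \<gamma> i \<le> \<beta> i" by auto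
    have add: "mi_add \<gamma> (\<lambda>i. \<beta> i - \<gamma> i) = \<beta>" using w(3) by (simp add: mi_add_def)
    then have "mi_order \<gamma> + mi_order (\<lambda>i. \<beta> i - \<gamma> i) = mi_order \<beta>" by (metis mi_order_add)
    with w add show "(case case w of (\<beta>, \<gamma>) \<Rightarrow> (\<gamma>, \<lambda>i. \<beta> i - \<gamma> i) of (\<gamma>, \<delta>) \<Rightarrow> (mi_add \<gamma> \<delta>, \<gamma>)) = w"
      and "(case w of (\<beta>, \<gamma>) \<Rightarrow> (\<gamma>, \<lambda>i. \<beta> i - \<gamma> i)) \<in> ?P"
      and "(case case w of (\<beta>, \<gamma>) \<Rightarrow> (\<gamma>, \<lambda>i. \<beta> i - \<gamma> i) of (\<gamma>, \<delta>) \<Rightarrow> a (mi_add \<gamma> \<delta>) * (monomial \<gamma> x * monomial \<delta> y))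
        = (case w of (\<beta>, \<gamma>) \<Rightarrow> a \<beta> * (monomial \<gamma> x * monomial (\<lambda>i. \<beta> i - \<gamma> i) y))"
      by auto
  next
    fix w :: "'n multi_index \<times> 'n multi_index" assume "w \<in> ?P"
    then obtain \<gamma> \<delta> where w: "w = (\<gamma>, \<delta>)" "k + mi_order \<gamma> + mi_order \<delta> \<le> m" by auto
    then show "(case case w of (\<gamma>, \<delta>) \<Rightarrow> (mi_add \<gamma> \<delta>, \<gamma>) of (\<beta>, \<gamma>) \<Rightarrow> (\<gamma>, \<lambda>i. \<beta> i - \<gamma> i)) = w"
      and "(case w of (\<gamma>, \<delta>) \<Rightarrow> (mi_add \<gamma> \<delta>, \<gamma>)) \<in> ?Q"
      by (auto simp: mi_add_def mi_order_add[unfolded mi_add_def])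
  qed
  also have "\<dots> = (\<Sum>\<gamma> | k + mi_order \<gamma> \<le> m. \<Sum>\<delta> | k + mi_order \<gamma> + mi_order \<delta> \<le> m.
       a (mi_add \<gamma> \<delta>) * (monomial \<gamma> x * monomial \<delta> y))"
    by (rule sum.Sigma[symmetric]) (auto intro!: fin)
  finally show ?thesis .
qed

text \<open>The case \<open>\<beta> i = 0\<close> is separate because subtraction of naturals is
  truncated: lowering the exponent 0 would return the monomial itself.\<close>

lemma monomial_derivative:
  fixes y :: "real ^ 'n::finite"
  shows "monomial \<beta> differentiable (at y)"
    and "partial i (monomial \<beta>) y = (if \<beta> i = 0 then 0 else monomial (\<lambda>j. \<beta> j - mi_unit i j) y)"
proof -
  let ?f = "\<lambda>j (y :: real ^ 'n). (y $ j) ^ \<beta> j / fact (\<beta> j)"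
  let ?f' = "\<lambda>j h. h $ j * (real (\<beta> j) * (y $ j) ^ (\<beta> j - 1) / fact (\<beta> j))"
  have "(?f j has_derivative ?f' j) (at y)" for j
  proof -
    have 1: "((\<lambda>y :: real ^ 'n. y $ j) has_derivative (\<lambda>h. h $ j)) (at y)"
      by (rule bounded_linear_imp_has_derivative[OF bounded_linear_vec_nth])
    have 2: "((\<lambda>t :: real. t ^ \<beta> j / fact (\<beta> j)) has_derivative
        (\<lambda>h. h * (real (\<beta> j) * (y $ j) ^ (\<beta> j - 1) / fact (\<beta> j)))) (at (y $ j))"
      by (auto intro!: derivative_eq_intros simp: field_simps)
    from has_derivative_compose[OF 1 2] show ?thesis .
  qed
  then have D: "((\<lambda>y. \<Prod>j\<in>UNIV. ?f j y) has_derivative (\<lambda>h. \<Sum>j\<in>UNIV. ?f' j h * (\<Prod>k\<in>UNIV - {j}. ?f k y))) (at y)"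
    by (intro has_derivative_prod)
  then show "monomial \<beta> differentiable (at y)"
    unfolding monomial_prod[abs_def] by (rule differentiableI)
  have "partial i (monomial \<beta>) y = (\<Sum>j\<in>UNIV. ?f' j (axis i 1) * (\<Prod>k\<in>UNIV - {j}. ?f k y))"
    unfolding monomial_prod[abs_def] by (rule partialI[OF D])
  also have "\<dots> = (\<Sum>j\<in>UNIV. if j = i then (real (\<beta> i) * (y $ i) ^ (\<beta> i - 1) / fact (\<beta> i)) * (\<Prod>k\<in>UNIV - {i}. ?f k y) else 0)"
    by (intro sum.cong refl) (auto simp: axis_def)
  also have "\<dots> = (real (\<beta> i) * (y $ i) ^ (\<beta> i - 1) / fact (\<beta> i)) * (\<Prod>k\<in>UNIV - {i}. ?f k y)" by simp
  also have "\<dots> = (if \<beta> i = 0 then 0 else monomial (\<lambda>j. \<beta> j - mi_unit i j) y)"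
  proof (cases "\<beta> i")
    case (Suc b)
    have "monomial (\<lambda>j. \<beta> j - mi_unit i j) y = (y $ i) ^ b / fact b *
        (\<Prod>k\<in>UNIV - {i}. (y $ k) ^ (\<beta> k - mi_unit i k) / fact (\<beta> k - mi_unit i k))"
      unfolding monomial_prod by (subst prod.remove[of _ i]) (simp_all add: mi_unit_def Suc)
    also have "(\<Prod>k\<in>UNIV - {i}. (y $ k) ^ (\<beta> k - mi_unit i k) / fact (\<beta> k - mi_unit i k)) = (\<Prod>k\<in>UNIV - {i}. ?f k y)"
      by (intro prod.cong refl) (auto simp: mi_unit_def)
    finally show ?thesis using Suc by (simp add: field_simps del: of_nat_Suc)
  qed simp
  finally show "partial i (monomial \<beta>) y = (if \<beta> i = 0 then 0 else monomial (\<lambda>j. \<beta> j - mi_unit i j) y)" .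
qed

text \<open>The \<open>\<alpha>\<close>-th derivative of the polynomial of degree at most \<open>m\<close> whose derivatives at \<open>z\<close>
  are the numbers \<open>a \<beta>\<close>.\<close>

definition poly_deriv :: "nat \<Rightarrow> ('n multi_index \<Rightarrow> real) \<Rightarrow> real ^ 'n::finite \<Rightarrow> 'n multi_index \<Rightarrow> real ^ 'n \<Rightarrow> real" where
  "poly_deriv m a z \<alpha> y = (\<Sum>\<delta> | mi_order \<alpha> + mi_order \<delta> \<le> m. a (mi_add \<alpha> \<delta>) * monomial \<delta> (y - z))"

lemma continuous_on_poly_deriv: "continuous_on S (poly_deriv m a z \<alpha>)"
  unfolding poly_deriv_def[abs_def]
  by (intro continuous_intros continuous_on_compose2[OF continuous_on_monomial[of UNIV]]) auto

lemma poly_deriv_borel [measurable]: "poly_deriv m a z \<alpha> \<in> borel_measurable borel"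
  by (rule borel_measurable_continuous_onI[OF continuous_on_poly_deriv])

lemma poly_deriv_top: "m < mi_order \<alpha> \<Longrightarrow> poly_deriv m a z \<alpha> y = 0"
  by (simp add: poly_deriv_def)

text \<open>The left side is the Taylor expansion about \<open>x\<close> of a derivative of the
  polynomial, evaluated at \<open>z\<close>, and for polynomials it is exact. After rearranging, the
  argument is \<open>(z - x) + (x - z) = 0\<close>, so only the constant monomial survives.\<close>

lemma poly_deriv_taylor:
  fixes z :: "real ^ 'n::finite"
  assumes "mi_order \<alpha> \<le> m"
  shows "(\<Sum>\<beta> | mi_order \<alpha> + mi_order \<beta> \<le> m. poly_deriv m a z (mi_add \<alpha> \<beta>) x * monomial \<beta> (z - x)) = a \<alpha>"
proof -
  have fin: "finite {\<beta> :: 'n multi_index. mi_order \<alpha> + mi_order \<beta> \<le> m}"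
    by (rule finite_subset[OF _ finite_multi_index[of m]]) auto
  have assoc: "mi_add (mi_add \<alpha> \<beta>) \<delta> = mi_add \<alpha> (mi_add \<beta> \<delta>)" for \<beta> \<delta>
    by (simp add: mi_add_def add.assoc)
  have "(\<Sum>\<beta> | mi_order \<alpha> + mi_order \<beta> \<le> m. poly_deriv m a z (mi_add \<alpha> \<beta>) x * monomial \<beta> (z - x)) =
    (\<Sum>\<beta> | mi_order \<alpha> + mi_order \<beta> \<le> m. \<Sum>\<delta> | mi_order \<alpha> + mi_order \<beta> + mi_order \<delta> \<le> m.
      a (mi_add \<alpha> (mi_add \<beta> \<delta>)) * (monomial \<beta> (z - x) * monomial \<delta> (x - z)))"
    by (simp add: poly_deriv_def mi_order_add assoc sum_distrib_right sum_distrib_left mult_ac)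
  also have "\<dots> = (\<Sum>\<beta> | mi_order \<alpha> + mi_order \<beta> \<le> m. a (mi_add \<alpha> \<beta>) * monomial \<beta> ((z - x) + (x - z)))"
    by (rule taylor_sum_rearrange[symmetric])
  also have "\<dots> = (\<Sum>\<beta> | mi_order \<alpha> + mi_order (\<beta> :: 'n multi_index) \<le> m. if \<beta> = (\<lambda>_. 0) then a \<alpha> else 0)"
    by (intro sum.cong refl) (simp add: monomial_at_0)
  also have "\<dots> = a \<alpha>" using fin assms by simp
  finally show ?thesis .
qed

lemma poly_deriv_derivative:
  fixes y :: "real ^ 'n::finite"
  shows "poly_deriv m a z \<alpha> differentiable (at y)"
    and "partial i (poly_deriv m a z \<alpha>) y = poly_deriv m a z (mi_add \<alpha> (mi_unit i)) y"
proof -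
  let ?Z = "{\<delta> :: 'n multi_index. mi_order \<alpha> + mi_order \<delta> \<le> m}"
  have fin: "finite ?Z" by (rule finite_subset[OF _ finite_multi_index[of m]]) auto
  have shift: "((\<lambda>y. y - z) has_derivative (\<lambda>h. h)) (at y)"
    by (auto intro!: derivative_eq_intros)
  have "((\<lambda>y. a (mi_add \<alpha> \<delta>) * monomial \<delta> (y - z)) has_derivative
      (\<lambda>h. a (mi_add \<alpha> \<delta>) * (\<Sum>i\<in>UNIV. h $ i * partial i (monomial \<delta>) (y - z)))) (at y)" for \<delta>
    by (intro has_derivative_mult_right has_derivative_compose[OF shift] has_derivative_partial monomial_derivative)
  then have D: "(poly_deriv m a z \<alpha> has_derivative
      (\<lambda>h. \<Sum>\<delta>\<in>?Z. a (mi_add \<alpha> \<delta>) * (\<Sum>i\<in>UNIV. h $ i * partial i (monomial \<delta>) (y - z)))) (at y)"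
    unfolding poly_deriv_def[abs_def] by (intro has_derivative_sum)
  then show "poly_deriv m a z \<alpha> differentiable (at y)" by (rule differentiableI)
  have ax: "(\<Sum>j\<in>UNIV. axis i 1 $ j * q j) = q i" for q :: "'n \<Rightarrow> real"
    by (simp add: axis_def if_distrib[where f="\<lambda>c. c * _"] cong: if_cong)
  have "partial i (poly_deriv m a z \<alpha>) y = (\<Sum>\<delta>\<in>?Z. a (mi_add \<alpha> \<delta>) * partial i (monomial \<delta>) (y - z))"
    unfolding partialI[OF D] ax ..
  also have "\<dots> = (\<Sum>\<delta>\<in>?Z. if \<delta> i = 0 then 0 else a (mi_add \<alpha> \<delta>) * monomial (\<lambda>j. \<delta> j - mi_unit i j) (y - z))"
    by (intro sum.cong refl) (simp add: monomial_derivative(2))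
  also have "\<dots> = (\<Sum>\<delta>\<in>{\<delta>\<in>?Z. \<delta> i \<noteq> 0}. a (mi_add \<alpha> \<delta>) * monomial (\<lambda>j. \<delta> j - mi_unit i j) (y - z))"
    using fin by (intro sum.mono_neutral_cong_right) auto
  also have "\<dots> = (\<Sum>\<delta> | mi_order (mi_add \<alpha> (mi_unit i)) + mi_order \<delta> \<le> m. a (mi_add (mi_add \<alpha> (mi_unit i)) \<delta>) * monomial \<delta> (y - z))"
  proof (rule sum.reindex_bij_witness[where i = "\<lambda>\<delta>. mi_add (mi_unit i) \<delta>" and j = "\<lambda>\<delta> j. \<delta> j - mi_unit i j"])
    fix \<delta> assume \<delta>: "\<delta> \<in> {\<delta>\<in>?Z. \<delta> i \<noteq> 0}"
    have add: "mi_add (mi_unit i) (\<lambda>j. \<delta> j - mi_unit i j) = \<delta>"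
      using \<delta> by (auto simp: mi_add_def mi_unit_def)
    then show "mi_add (mi_unit i) (\<lambda>j. \<delta> j - mi_unit i j) = \<delta>" .
    have "1 + mi_order (\<lambda>j. \<delta> j - mi_unit i j) = mi_order \<delta>"
      using arg_cong[OF add, of mi_order] by (simp add: mi_order_add)
    then show "(\<lambda>j. \<delta> j - mi_unit i j) \<in> {\<delta>. mi_order (mi_add \<alpha> (mi_unit i)) + mi_order \<delta> \<le> m}"
      using \<delta> by (simp add: mi_order_add)
    have "mi_add (mi_add \<alpha> (mi_unit i)) (\<lambda>j. \<delta> j - mi_unit i j) = mi_add \<alpha> \<delta>"
      using add by (simp add: mi_add_def fun_eq_iff add.assoc)
    then show "a (mi_add (mi_add \<alpha> (mi_unit i)) (\<lambda>j. \<delta> j - mi_unit i j)) * monomial (\<lambda>j. \<delta> j - mi_unit i j) (y - z)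
        = a (mi_add \<alpha> \<delta>) * monomial (\<lambda>j. \<delta> j - mi_unit i j) (y - z)" by simp
  next
    fix \<delta> :: "'n multi_index" assume \<delta>: "\<delta> \<in> {\<delta>. mi_order (mi_add \<alpha> (mi_unit i)) + mi_order \<delta> \<le> m}"
    show "(\<lambda>j. mi_add (mi_unit i) \<delta> j - mi_unit i j) = \<delta>" by (simp add: mi_add_def)
    show "mi_add (mi_unit i) \<delta> \<in> {\<delta>\<in>?Z. \<delta> i \<noteq> 0}"
      using \<delta> by (simp add: mi_order_add) (simp add: mi_add_def mi_unit_def)
  qed
  also have "\<dots> = poly_deriv m a z (mi_add \<alpha> (mi_unit i)) y" by (simp add: poly_deriv_def)
  finally show "partial i (poly_deriv m a z \<alpha>) y = poly_deriv m a z (mi_add \<alpha> (mi_unit i)) y" .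
qed

text \<open>The product with \<phi> has compact support, so its partial derivative integrates to 0
  by \<open>integral_partial_eq_0\<close>; the product rule does the rest.\<close>

lemma poly_deriv_by_parts:
  fixes z :: "real ^ 'n::finite"
  assumes \<phi>: "test_function S \<phi>"
  shows "(\<integral>x. poly_deriv m a z \<alpha> x * partial i \<phi> x \<partial>lborel) =
    - (\<integral>x. poly_deriv m a z (mi_add \<alpha> (mi_unit i)) x * \<phi> x \<partial>lborel)"
proof -
  let ?P = "poly_deriv m a z \<alpha>" and ?P' = "poly_deriv m a z (mi_add \<alpha> (mi_unit i))"
  have sm: "smooth \<phi>" and K: "compact (supp \<phi>)" using \<phi> by (auto simp: test_function_def)
  have c: "continuous_on UNIV \<phi>" "continuous_on UNIV (partial i \<phi>)"
    using sm by (auto intro: smooth_continuous_on smooth_partial)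
  have z: "x \<notin> supp \<phi> \<Longrightarrow> \<phi> x = 0" "x \<notin> supp \<phi> \<Longrightarrow> partial i \<phi> x = 0" for x
    using zero_outside_supp[of x \<phi>] zero_outside_supp[of x "partial i \<phi>"] supp_partial[of i \<phi>] by auto
  have D: "((\<lambda>x. ?P x * \<phi> x) has_derivative (\<lambda>h. ?P y * (\<Sum>i\<in>UNIV. h $ i * partial i \<phi> y)
      + (\<Sum>i\<in>UNIV. h $ i * partial i ?P y) * \<phi> y)) (at y)" for y
    by (intro has_derivative_mult has_derivative_partial poly_deriv_derivative smooth_differentiable[OF sm])
  have ax: "(\<Sum>j\<in>UNIV. axis i 1 $ j * q j) = q i" for q :: "'n \<Rightarrow> real"
    by (simp add: axis_def if_distrib[where f="\<lambda>c. c * _"] cong: if_cong)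
  have par: "partial i (\<lambda>x. ?P x * \<phi> x) = (\<lambda>y. ?P y * partial i \<phi> y + ?P' y * \<phi> y)"
    unfolding fun_eq_iff partialI[OF D] ax poly_deriv_derivative(2) by simp
  have i1: "integrable lborel (\<lambda>y. ?P y * partial i \<phi> y)" and i2: "integrable lborel (\<lambda>y. ?P' y * \<phi> y)"
    by (rule continuous_compact_supp_integrable[OF _ K];
        (intro continuous_intros c continuous_on_poly_deriv | simp add: z))+
  have "(\<integral>y. partial i (\<lambda>x. ?P x * \<phi> x) y \<partial>lborel) = 0"
  proof (rule integral_partial_eq_0[OF _ _ K])
    show "(\<lambda>x. ?P x * \<phi> x) differentiable (at y)" for y using D by (rule differentiableI)
    show "continuous_on UNIV (partial i (\<lambda>x. ?P x * \<phi> x))"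
      unfolding par by (intro continuous_intros c continuous_on_poly_deriv)
  qed (auto simp: par z)
  then show ?thesis unfolding par using i1 i2 by simp
qed

text \<open>Local integrability makes only the cut-offs of \<omega> measurable, and \<omega> itself
  is their limit over growing balls. A change on a null set preserves all integrals over balls, so
  \<open>Ap_const p \<omega>\<close> itself serves as the bound \<open>A\<close>.\<close>

lemma Ap_borel_representative:
  fixes \<omega> :: "real ^ 'n::finite \<Rightarrow> real"
  assumes Ap: "Ap_weight p \<omega>" and p: "1 < p"
  obtains \<omega>' where "borel_Ap_weight p (Ap_const p \<omega>) \<omega>'" "negligible {x. \<omega> x \<noteq> \<omega>' x}"
proof -
  have loc: "locally_integrable_on \<omega> UNIV" and pos: "AE x in lebesgue. 0 < \<omega> x"
    and dual: "\<And>x s. 0 < s \<Longrightarrow> (\<lambda>y. \<omega> y powr (1 / (1 - p))) absolutely_integrable_on ball x s"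
    and bdd: "bdd_above {Ap_quotient p \<omega> (ball x s) |x s. s > 0}"
    using Ap unfolding Ap_weight_def weight_def by auto
  have ball_int: "\<omega> absolutely_integrable_on ball x s" for x s
  proof -
    have "\<omega> absolutely_integrable_on cball x s"
      using loc unfolding locally_integrable_on_def by simp
    then show ?thesis by (rule set_integrable_subset) auto
  qed
  have "\<omega> \<in> borel_measurable lebesgue"
  proof (rule borel_measurable_LIMSEQ_metric)
    fix k :: nat
    show "(\<lambda>x. indicator (ball 0 (real k)) x *\<^sub>R \<omega> x) \<in> borel_measurable lebesgue"
      using ball_int[of 0 "real k"] unfolding set_integrable_def by (rule borel_measurable_integrable)
  next
    fix x :: "real ^ 'n"
    have "eventually (\<lambda>k. norm x < real k) sequentially"
      using eventually_gt_at_top[of "nat \<lceil>norm x\<rceil>"] by eventually_elim linarith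
    then have "eventually (\<lambda>k. indicator (ball 0 (real k)) x *\<^sub>R \<omega> x = \<omega> x) sequentially"
      by eventually_elim simp
    then show "(\<lambda>k. indicator (ball 0 (real k)) x *\<^sub>R \<omega> x) \<longlonglongrightarrow> \<omega> x" by (rule tendsto_eventually)
  qed
  then have "set_borel_measurable lebesgue UNIV \<omega>" by (simp add: set_borel_measurable_def)
  then obtain f where [measurable]: "f \<in> borel_measurable borel" and f: "negligible {x \<in> UNIV. \<omega> x \<noteq> f x}"
    by (rule borel_representative) auto
  \<comment> \<open>The value 1 is an arbitrary positive one; it is used only on a null set.\<close>
  define \<omega>' where "\<omega>' x = (if 0 < f x then f x else 1)" for x
  have [measurable]: "\<omega>' \<in> borel_measurable borel" unfolding \<omega>'_def by measurable
  have neg: "negligible {x. \<omega> x \<noteq> \<omega>' x}"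
  proof -
    obtain N where "{x. \<not> 0 < \<omega> x} \<subseteq> N" "N \<in> null_sets lebesgue"
      using pos unfolding eventually_ae_filter by auto
    then have "negligible {x. \<not> 0 < \<omega> x}"
      using negligible_iff_null_sets negligible_subset by blast
    then have "negligible ({x \<in> UNIV. \<omega> x \<noteq> f x} \<union> {x. \<not> 0 < \<omega> x})"
      using f by (intro negligible_Un)
    then show ?thesis by (rule negligible_subset) (auto simp: \<omega>'_def)
  qed
  \<comment> \<open>Stated for a general \<open>F\<close> so that it serves both the weight and its
    dual power.\<close>
  have rep: "negligible {y \<in> ball x s. F (\<omega> y) \<noteq> near s x y * F (\<omega>' y)}" for F :: "real \<Rightarrow> real" and x s
    by (rule negligible_subset[OF neg]) (auto simp: near_alt)
  have z: "y \<notin> ball x s \<Longrightarrow> near s x y * q = 0" for x y :: "real ^ 'n" and s q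
    by (simp add: near_alt)
  have w: "integrable lborel (\<lambda>y. near s x y * \<omega>' y)"
    "(LINT y:ball x s|lebesgue. \<omega> y) = (\<integral>y. near s x y * \<omega>' y \<partial>lborel)" for x s
    using absolutely_integrable_rep[OF _ _ z rep[where F = "\<lambda>t. t"]] LINT_rep[OF _ _ z rep[where F = "\<lambda>t. t"]] ball_int
    by auto
  have d: "integrable lborel (\<lambda>y. near s x y * \<omega>' y powr (1 / (1 - p)))"
    "(LINT y:ball x s|lebesgue. \<omega> y powr (1 / (1 - p))) = (\<integral>y. near s x y * \<omega>' y powr (1 / (1 - p)) \<partial>lborel)"
    if "0 < s" for x s
    using absolutely_integrable_rep[OF _ _ z rep[where F = "\<lambda>t. t powr (1 / (1 - p))"]]
      LINT_rep[OF _ _ z rep[where F = "\<lambda>t. t powr (1 / (1 - p))"]] dual[OF that]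
    by auto
  show thesis
  proof (rule that[OF _ neg], unfold_locales)
    fix x :: "real ^ 'n" and s :: real assume s: "0 < s"
    let ?W = "\<integral>y. near s x y * \<omega>' y \<partial>lborel" and ?D = "\<integral>y. near s x y * \<omega>' y powr (1 / (1 - p)) \<partial>lborel"
    let ?V = "bvol TYPE('n) s"
    have V: "0 < ?V" "measure lebesgue (ball x s) = ?V"
      using s by (simp_all add: bvol_pos measure_completion measure_ball_vec)
    have D0: "0 \<le> ?D" by (intro integral_nonneg_AE) auto
    have "Ap_quotient p \<omega> (ball x s) \<le> Ap_const p \<omega>"
      unfolding Ap_const_def by (rule cSup_upper[OF _ bdd]) (use s in auto)
    then have "?W / ?V * (?D / ?V) powr (p - 1) \<le> Ap_const p \<omega>"
      unfolding Ap_quotient_def V w(2) d(2)[OF s] .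
    then have "?W / ?V * (?D / ?V) powr (p - 1) * ?V powr p \<le> Ap_const p \<omega> * ?V powr p"
      by (rule mult_right_mono) simp
    moreover have "?W / ?V * (?D / ?V) powr (p - 1) * ?V powr p = ?W * ?D powr (p - 1)"
    proof -
      have "?V powr p = ?V * ?V powr (p - 1)"
        using V powr_add[of ?V 1 "p - 1"] by simp
      then show ?thesis using V by (simp add: powr_divide)
    qed
    ultimately show "?W * ?D powr (p - 1) \<le> Ap_const p \<omega> * ?V powr p" by simp
    show "integrable lborel (\<lambda>y. near s x y * \<omega>' y)" by (rule w)
    show "integrable lborel (\<lambda>y. near s x y * \<omega>' y powr (1 / (1 - p)))" by (rule d[OF s])
  qed (use p in \<open>auto simp: \<omega>'_def\<close>)
qed

lemma index_count_eq: "mi_add \<alpha> (count_list (i # js)) = mi_add (mi_add \<alpha> (mi_unit i)) (count_list js)"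
  by (auto simp: mi_add_def mi_unit_def)

lemma test_function_iterated: "test_function S \<phi> \<Longrightarrow> test_function S (iterated_partial js \<phi>)"
  by (induction js) (auto intro: test_function_partial)

text \<open>The analytic half of the theorem: of the mesh there remains only an open set inside
  \<open>ball z (C * h)\<close> that is star-shaped with respect to \<open>cball z (c * h)\<close>.
  \<open>K\<close> is chosen before \<omega>, \<open>S\<close>, \<open>z\<close>, \<open>h\<close>
  and \<open>v\<close>, which expresses what the constant may depend on.\<close>

lemma averaged_taylor_estimate:
  fixes \<psi> :: "real ^ 'n::finite \<Rightarrow> real"
  assumes p: "1 < p" and psi: "smooth \<psi>" "\<And>x. r < norm x \<Longrightarrow> \<psi> x = 0" "(\<integral>x. \<psi> x \<partial>lborel) = 1"
    and r: "0 < r" and c: "0 < c" "c \<le> C"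
  shows "\<exists>K. \<forall>\<omega> S z h v k. Ap_weight p \<omega> \<longrightarrow> open S \<longrightarrow> S \<subseteq> ball z (C * h) \<longrightarrow> 0 < h \<longrightarrow>
    (\<forall>y\<in>S. \<forall>y'\<in>cball z (c * h). \<forall>t. 0 \<le> t \<and> t \<le> 1 \<longrightarrow> y + t *\<^sub>R (y' - y) \<in> S) \<longrightarrow>
    (LINT x:S|lebesgue. scaled_kernel m \<psi> h z x) = 1 \<longrightarrow>
    v \<in> weighted_sobolev (m + 1) p \<omega> S \<longrightarrow> k \<le> m + 1 \<longrightarrow>
    weighted_seminorm k p \<omega> S (\<lambda>y. v y - (LINT x:S|lebesgue. taylor_poly m S v x y * scaled_kernel m \<psi> h z x))
      \<le> K (Ap_const p \<omega>) * h ^ (m + 1 - k) * weighted_seminorm (m + 1) p \<omega> S v"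
proof -
  have pc: "continuous_on UNIV \<psi>" by (rule smooth_continuous_on[OF psi(1)])
  obtain M where M: "\<And>x. \<bar>\<psi> x\<bar> \<le> M"
    using bounded_compact_supp[OF pc compact_cball[of 0 r]] psi(2) by auto
  \<comment> \<open>A bound for \<open>scaled_kernel\<close> without its factor
    \<open>1 / h^n\<close>.\<close>
  define B where "B = real (m + 1) ^ CARD('n) * M"
  define N where "N = real (card {\<kappa> :: 'n multi_index. mi_order \<kappa> \<le> m + 1})"
  define KK where "KK A = (2 * C * bvol TYPE('n) (4 * C) / bvol TYPE('n) c) powr p * A * (A * (M * bvol TYPE('n) (4 * r)) powr p)" for A
  define L where "L A = (2 powr p + 4 powr p * (A * (B * bvol TYPE('n) C) powr p)) * (KK A * real CARD('n) powr p)
      + 4 powr p * (N powr p * (A * (B * bvol TYPE('n) C * max 1 C ^ m) powr p))" for A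
  \<comment> \<open>\<open>N\<close> bounds the number of multi-indices of order \<open>k\<close>,
    the power of \<open>1 + L A * N\<close> comes from \<open>descending_bound\<close>, and the root
    undoes the passage to \<open>p\<close>-th powers.\<close>
  define K where "K A = (N * (1 + L A * N) ^ (m + 1)) powr (1 / p)" for A
  show ?thesis
  proof (intro exI[of _ K] allI impI)
    fix \<omega> v :: "real ^ 'n \<Rightarrow> real" and S z h and k :: nat
    assume Ap: "Ap_weight p \<omega>" and S: "open S" "S \<subseteq> ball z (C * h)" and h: "0 < h"
      and star: "\<forall>y\<in>S. \<forall>y'\<in>cball z (c * h). \<forall>t. 0 \<le> t \<and> t \<le> 1 \<longrightarrow> y + t *\<^sub>R (y' - y) \<in> S"
      and one: "(LINT x:S|lebesgue. scaled_kernel m \<psi> h z x) = 1"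
      and v: "v \<in> weighted_sobolev (m + 1) p \<omega> S" and k: "k \<le> m + 1"
    obtain \<omega>' where bw: "borel_Ap_weight p (Ap_const p \<omega>) \<omega>'" and neg\<omega>: "negligible {x. \<omega> x \<noteq> \<omega>' x}"
      using Ap_borel_representative[OF Ap p] by blast
    interpret borel_Ap_weight p "Ap_const p \<omega>" \<omega>' by (rule bw)
    let ?A = "Ap_const p \<omega>"
    have Sb[measurable]: "S \<in> sets borel" using S(1) by simp
    have C: "0 < C" using c by linarith
    have R: "0 < C * h" using C h by simp
    have w0: "0 \<le> \<omega>' x" for x using weight_pos[of x] by simp
    have out: "x \<notin> S" if "x \<notin> ball z (C * h)" for x using S(2) that by blast
    let ?sk = "scaled_kernel m \<psi> h z"
    have sk_cont: "continuous_on UNIV ?sk"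
      unfolding scaled_kernel_def[abs_def]
      by (intro continuous_intros continuous_on_compose2[OF pc]) auto
    have [measurable]: "?sk \<in> borel_measurable borel" by (rule borel_measurable_continuous_onI[OF sk_cont])
    define \<theta> where "\<theta> x = indicator S x * ?sk x" for x
    have [measurable]: "\<theta> \<in> borel_measurable borel" unfolding \<theta>_def by measurable
    have \<theta>_out: "x \<notin> S \<Longrightarrow> \<theta> x = 0" for x by (simp add: \<theta>_def)
    have \<theta>_le: "\<bar>\<theta> x\<bar> \<le> B / h ^ CARD('n)" for x
    proof -
      have "\<bar>\<theta> x\<bar> \<le> \<bar>?sk x\<bar>" by (simp add: \<theta>_def indicator_def)
      also have "\<dots> \<le> real (m + 1) ^ CARD('n) / h ^ CARD('n) * M"
        unfolding scaled_kernel_def abs_mult using h M by (intro mult_mono) auto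
      finally show ?thesis by (simp add: B_def)
    qed
    have \<theta>_one: "(\<integral>x. \<theta> x \<partial>lborel) = 1"
    proof -
      have "{x \<in> S. ?sk x \<noteq> \<theta> x} = {}" by (auto simp: \<theta>_def)
      then have "negligible {x \<in> S. ?sk x \<noteq> \<theta> x}" by (simp only: negligible_empty)
      from LINT_rep[OF Sb _ \<theta>_out this] one show ?thesis by simp
    qed
    have \<theta>_int: "integrable lborel \<theta>"
      using \<theta>_one not_integrable_integral_eq[of lborel \<theta>] by fastforce

    \<comment> \<open>Representatives of the weak derivatives of \<open>v\<close>\<close>
    have "\<exists>V. V \<in> borel_measurable borel \<and> (\<forall>x. x \<notin> S \<longrightarrow> V x = 0) \<and>
        negligible {x \<in> S. weak_deriv S \<kappa> v x \<noteq> V x} \<and> integrable lborel (\<lambda>x. \<bar>V x\<bar> powr p * \<omega>' x) \<and>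
        has_weak_deriv S \<kappa> v (weak_deriv S \<kappa> v)" if \<kappa>: "mi_order \<kappa> \<le> m + 1" for \<kappa>
    proof -
      obtain g where g: "g \<in> weighted_Lp p \<omega> S" "has_weak_deriv S \<kappa> v g"
        using v \<kappa> unfolding weighted_sobolev_def by blast
      have wd: "has_weak_deriv S \<kappa> v (weak_deriv S \<kappa> v)"
        using someI[of "has_weak_deriv S \<kappa> v", OF g(2)] by (simp add: weak_deriv_def)
      obtain V where V: "V \<in> borel_measurable borel" "\<And>x. x \<notin> S \<Longrightarrow> V x = 0" "negligible {x \<in> S. g x \<noteq> V x}"
        using g(1) unfolding weighted_Lp_def by (auto intro: borel_representative[OF _ Sb])
      have "negligible ({x \<in> S. weak_deriv S \<kappa> v x \<noteq> g x} \<union> {x \<in> S. g x \<noteq> V x})"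
        by (intro negligible_Un V weak_deriv_unique[OF wd g(2) S(1) psi r])
      then have "negligible {x \<in> S. weak_deriv S \<kappa> v x \<noteq> V x}" by (rule negligible_subset) auto
      moreover have "integrable lborel (\<lambda>x. \<bar>V x\<bar> powr p * \<omega>' x)"
      proof -
        have "negligible ({x \<in> S. g x \<noteq> V x} \<union> {x. \<omega> x \<noteq> \<omega>' x})"
          by (intro negligible_Un V neg\<omega>)
        then have "negligible {x \<in> S. \<bar>g x\<bar> powr p * \<omega> x \<noteq> \<bar>V x\<bar> powr p * \<omega>' x}"
          by (rule negligible_subset) auto
        then show ?thesis
          using absolutely_integrable_rep[OF Sb, of "\<lambda>x. \<bar>V x\<bar> powr p * \<omega>' x" "\<lambda>x. \<bar>g x\<bar> powr p * \<omega> x"]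
            V(1,2) g(1) by (simp add: weighted_Lp_def)
      qed
      ultimately show ?thesis using V wd by blast
    qed
    then have "\<forall>\<kappa>. \<exists>V. mi_order \<kappa> \<le> m + 1 \<longrightarrow> V \<in> borel_measurable borel \<and> (\<forall>x. x \<notin> S \<longrightarrow> V x = 0) \<and>
        negligible {x \<in> S. weak_deriv S \<kappa> v x \<noteq> V x} \<and> integrable lborel (\<lambda>x. \<bar>V x\<bar> powr p * \<omega>' x) \<and>
        has_weak_deriv S \<kappa> v (weak_deriv S \<kappa> v)" by blast
    from choice[OF this] obtain V where V': "\<forall>\<kappa>. mi_order \<kappa> \<le> m + 1 \<longrightarrow> V \<kappa> \<in> borel_measurable borel \<and>
        (\<forall>x. x \<notin> S \<longrightarrow> V \<kappa> x = 0) \<and>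
        negligible {x \<in> S. weak_deriv S \<kappa> v x \<noteq> V \<kappa> x} \<and> integrable lborel (\<lambda>x. \<bar>V \<kappa> x\<bar> powr p * \<omega>' x) \<and>
        has_weak_deriv S \<kappa> v (weak_deriv S \<kappa> v)" ..
    have V: "\<And>\<kappa>. mi_order \<kappa> \<le> m + 1 \<Longrightarrow> V \<kappa> \<in> borel_measurable borel"
      "\<And>\<kappa> x. mi_order \<kappa> \<le> m + 1 \<Longrightarrow> x \<notin> S \<Longrightarrow> V \<kappa> x = 0"
      "\<And>\<kappa>. mi_order \<kappa> \<le> m + 1 \<Longrightarrow> negligible {x \<in> S. weak_deriv S \<kappa> v x \<noteq> V \<kappa> x}"
      "\<And>\<kappa>. mi_order \<kappa> \<le> m + 1 \<Longrightarrow> integrable lborel (\<lambda>x. \<bar>V \<kappa> x\<bar> powr p * \<omega>' x)"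
      "\<And>\<kappa>. mi_order \<kappa> \<le> m + 1 \<Longrightarrow> has_weak_deriv S \<kappa> v (weak_deriv S \<kappa> v)"
      using V' by blast+
    have V_int: "integrable lborel (V \<kappa>)" if "mi_order \<kappa> \<le> m + 1" for \<kappa>
      by (rule supported_integrable[OF V(1)[OF that] _ V(4)[OF that] R]) (rule V(2)[OF that out])
    have V_test: "(\<integral>x. V \<kappa> x * \<phi> x \<partial>lborel) = (- 1) ^ mi_order \<kappa> * (LINT x:S|lebesgue. v x * classical_deriv \<kappa> \<phi> x)"
      if \<kappa>: "mi_order \<kappa> \<le> m + 1" and \<phi>: "test_function S \<phi>" for \<kappa> \<phi>
    proof -
      have "(LINT x:S|lebesgue. v x * classical_deriv \<kappa> \<phi> x) =
          (- 1) ^ mi_order \<kappa> * (LINT x:S|lebesgue. weak_deriv S \<kappa> v x * \<phi> x)"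
        using V(5)[OF \<kappa>] \<phi> unfolding has_weak_deriv_def by blast
      also have "(LINT x:S|lebesgue. weak_deriv S \<kappa> v x * \<phi> x) = (\<integral>x. V \<kappa> x * \<phi> x \<partial>lborel)"
        by (rule LINT_rep_mult[OF Sb V(1)[OF \<kappa>] V(2)[OF \<kappa>] V(3)[OF \<kappa>] test_function_borel[OF \<phi>]])
      finally have eq: "(LINT x:S|lebesgue. v x * classical_deriv \<kappa> \<phi> x) = (- 1) ^ mi_order \<kappa> * (\<integral>x. V \<kappa> x * \<phi> x \<partial>lborel)" .
      have "(- 1) ^ mi_order \<kappa> * (- 1) ^ mi_order \<kappa> = (1 :: real)"
        by (rule minus_one_mult_self)
      then have "(- 1) ^ mi_order \<kappa> * ((- 1) ^ mi_order \<kappa> * q) = q" for q :: real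
        by (simp only: mult.assoc[symmetric] mult_1)
      then show ?thesis unfolding eq by (rule sym)
    qed
    have V_weak: "(\<integral>x. V \<alpha> x * partial i \<phi> x \<partial>lborel) = - (\<integral>x. V (mi_add \<alpha> (mi_unit i)) x * \<phi> x \<partial>lborel)"
      if \<alpha>: "mi_order \<alpha> \<le> m" and \<phi>: "test_function S \<phi>" for \<alpha> i \<phi>
    proof -
      have "smooth \<phi>" using \<phi> by (simp add: test_function_def)
      then show ?thesis
        using \<alpha> by (simp add: V_test \<phi> test_function_partial mi_order_add classical_deriv_partial)
    qed
    \<comment> \<open>Order 0 is no exception: \<open>weak_deriv\<close> is a choice there too, and
      only uniqueness ties it to \<open>v\<close> almost everywhere.\<close>
    have v_V: "negligible {x \<in> S. v x \<noteq> V (\<lambda>_. 0) x}"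
    proof -
      have wd: "has_weak_deriv S (\<lambda>_. 0) v (weak_deriv S (\<lambda>_. 0) v)" by (rule V(5)) simp
      have "classical_deriv (\<lambda>_. 0) \<phi> = \<phi>" if "test_function S \<phi>" for \<phi>
        using classical_deriv_eq_iterated[of \<phi> "[]" "\<lambda>_. 0"] that by (simp add: test_function_def)
      then have "has_weak_deriv S (\<lambda>_. 0) v v"
        using wd unfolding has_weak_deriv_def by simp
      from weak_deriv_unique[OF this wd S(1) psi r]
      have "negligible ({x \<in> S. v x \<noteq> weak_deriv S (\<lambda>_. 0) v x} \<union> {x \<in> S. weak_deriv S (\<lambda>_. 0) v x \<noteq> V (\<lambda>_. 0) x})"
        by (intro negligible_Un V(3)) auto
      then show ?thesis by (rule negligible_subset) auto
    qed

    \<comment> \<open>The averaged Taylor polynomial as a polynomial about \<open>z\<close>\<close>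
    have bounded: "\<exists>b. \<forall>x. \<bar>indicator S x * q x\<bar> \<le> b" if "continuous_on UNIV q" for q :: "real ^ 'n \<Rightarrow> real"
    proof -
      have "bounded (q ` cball z (C * h))"
        by (intro compact_imp_bounded compact_continuous_image continuous_on_subset[OF that]) auto
      then obtain b where b: "b > 0" "\<And>x. x \<in> cball z (C * h) \<Longrightarrow> \<bar>q x\<bar> \<le> b"
        by (auto simp: bounded_pos)
      have "S \<subseteq> cball z (C * h)" using S(2) by auto
      then have "\<bar>indicator S x * q x\<bar> \<le> b" for x
        using b by (cases "x \<in> S") auto
      then show ?thesis by blast
    qed
    have mon_cont: "continuous_on UNIV (\<lambda>x. monomial \<delta> (z - x) * ?sk x)" for \<delta>
      by (intro continuous_intros sk_cont continuous_on_compose2[OF continuous_on_monomial[of UNIV]]) auto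
    have kernel_int: "integrable lborel (\<lambda>x. q x * (monomial \<delta> (z - x) * \<theta> x))" if "integrable lborel q" for q \<delta>
    proof -
      have "monomial \<delta> (z - x) * \<theta> x = indicator S x * (monomial \<delta> (z - x) * ?sk x)" for x
        by (simp add: \<theta>_def)
      then obtain b where "\<And>x. \<bar>monomial \<delta> (z - x) * \<theta> x\<bar> \<le> b"
        using bounded[OF mon_cont] by metis
      then show ?thesis by (intro integrable_mult_bounded[OF that]) measurable
    qed
    \<comment> \<open>\<open>a \<beta>\<close> is the value at \<open>z\<close> of the averaged
      Taylor polynomial of degree \<open>m - mi_order \<beta>\<close> of the \<beta>-th derivative
      of \<open>v\<close>; it becomes the \<beta>-th derivative of \<open>Q v\<close> at
      \<open>z\<close>.\<close>
    define a where "a \<beta> = (\<Sum>\<delta> | mi_order \<beta> + mi_order \<delta> \<le> m.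
        \<integral>x. V (mi_add \<beta> \<delta>) x * (monomial \<delta> (z - x) * \<theta> x) \<partial>lborel)" for \<beta>
    let ?P = "poly_deriv m a z"
    have fin: "finite {\<beta> :: 'n multi_index. j + mi_order \<beta> \<le> m}" for j
      by (rule finite_subset[OF _ finite_multi_index[of m]]) auto
    \<comment> \<open>Writing \<open>y - x = (y - z) + (z - x)\<close> and expanding separates
      \<open>y\<close> from the variable of integration; the coefficients that remain are the
      numbers \<open>a \<gamma>\<close>.\<close>
    have Q: "(LINT x:S|lebesgue. taylor_poly m S v x y * ?sk x) = ?P (\<lambda>_. 0) y" for y
    proof -
      let ?f' = "\<lambda>x. (\<Sum>\<beta> | mi_order \<beta> \<le> m. V \<beta> x * monomial \<beta> (y - x)) * \<theta> x"
      have neg': "negligible (\<Union>\<beta>\<in>{\<beta>. mi_order \<beta> \<le> m}. {x \<in> S. weak_deriv S \<beta> v x \<noteq> V \<beta> x})"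
        by (intro negligible_Union finite_imageI finite_multi_index) (auto intro: V(3))
      have neg: "negligible {x \<in> S. taylor_poly m S v x y * ?sk x \<noteq> ?f' x}"
      proof (rule negligible_subset[OF neg'], rule subsetI, rule ccontr)
        fix x assume x: "x \<in> {x \<in> S. taylor_poly m S v x y * ?sk x \<noteq> ?f' x}"
          "x \<notin> (\<Union>\<beta>\<in>{\<beta>. mi_order \<beta> \<le> m}. {x \<in> S. weak_deriv S \<beta> v x \<noteq> V \<beta> x})"
        then have "weak_deriv S \<beta> v x = V \<beta> x" if "mi_order \<beta> \<le> m" for \<beta> using that by auto
        then have "taylor_poly m S v x y = (\<Sum>\<beta> | mi_order \<beta> \<le> m. V \<beta> x * monomial \<beta> (y - x))"
          unfolding taylor_poly_def by (intro sum.cong refl) (simp add: monomial_def)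
        with x(1) show False by (auto simp: \<theta>_def)
      qed
      have "(LINT x:S|lebesgue. taylor_poly m S v x y * ?sk x) = (\<integral>x. ?f' x \<partial>lborel)"
        by (rule LINT_rep[OF Sb _ _ neg])
           (use V(1) \<theta>_out in \<open>auto intro!: borel_measurable_times borel_measurable_sum\<close>)
      also have "\<dots> = (\<integral>x. (\<Sum>\<gamma> | 0 + mi_order \<gamma> \<le> m. \<Sum>\<delta> | 0 + mi_order \<gamma> + mi_order \<delta> \<le> m.
          V (mi_add \<gamma> \<delta>) x * (monomial \<gamma> (y - z) * monomial \<delta> (z - x))) * \<theta> x \<partial>lborel)"
        by (subst taylor_sum_rearrange[symmetric]) simp
      also have "\<dots> = (\<integral>x. (\<Sum>\<gamma> | mi_order \<gamma> \<le> m. \<Sum>\<delta> | mi_order \<gamma> + mi_order \<delta> \<le> m.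
          monomial \<gamma> (y - z) * (V (mi_add \<gamma> \<delta>) x * (monomial \<delta> (z - x) * \<theta> x))) \<partial>lborel)"
        by (simp add: sum_distrib_left sum_distrib_right mult_ac)
      also have "\<dots> = (\<Sum>\<gamma> | mi_order \<gamma> \<le> m. \<Sum>\<delta> | mi_order \<gamma> + mi_order \<delta> \<le> m.
          monomial \<gamma> (y - z) * (\<integral>x. V (mi_add \<gamma> \<delta>) x * (monomial \<delta> (z - x) * \<theta> x) \<partial>lborel))"
      proof -
        have i: "integrable lborel (\<lambda>x. monomial \<gamma> (y - z) * (V (mi_add \<gamma> \<delta>) x * (monomial \<delta> (z - x) * \<theta> x)))"
          if "mi_order \<gamma> + mi_order \<delta> \<le> m" for \<gamma> \<delta>
          using that by (intro integrable_mult_right kernel_int V_int) (simp add: mi_order_add)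
        show ?thesis
          by (subst Bochner_Integration.integral_sum, (intro Bochner_Integration.integrable_sum i; simp),
              intro sum.cong refl, subst Bochner_Integration.integral_sum, (intro i; simp), simp)
      qed
      also have "\<dots> = ?P (\<lambda>_. 0) y"
        by (simp add: poly_deriv_def a_def mi_add_def sum_distrib_left sum_distrib_right mult_ac)
      finally show ?thesis .
    qed

    \<comment> \<open>The derivatives of \<open>v - Q v\<close> and their moments\<close>
    define W where "W \<kappa> x = V \<kappa> x - indicator S x * ?P \<kappa> x" for \<kappa> x
    have W1: "W \<kappa> \<in> borel_measurable borel" if "mi_order \<kappa> \<le> m + 1" for \<kappa>
      unfolding W_def using V(1)[OF that] by measurable
    have W2: "W \<kappa> x = 0" if "mi_order \<kappa> \<le> m + 1" "x \<notin> S" for \<kappa> x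
      using V(2)[OF that] that by (simp add: W_def)
    have P_energy: "integrable lborel (\<lambda>x. \<bar>indicator S x * ?P \<kappa> x\<bar> powr p * \<omega>' x)" for \<kappa>
    proof -
      obtain b where b: "\<And>x. \<bar>indicator S x * ?P \<kappa> x\<bar> \<le> b"
        using bounded[OF continuous_on_poly_deriv] by blast
      show ?thesis
      proof (rule Bochner_Integration.integrable_bound)
        show "integrable lborel (\<lambda>x. b powr p * (near (C * h) z x * \<omega>' x))"
          using weight_integrable[OF R] by auto
        show "AE x in lborel. norm (\<bar>indicator S x * ?P \<kappa> x\<bar> powr p * \<omega>' x) \<le> norm (b powr p * (near (C * h) z x * \<omega>' x))"
        proof (rule AE_I2)
          fix x
          show "norm (\<bar>indicator S x * ?P \<kappa> x\<bar> powr p * \<omega>' x) \<le> norm (b powr p * (near (C * h) z x * \<omega>' x))"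
          proof (cases "x \<in> S")
            case True
            then have "near (C * h) z x = 1" using S(2) by (auto simp: near_alt)
            moreover have "\<bar>indicator S x * ?P \<kappa> x\<bar> powr p \<le> b powr p"
              using b[of x] p by (intro powr_mono2) auto
            ultimately show ?thesis using w0[of x] by (simp add: mult_right_mono)
          qed simp
        qed
      qed measurable
    qed
    have W3: "integrable lborel (\<lambda>x. \<bar>W \<kappa> x\<bar> powr p * \<omega>' x)" if \<kappa>: "mi_order \<kappa> \<le> m + 1" for \<kappa>
    proof (rule Bochner_Integration.integrable_bound)
      show "integrable lborel (\<lambda>x. 2 powr p * (\<bar>V \<kappa> x\<bar> powr p * \<omega>' x + \<bar>indicator S x * ?P \<kappa> x\<bar> powr p * \<omega>' x))"
        using V(4)[OF \<kappa>] P_energy[of \<kappa>] by auto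
      show "AE x in lborel. norm (\<bar>W \<kappa> x\<bar> powr p * \<omega>' x) \<le>
          norm (2 powr p * (\<bar>V \<kappa> x\<bar> powr p * \<omega>' x + \<bar>indicator S x * ?P \<kappa> x\<bar> powr p * \<omega>' x))"
      proof (rule AE_I2)
        fix x
        let ?q = "indicator S x * ?P \<kappa> x"
        have "\<bar>W \<kappa> x\<bar> powr p \<le> (\<bar>V \<kappa> x\<bar> + \<bar>?q\<bar>) powr p"
          unfolding W_def using p by (intro powr_mono2) auto
        also have "\<dots> \<le> 2 powr p * (\<bar>V \<kappa> x\<bar> powr p + \<bar>?q\<bar> powr p)"
          using p by (intro powr_add_le) auto
        finally have "\<bar>W \<kappa> x\<bar> powr p * \<omega>' x \<le> 2 powr p * (\<bar>V \<kappa> x\<bar> powr p + \<bar>?q\<bar> powr p) * \<omega>' x"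
          by (rule mult_right_mono[OF _ w0])
        then have *: "\<bar>W \<kappa> x\<bar> powr p * \<omega>' x \<le> 2 powr p * (\<bar>V \<kappa> x\<bar> powr p * \<omega>' x + \<bar>?q\<bar> powr p * \<omega>' x)"
          by (simp add: distrib_right mult.assoc)
        have "0 \<le> \<bar>W \<kappa> x\<bar> powr p * \<omega>' x" using w0[of x] by simp
        with * show "norm (\<bar>W \<kappa> x\<bar> powr p * \<omega>' x) \<le>
          norm (2 powr p * (\<bar>V \<kappa> x\<bar> powr p * \<omega>' x + \<bar>?q\<bar> powr p * \<omega>' x))"
          unfolding real_norm_def by linarith
      qed
    qed (use W1[OF \<kappa>] in measurable)
    have W_int: "integrable lborel (W \<kappa>)" if "mi_order \<kappa> \<le> m + 1" for \<kappa>
      by (rule supported_integrable[OF W1[OF that] _ W3[OF that] R]) (rule W2[OF that out])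
    have P_int: "integrable lborel (\<lambda>x. indicator S x * ?P \<kappa> x)" for \<kappa>
    proof (rule supported_integrable[OF _ _ P_energy R])
      show "indicator S x * ?P \<kappa> x = 0" if "x \<notin> ball z (C * h)" for x
        using out[OF that] by simp
    qed measurable
    have W_weak: "(\<integral>x. W \<alpha> x * partial i \<phi> x \<partial>lborel) = - (\<integral>x. W (mi_add \<alpha> (mi_unit i)) x * \<phi> x \<partial>lborel)"
      if \<alpha>: "mi_order \<alpha> \<le> m" and \<phi>: "test_function S \<phi>" for \<alpha> i \<phi>
    proof -
      have W_test: "(\<integral>x. W \<kappa> x * \<eta> x \<partial>lborel) = (\<integral>x. V \<kappa> x * \<eta> x \<partial>lborel) - (\<integral>x. ?P \<kappa> x * \<eta> x \<partial>lborel)"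
        if \<kappa>: "mi_order \<kappa> \<le> m + 1" and \<eta>: "test_function S \<eta>" for \<kappa> \<eta>
      proof -
        have [measurable]: "\<eta> \<in> borel_measurable borel" by (rule test_function_borel[OF \<eta>])
        obtain b where b: "\<And>x. \<bar>\<eta> x\<bar> \<le> b" using test_function_bounded[OF \<eta>] by blast
        have "(\<integral>x. W \<kappa> x * \<eta> x \<partial>lborel) = (\<integral>x. V \<kappa> x * \<eta> x - (indicator S x * ?P \<kappa> x) * \<eta> x \<partial>lborel)"
          by (simp add: W_def left_diff_distrib)
        also have "\<dots> = (\<integral>x. V \<kappa> x * \<eta> x \<partial>lborel) - (\<integral>x. (indicator S x * ?P \<kappa> x) * \<eta> x \<partial>lborel)"
          by (intro Bochner_Integration.integral_diff integrable_mult_bounded[OF _ _ b] V_int P_int \<kappa>) measurable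
        also have "(\<integral>x. (indicator S x * ?P \<kappa> x) * \<eta> x \<partial>lborel) = (\<integral>x. ?P \<kappa> x * \<eta> x \<partial>lborel)"
          using test_function_zero[OF \<eta>]
          by (intro Bochner_Integration.integral_cong refl) (auto simp: indicator_def)
        finally show ?thesis .
      qed
      show ?thesis
        using \<alpha> V_weak[OF \<alpha> \<phi>, of i] poly_deriv_by_parts[OF \<phi>, of m a z \<alpha> i]
        by (simp add: W_test \<phi> test_function_partial mi_order_add)
    qed
    \<comment> \<open>The moments of \<open>V\<close> add up to \<open>a \<alpha>\<close> by
      definition, and those of the polynomial do so by \<open>poly_deriv_taylor\<close> and because
      \<theta> has integral 1. The two contributions cancel.\<close>
    have W_moment: "(\<Sum>\<beta> | mi_order \<alpha> + mi_order \<beta> \<le> m.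
        \<integral>x. W (mi_add \<alpha> \<beta>) x * (mi_power (z - x) \<beta> / mi_fact \<beta> * \<theta> x) \<partial>lborel) = 0"
      if \<alpha>: "mi_order \<alpha> \<le> m" for \<alpha>
    proof -
      have "(\<integral>x. W (mi_add \<alpha> \<beta>) x * (monomial \<beta> (z - x) * \<theta> x) \<partial>lborel) =
        (\<integral>x. V (mi_add \<alpha> \<beta>) x * (monomial \<beta> (z - x) * \<theta> x) \<partial>lborel) -
        (\<integral>x. (indicator S x * ?P (mi_add \<alpha> \<beta>) x) * (monomial \<beta> (z - x) * \<theta> x) \<partial>lborel)"
        if "mi_order \<alpha> + mi_order \<beta> \<le> m" for \<beta>
        unfolding W_def left_diff_distrib
        by (intro Bochner_Integration.integral_diff kernel_int V_int P_int) (use that in \<open>simp add: mi_order_add\<close>)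
      then have "(\<Sum>\<beta> | mi_order \<alpha> + mi_order \<beta> \<le> m. \<integral>x. W (mi_add \<alpha> \<beta>) x * (monomial \<beta> (z - x) * \<theta> x) \<partial>lborel)
        = a \<alpha> - (\<Sum>\<beta> | mi_order \<alpha> + mi_order \<beta> \<le> m.
            \<integral>x. (indicator S x * ?P (mi_add \<alpha> \<beta>) x) * (monomial \<beta> (z - x) * \<theta> x) \<partial>lborel)"
        by (simp add: a_def sum_subtractf)
      also have "(\<Sum>\<beta> | mi_order \<alpha> + mi_order \<beta> \<le> m.
            \<integral>x. (indicator S x * ?P (mi_add \<alpha> \<beta>) x) * (monomial \<beta> (z - x) * \<theta> x) \<partial>lborel) =
          (\<integral>x. (\<Sum>\<beta> | mi_order \<alpha> + mi_order \<beta> \<le> m. (indicator S x * ?P (mi_add \<alpha> \<beta>) x) * (monomial \<beta> (z - x) * \<theta> x)) \<partial>lborel)"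
        by (rule Bochner_Integration.integral_sum[symmetric]) (intro kernel_int P_int)
      also have "\<dots> = (\<integral>x. a \<alpha> * \<theta> x \<partial>lborel)"
      proof (intro Bochner_Integration.integral_cong refl)
        fix x
        have "(\<Sum>\<beta> | mi_order \<alpha> + mi_order \<beta> \<le> m. (indicator S x * ?P (mi_add \<alpha> \<beta>) x) * (monomial \<beta> (z - x) * \<theta> x))
          = (\<Sum>\<beta> | mi_order \<alpha> + mi_order \<beta> \<le> m. ?P (mi_add \<alpha> \<beta>) x * monomial \<beta> (z - x)) * (indicator S x * \<theta> x)"
          by (simp add: sum_distrib_left sum_distrib_right mult_ac)
        also have "\<dots> = a \<alpha> * \<theta> x"
          by (simp add: poly_deriv_taylor[OF \<alpha>] \<theta>_def indicator_def)
        finally show "(\<Sum>\<beta> | mi_order \<alpha> + mi_order \<beta> \<le> m. (indicator S x * ?P (mi_add \<alpha> \<beta>) x) * (monomial \<beta> (z - x) * \<theta> x))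
          = a \<alpha> * \<theta> x" .
      qed
      also have "\<dots> = a \<alpha>" by (simp add: \<theta>_one)
      finally show ?thesis by (simp add: monomial_def)
    qed
    have main: "(h powr p) ^ mi_order \<alpha> * energy (W \<alpha>)
      \<le> (1 + L ?A * N) ^ (m + 1) * ((h powr p) ^ (m + 1) * (\<Sum>\<kappa> | mi_order \<kappa> = m + 1. energy (W \<kappa>)))"
      if \<alpha>: "mi_order \<alpha> \<le> m + 1" for \<alpha>
      by (rule moment_family_energy[OF KK_def N_def L_def S c h _ W1 W2 W3 W_weak W_moment psi M r _ \<theta>_le \<theta>_out \<theta>_one \<alpha>])
         (use star in auto)

    \<comment> \<open>From energies back to Sobolev seminorms\<close>
    let ?u = "\<lambda>y. v y - (LINT x:S|lebesgue. taylor_poly m S v x y * ?sk x)"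
    have u_rep: "negligible {x \<in> S. ?u x \<noteq> W (\<lambda>_. 0) x}"
      by (rule negligible_subset[OF v_V]) (auto simp: W_def Q)
    have W_rep: "negligible {x \<in> S. W \<kappa> x \<noteq> W \<kappa> x}" for \<kappa> by simp
    have W_iter: "(\<integral>x. W \<alpha> x * iterated_partial js \<phi> x \<partial>lborel) =
        (- 1) ^ length js * (\<integral>x. W (mi_add \<alpha> (count_list js)) x * \<phi> x \<partial>lborel)"
      if "test_function S \<phi>" "mi_order \<alpha> + length js \<le> m + 1" for \<alpha> js \<phi>
      using that(2)
    proof (induction js arbitrary: \<alpha>)
      case Nil
      have "count_list [] = (\<lambda>_ :: 'n. 0)" by (simp add: fun_eq_iff)
      then show ?case by simp
    next
      case (Cons i js)
      then have \<alpha>: "mi_order \<alpha> \<le> m" by simp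
      have "(\<integral>x. W \<alpha> x * partial i (iterated_partial js \<phi>) x \<partial>lborel)
        = - (\<integral>x. W (mi_add \<alpha> (mi_unit i)) x * iterated_partial js \<phi> x \<partial>lborel)"
        by (rule W_weak[OF \<alpha> test_function_iterated[OF that(1)]])
      also have "\<dots> = - ((- 1) ^ length js * (\<integral>x. W (mi_add (mi_add \<alpha> (mi_unit i)) (count_list js)) x * \<phi> x \<partial>lborel))"
        using Cons by (simp add: mi_order_add)
      finally show ?case unfolding index_count_eq by simp
    qed
    \<comment> \<open>\<open>W \<kappa>\<close> is given by a formula and still has to be recognised
      as a weak derivative of \<open>v - Q v\<close>, by iterating the first-order rule along
      \<open>index_list \<kappa>\<close>.\<close>
    have W_wd: "has_weak_deriv S \<kappa> ?u (W \<kappa>)" if \<kappa>: "mi_order \<kappa> \<le> m + 1" for \<kappa>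
      unfolding has_weak_deriv_def
    proof (intro conjI allI impI)
      have 0: "mi_order (\<lambda>_ :: 'n. 0) \<le> m + 1" by simp
      show "locally_integrable_on ?u S"
        by (rule absolutely_integrable_imp_locally)
           (use absolutely_integrable_rep[OF Sb W1[OF 0] W2[OF 0] u_rep] W_int[OF 0] in blast)
      show "locally_integrable_on (W \<kappa>) S"
        by (rule absolutely_integrable_imp_locally)
           (use absolutely_integrable_rep[OF Sb W1[OF \<kappa>] W2[OF \<kappa>] W_rep] W_int[OF \<kappa>] in blast)
      fix \<phi> assume \<phi>: "test_function S \<phi>"
      have b: "classical_deriv \<kappa> \<phi> \<in> borel_measurable borel"
        unfolding classical_deriv_def by (rule test_function_borel[OF test_function_iterated[OF \<phi>]])
      have len: "length (index_list \<kappa>) = mi_order \<kappa>" by (rule length_eq_mi_order) (rule count_index_list)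
      have "count_list (index_list \<kappa>) = \<kappa>" by (simp add: fun_eq_iff count_index_list)
      then have cnt: "mi_add (\<lambda>_. 0) (count_list (index_list \<kappa>)) = \<kappa>" by (simp add: mi_add_def)
      have "(LINT x:S|lebesgue. ?u x * classical_deriv \<kappa> \<phi> x) = (\<integral>x. W (\<lambda>_. 0) x * classical_deriv \<kappa> \<phi> x \<partial>lborel)"
        by (rule LINT_rep_mult[OF Sb W1[OF 0] W2[OF 0] u_rep b])
      also have "\<dots> = (- 1) ^ mi_order \<kappa> * (\<integral>x. W \<kappa> x * \<phi> x \<partial>lborel)"
        using W_iter[OF \<phi>, of "\<lambda>_. 0" "index_list \<kappa>"] \<kappa> by (simp add: classical_deriv_def len cnt)
      also have "(\<integral>x. W \<kappa> x * \<phi> x \<partial>lborel) = (LINT x:S|lebesgue. W \<kappa> x * \<phi> x)"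
        by (rule LINT_rep_mult[OF Sb W1[OF \<kappa>] W2[OF \<kappa>] W_rep test_function_borel[OF \<phi>], symmetric])
      finally show "(LINT x:S|lebesgue. ?u x * classical_deriv \<kappa> \<phi> x) = (- 1) ^ mi_order \<kappa> * (LINT x:S|lebesgue. W \<kappa> x * \<phi> x)" .
    qed
    have norm_energy: "weighted_Lp_norm p \<omega> S f powr p = energy f'"
      if f': "f' \<in> borel_measurable borel" "\<And>x. x \<notin> S \<Longrightarrow> f' x = 0" "negligible {x \<in> S. f x \<noteq> f' x}" for f f'
    proof -
      note [measurable] = f'(1)
      have "negligible ({x \<in> S. f x \<noteq> f' x} \<union> {x. \<omega> x \<noteq> \<omega>' x})" by (intro negligible_Un f' neg\<omega>)
      then have "negligible {x \<in> S. \<bar>f x\<bar> powr p * \<omega> x \<noteq> \<bar>f' x\<bar> powr p * \<omega>' x}"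
        by (rule negligible_subset) auto
      then have "(LINT x:S|lebesgue. \<bar>f x\<bar> powr p * \<omega> x) = energy f'"
        unfolding energy_def by (intro LINT_rep[OF Sb]) (auto simp: f'(2))
      then show ?thesis
        unfolding weighted_Lp_norm_def using p energy_nonneg[of f'] by (simp add: powr_powr)
    qed
    have norm_u: "weighted_Lp_norm p \<omega> S (weak_deriv S \<kappa> ?u) powr p = energy (W \<kappa>)" if \<kappa>: "mi_order \<kappa> \<le> m + 1" for \<kappa>
    proof (rule norm_energy[OF W1[OF \<kappa>] W2[OF \<kappa>]])
      have "has_weak_deriv S \<kappa> ?u (weak_deriv S \<kappa> ?u)"
        using someI[of "has_weak_deriv S \<kappa> ?u", OF W_wd[OF \<kappa>]] by (simp add: weak_deriv_def)
      then show "negligible {x \<in> S. weak_deriv S \<kappa> ?u x \<noteq> W \<kappa> x}"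
        by (rule weak_deriv_unique[OF _ W_wd[OF \<kappa>] S(1) psi r])
    qed
    \<comment> \<open>At order \<open>m + 1\<close> the polynomial part is 0, so the top energies
      belong to \<open>v\<close> alone.\<close>
    have norm_v: "weighted_Lp_norm p \<omega> S (weak_deriv S \<kappa> v) powr p = energy (W \<kappa>)" if \<kappa>: "mi_order \<kappa> = m + 1" for \<kappa>
    proof (rule norm_energy[OF W1 W2])
      have "W \<kappa> = V \<kappa>" using \<kappa> by (simp add: W_def poly_deriv_top fun_eq_iff)
      then show "negligible {x \<in> S. weak_deriv S \<kappa> v x \<noteq> W \<kappa> x}" using V(3)[of \<kappa>] \<kappa> by simp
    qed (use \<kappa> in auto)
    let ?T = "\<Sum>\<kappa> | mi_order \<kappa> = m + 1. energy (W \<kappa>)" and ?G = "(1 + L ?A * N) ^ (m + 1)"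
    have T0: "0 \<le> ?T" by (intro sum_nonneg energy_nonneg)
    have N0: "0 \<le> N" by (simp add: N_def)
    have G0: "0 \<le> ?G"
    proof -
      have B0: "0 \<le> KK ?A" unfolding KK_def using A_nonneg by auto
      then have "0 \<le> L ?A" unfolding L_def using A_nonneg
        by (intro add_nonneg_nonneg mult_nonneg_nonneg) auto
      then show ?thesis using N0 by simp
    qed
    \<comment> \<open>Cancelling the positive factor \<open>(h powr p) ^ k\<close> leaves the
      exponent \<open>m + 1 - k\<close>.\<close>
    have each: "energy (W \<kappa>) \<le> ?G * ((h ^ (m + 1 - k)) powr p * ?T)" if \<kappa>: "mi_order \<kappa> = k" for \<kappa>
    proof -
      have H: "0 < (h powr p) ^ k" using h by simp
      have "(h powr p) ^ (m + 1) = (h powr p) ^ k * (h powr p) ^ (m + 1 - k)"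
        using k by (simp flip: power_add)
      then have "(h powr p) ^ k * energy (W \<kappa>) \<le> (h powr p) ^ k * (?G * ((h powr p) ^ (m + 1 - k) * ?T))"
        using main[of \<kappa>] \<kappa> k by (simp add: mult_ac)
      then have "energy (W \<kappa>) \<le> ?G * ((h powr p) ^ (m + 1 - k) * ?T)"
        using H by (simp only: mult_le_cancel_left_pos)
      then show ?thesis using h by (simp add: power_powr)
    qed
    have card_le: "real (card {\<kappa> :: 'n multi_index. mi_order \<kappa> = k}) \<le> N"
      unfolding N_def using k by (intro of_nat_mono card_mono finite_multi_index) auto
    have "(\<Sum>\<kappa> | mi_order \<kappa> = k. weighted_Lp_norm p \<omega> S (weak_deriv S \<kappa> ?u) powr p) = (\<Sum>\<kappa> | mi_order \<kappa> = k. energy (W \<kappa>))"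
      using k by (intro sum.cong refl norm_u) auto
    also have "\<dots> \<le> (\<Sum>\<kappa> | mi_order (\<kappa> :: 'n multi_index) = k. ?G * ((h ^ (m + 1 - k)) powr p * ?T))"
      by (intro sum_mono each) auto
    also have "\<dots> = real (card {\<kappa> :: 'n multi_index. mi_order \<kappa> = k}) * (?G * ((h ^ (m + 1 - k)) powr p * ?T))" by simp
    also have "\<dots> \<le> N * (?G * ((h ^ (m + 1 - k)) powr p * ?T))"
      using card_le G0 T0 by (intro mult_right_mono) auto
    also have "\<dots> = (N * ?G) * ((h ^ (m + 1 - k)) powr p * ?T)" by (simp only: mult.assoc)
    finally have bound: "(\<Sum>\<kappa> | mi_order \<kappa> = k. weighted_Lp_norm p \<omega> S (weak_deriv S \<kappa> ?u) powr p)
        \<le> (N * ?G) * ((h ^ (m + 1 - k)) powr p * ?T)" .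
    have "weighted_seminorm k p \<omega> S ?u \<le> ((N * ?G) * ((h ^ (m + 1 - k)) powr p * ?T)) powr (1 / p)"
      unfolding weighted_seminorm_def using bound p by (intro powr_mono2 sum_nonneg) auto
    also have "\<dots> = (N * ?G) powr (1 / p) * (((h ^ (m + 1 - k)) powr p) powr (1 / p) * ?T powr (1 / p))"
      by (simp only: powr_mult)
    also have "((h ^ (m + 1 - k)) powr p) powr (1 / p) = h ^ (m + 1 - k)"
      using p h by (simp add: powr_powr)
    also have "?T = (\<Sum>\<kappa> | mi_order \<kappa> = m + 1. weighted_Lp_norm p \<omega> S (weak_deriv S \<kappa> v) powr p)"
      by (intro sum.cong refl norm_v[symmetric]) auto
    finally show "weighted_seminorm k p \<omega> S ?u \<le> K ?A * h ^ (m + 1 - k) * weighted_seminorm (m + 1) p \<omega> S v"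
      by (simp add: K_def weighted_seminorm_def mult.assoc)
  qed
qed

section \<open>Geometry of the patch of an interior node\<close>

text \<open>An affine function is stored as its constant term and its gradient, so that
  \<open>snd \<phi>\<close> is available in the size estimates.\<close>

definition aff :: "real \<times> 'a \<Rightarrow> 'a::real_inner \<Rightarrow> real" where
  "aff \<phi> x = fst \<phi> + snd \<phi> \<bullet> x"

lemma aff_sum:
  assumes "sum u I = 1"
  shows "aff \<phi> (\<Sum>i\<in>I. u i *\<^sub>R e i) = (\<Sum>i\<in>I. u i * aff \<phi> (e i))"
  using assms by (simp add: aff_def inner_sum_right distrib_left sum.distrib flip: sum_distrib_right)

lemma aff_segment: "aff \<phi> (x + t *\<^sub>R (y - x)) = (1 - t) * aff \<phi> x + t * aff \<phi> y"
  by (simp add: aff_def inner_add_right inner_diff_right algebra_simps)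

lemma aff_nonneg_iff: "0 \<le> aff \<phi> x \<longleftrightarrow> - fst \<phi> \<le> snd \<phi> \<bullet> x"
  by (auto simp: aff_def)

lemma aff_pos_iff: "0 < aff \<phi> x \<longleftrightarrow> - fst \<phi> < snd \<phi> \<bullet> x"
  by (auto simp: aff_def)

lemma aff_diff: "aff \<phi> x - aff \<phi> y = snd \<phi> \<bullet> (x - y)"
  by (simp add: aff_def inner_diff_right)

text \<open>Simplices and rectangles are both cut out by affine functions with values in the unit
  interval that are 0 or 1 at the extreme points: barycentric coordinates, or the normalised
  coordinates and their complements.\<close>

definition slab_rep :: "(real \<times> 'a) set \<Rightarrow> 'a::euclidean_space set \<Rightarrow> bool" where
  "slab_rep \<Phi> T \<longleftrightarrow> finite \<Phi> \<and> bounded T \<and> T = {x. \<forall>\<phi>\<in>\<Phi>. 0 \<le> aff \<phi> x} \<and>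
     (\<forall>\<phi>\<in>\<Phi>. \<forall>x\<in>T. aff \<phi> x \<le> 1) \<and>
     (\<forall>\<phi>\<in>\<Phi>. \<forall>e. e extreme_point_of T \<longrightarrow> aff \<phi> e = 0 \<or> aff \<phi> e = 1) \<and>
     (\<exists>b. \<forall>\<phi>\<in>\<Phi>. 0 < aff \<phi> b)"

text \<open>A second vertex \<open>u\<close> serves as origin: the differences of the other vertices
  from it are independent, so a linear functional can be prescribed as 1 on \<open>v - u\<close> and
  0 on the rest. Its adjoint, applied to 1, is the gradient.\<close>

lemma barycentric_coordinate:
  fixes V :: "'a::euclidean_space set"
  assumes V: "\<not> affine_dependent V" and v: "v \<in> V" and u: "u \<in> V" "u \<noteq> v"
  shows "\<exists>\<phi>. aff \<phi> v = 1 \<and> (\<forall>w\<in>V - {v}. aff \<phi> w = 0)"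
proof -
  let ?B = "(\<lambda>x. - u + x) ` (V - {u})"
  have "independent ?B" using V affine_dependent_iff_dependent2[OF u(1)] by auto
  from linear_independent_extend[OF this, of "\<lambda>x. if x = - u + v then 1 else (0::real)"]
  obtain g :: "'a \<Rightarrow> real" where g: "linear g" "\<And>x. x \<in> ?B \<Longrightarrow> g x = (if x = - u + v then 1 else 0)" by blast
  let ?\<phi> = "(- g u, adjoint g 1)"
  have aff: "aff ?\<phi> x = g (- u + x)" for x
    using adjoint_works[OF g(1), of x 1]
    by (simp add: aff_def inner_commute linear_add[OF g(1)] linear_diff[OF g(1)])
  have "aff ?\<phi> w = (if w = v then 1 else 0)" if "w \<in> V" for w
  proof (cases "w = u")
    case True
    then show ?thesis using u(2) linear_0[OF g(1)] by (simp add: aff)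
  next
    case False
    then have "- u + w \<in> ?B" using that by auto
    from g(2)[OF this] show ?thesis by (simp add: aff)
  qed
  with v show ?thesis by (intro exI[of _ ?\<phi>]) auto
qed

text \<open>By full dimension every point is an affine combination of the vertices, so nonnegativity
  of the barycentric coordinates alone describes \<open>T\<close>. Positive dimension supplies the
  second vertex for \<open>barycentric_coordinate\<close>.\<close>

lemma slab_rep_simplex:
  fixes T :: "'a::euclidean_space set"
  assumes "int DIM('a) simplex T"
  shows "\<exists>\<Phi>. slab_rep \<Phi> T"
proof -
  obtain V where V: "\<not> affine_dependent V" "card V = DIM('a) + 1" "T = convex hull V"
    using assms unfolding simplex_def by auto
  have fin: "finite V" using V(2) by (metis card.infinite add_is_0 zero_neq_one)
  have "\<exists>\<phi>. aff \<phi> v = 1 \<and> (\<forall>w\<in>V - {v}. aff \<phi> w = 0)" if "v \<in> V" for v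
  proof -
    have "card (V - {v}) = DIM('a)" using V(2) that fin by simp
    then have "V - {v} \<noteq> {}" using DIM_positive[where 'a='a] by (metis card.empty less_irrefl)
    then obtain u where "u \<in> V" "u \<noteq> v" by auto
    then show ?thesis by (rule barycentric_coordinate[OF V(1) that])
  qed
  then obtain f where f: "\<And>v. v \<in> V \<Longrightarrow> aff (f v) v = 1" "\<And>v w. v \<in> V \<Longrightarrow> w \<in> V \<Longrightarrow> w \<noteq> v \<Longrightarrow> aff (f v) w = 0"
    by (metis DiffI singletonD)
  have coord: "aff (f v) (\<Sum>w\<in>V. u w *\<^sub>R w) = u v" if "v \<in> V" "sum u V = 1" for u v
  proof -
    have "aff (f v) (\<Sum>w\<in>V. u w *\<^sub>R w) = (\<Sum>w\<in>V. u w * aff (f v) w)" by (rule aff_sum[OF that(2)])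
    also have "\<dots> = (\<Sum>w\<in>V. if w = v then u v else 0)"
      using f that by (intro sum.cong refl) auto
    finally show ?thesis using that fin by simp
  qed
  have full: "affine hull V = UNIV"
    using aff_dim_affine_independent[OF V(1)] V(2) by (simp add: aff_dim_eq_full[symmetric])
  have T: "T = {y. \<exists>u. (\<forall>x\<in>V. 0 \<le> u x) \<and> sum u V = 1 \<and> (\<Sum>v\<in>V. u v *\<^sub>R v) = y}"
    unfolding V(3) by (rule convex_hull_finite[OF fin])
  have eq: "T = {x. \<forall>\<phi>\<in>f ` V. 0 \<le> aff \<phi> x}"
  proof (intro set_eqI iffI)
    fix x assume "x \<in> T"
    then obtain u where "\<forall>x\<in>V. 0 \<le> u x" "sum u V = 1" "(\<Sum>v\<in>V. u v *\<^sub>R v) = x" unfolding T by blast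
    then show "x \<in> {x. \<forall>\<phi>\<in>f ` V. 0 \<le> aff \<phi> x}" using coord by auto
  next
    fix x assume x: "x \<in> {x. \<forall>\<phi>\<in>f ` V. 0 \<le> aff \<phi> x}"
    have "x \<in> affine hull V" using full by simp
    then obtain u where u: "sum u V = 1" "(\<Sum>v\<in>V. u v *\<^sub>R v) = x"
      unfolding affine_hull_finite[OF fin] by blast
    have "0 \<le> u v" if "v \<in> V" for v using x coord[OF that u(1)] u(2) that by auto
    with u show "x \<in> T" unfolding T by blast
  qed
  have "slab_rep (f ` V) T"
    unfolding slab_rep_def
  proof (intro conjI)
    show "finite (f ` V)" using fin by simp
    show "bounded T" unfolding V(3) by (rule bounded_convex_hull[OF finite_imp_bounded[OF fin]])
    show "T = {x. \<forall>\<phi>\<in>f ` V. 0 \<le> aff \<phi> x}" by (rule eq)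
    show "\<forall>\<phi>\<in>f ` V. \<forall>x\<in>T. aff \<phi> x \<le> 1"
    proof (intro ballI)
      fix \<phi> x assume "\<phi> \<in> f ` V" "x \<in> T"
      then obtain v u where v: "v \<in> V" "\<phi> = f v" and u: "\<forall>x\<in>V. 0 \<le> u x" "sum u V = 1" "(\<Sum>v\<in>V. u v *\<^sub>R v) = x"
        unfolding T by blast
      have "u v \<le> sum u V" using u(1) v(1) fin by (intro member_le_sum) auto
      then show "aff \<phi> x \<le> 1" using coord[OF v(1) u(2)] u v by simp
    qed
    show "\<forall>\<phi>\<in>f ` V. \<forall>e. e extreme_point_of T \<longrightarrow> aff \<phi> e = 0 \<or> aff \<phi> e = 1"
    proof (intro ballI allI impI)
      fix \<phi> e assume "\<phi> \<in> f ` V" "e extreme_point_of T"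
      then obtain v where v: "v \<in> V" "\<phi> = f v" and e: "e \<in> V"
        using extreme_point_of_convex_hull[of e V] unfolding V(3) by blast
      then show "aff \<phi> e = 0 \<or> aff \<phi> e = 1" using f by (cases "e = v") auto
    qed
    show "\<exists>b. \<forall>\<phi>\<in>f ` V. 0 < aff \<phi> b"
    proof (intro exI[of _ "\<Sum>w\<in>V. (1 / real (card V)) *\<^sub>R w"] ballI)
      fix \<phi> assume "\<phi> \<in> f ` V"
      then obtain v where v: "v \<in> V" "\<phi> = f v" by blast
      have "sum (\<lambda>_. 1 / real (card V)) V = 1" using V(2) by simp
      from coord[OF v(1) this] show "0 < aff \<phi> (\<Sum>w\<in>V. (1 / real (card V)) *\<^sub>R w)"
        using v V(2) by simp
    qed
  qed
  then show ?thesis by blast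
qed

text \<open>A coordinate strictly between its bounds could be moved both ways by the same amount,
  exhibiting \<open>e\<close> as a midpoint.\<close>

lemma extreme_point_of_cbox:
  fixes a b :: "real ^ 'n::finite"
  assumes "e extreme_point_of cbox a b"
  shows "e $ i = a $ i \<or> e $ i = b $ i"
proof (rule ccontr)
  assume no: "\<not> (e $ i = a $ i \<or> e $ i = b $ i)"
  have e: "a $ j \<le> e $ j" "e $ j \<le> b $ j" for j
    using assms unfolding extreme_point_of_def mem_box_cart by auto
  define d where "d = min (e $ i - a $ i) (b $ i - e $ i)"
  have d: "0 < d" using no e[of i] by (auto simp: d_def less_le)
  have d': "d \<le> e $ i - a $ i" "d \<le> b $ i - e $ i" by (auto simp: d_def)
  let ?x = "e - axis i d" and ?y = "e + axis i d"
  have ax: "axis i d $ j = (if j = i then d else 0)" for j by (simp add: axis_def)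
  have "?x \<in> cbox a b" "?y \<in> cbox a b"
    unfolding mem_box_cart using e d d' by (auto simp: ax intro: order_trans[OF e(1)] order_trans[OF _ e(2)] add_increasing2)
  moreover have "e \<in> open_segment ?x ?y"
  proof -
    have "?x $ i \<noteq> ?y $ i" using d by (simp add: ax)
    then have "?x \<noteq> ?y" by metis
    moreover have "e = (1 - 1/2) *\<^sub>R ?x + (1/2) *\<^sub>R ?y" by (simp add: algebra_simps flip: scaleR_add_left)
    ultimately show ?thesis unfolding in_segment by (intro conjI exI[of _ "1/2"]) auto
  qed
  ultimately show False using assms unfolding extreme_point_of_def by blast
qed

lemma corner_extreme_point_of_cbox:
  fixes a b :: "real ^ 'n::finite"
  assumes e: "\<And>i. e $ i = a $ i \<or> e $ i = b $ i" and ab: "\<And>i. a $ i < b $ i"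
  shows "e extreme_point_of cbox a b"
  unfolding extreme_point_of_def
proof (intro conjI ballI notI)
  show "e \<in> cbox a b" unfolding mem_box_cart using e ab by (metis less_imp_le order_refl)
  fix x y assume x: "x \<in> cbox a b" and y: "y \<in> cbox a b" and "e \<in> open_segment x y"
  then obtain t where t: "0 < t" "t < 1" "e = (1 - t) *\<^sub>R x + t *\<^sub>R y" "x \<noteq> y"
    unfolding in_segment by auto
  have "x $ i = y $ i" for i
  proof -
    have ei: "e $ i = (1 - t) * x $ i + t * y $ i" using t(3) by simp
    have xi: "a $ i \<le> x $ i" "x $ i \<le> b $ i" "a $ i \<le> y $ i" "y $ i \<le> b $ i"
      using x y unfolding mem_box_cart by auto
    show ?thesis
      using e[of i]
    proof
      assume "e $ i = a $ i"
      then have "(1 - t) * (x $ i - a $ i) + t * (y $ i - a $ i) = 0" using ei by (simp add: algebra_simps)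
      then have "(1 - t) * (x $ i - a $ i) = 0 \<and> t * (y $ i - a $ i) = 0"
        using xi t by (subst (asm) add_nonneg_eq_0_iff) auto
      then show ?thesis using t by simp
    next
      assume "e $ i = b $ i"
      then have "(1 - t) * (b $ i - x $ i) + t * (b $ i - y $ i) = 0" using ei by (simp add: algebra_simps)
      then have "(1 - t) * (b $ i - x $ i) = 0 \<and> t * (b $ i - y $ i) = 0"
        using xi t by (subst (asm) add_nonneg_eq_0_iff) auto
      then show ?thesis using t by simp
    qed
  qed
  then show False using t(4) by (simp add: vec_eq_iff)
qed

lemma slab_rep_rectangle:
  fixes T :: "(real ^ 'n::finite) set"
  assumes "n_rectangle T"
  shows "\<exists>\<Phi>. slab_rep \<Phi> T"
proof -
  obtain a b where ab: "\<And>i. a $ i < b $ i" and T: "T = cbox a b"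
    using assms unfolding n_rectangle_def by blast
  let ?d = "\<lambda>i. b $ i - a $ i"
  define lo where "lo i = (- a $ i / ?d i, axis i (1 / ?d i))" for i
  define hi where "hi i = (b $ i / ?d i, axis i (- 1 / ?d i))" for i
  let ?\<Phi> = "range lo \<union> range hi"
  have d: "0 < ?d i" for i using ab[of i] by simp
  have lo: "aff (lo i) x = (x $ i - a $ i) / ?d i" for i x
    by (simp add: lo_def aff_def inner_axis' diff_divide_distrib)
  have hi: "aff (hi i) x = (b $ i - x $ i) / ?d i" for i x
    by (simp add: hi_def aff_def inner_axis' diff_divide_distrib)
  have nonneg: "0 \<le> aff (lo i) x \<longleftrightarrow> a $ i \<le> x $ i" "0 \<le> aff (hi i) x \<longleftrightarrow> x $ i \<le> b $ i" for i x
    using d[of i] by (auto simp: lo hi pos_le_divide_eq)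
  have le_1: "aff (lo i) x \<le> 1 \<longleftrightarrow> x $ i \<le> b $ i" "aff (hi i) x \<le> 1 \<longleftrightarrow> a $ i \<le> x $ i" for i x
    using d[of i] by (auto simp: lo hi pos_divide_le_eq)
  have "slab_rep ?\<Phi> T"
    unfolding slab_rep_def
  proof (intro conjI)
    show "finite ?\<Phi>" by simp
    show "bounded T" unfolding T by simp
    show "T = {x. \<forall>\<phi>\<in>?\<Phi>. 0 \<le> aff \<phi> x}"
      unfolding T by (auto simp: mem_box_cart ball_Un nonneg)
    show "\<forall>\<phi>\<in>?\<Phi>. \<forall>x\<in>T. aff \<phi> x \<le> 1"
      unfolding T by (auto simp: mem_box_cart ball_Un le_1)
    show "\<forall>\<phi>\<in>?\<Phi>. \<forall>e. e extreme_point_of T \<longrightarrow> aff \<phi> e = 0 \<or> aff \<phi> e = 1"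
    proof (intro ballI allI impI)
      fix \<phi> e assume \<phi>: "\<phi> \<in> ?\<Phi>" and e: "e extreme_point_of T"
      from \<phi> obtain i where "\<phi> = lo i \<or> \<phi> = hi i" by blast
      then show "aff \<phi> e = 0 \<or> aff \<phi> e = 1"
        using extreme_point_of_cbox[OF e[unfolded T], of i] d[of i] by (auto simp: lo hi)
    qed
    have "0 < aff (lo i) ((1/2) *\<^sub>R (a + b))" "0 < aff (hi i) ((1/2) *\<^sub>R (a + b))" for i
      unfolding lo hi using ab[of i] by (auto intro!: divide_pos_pos)
    then show "\<exists>c. \<forall>\<phi>\<in>?\<Phi>. 0 < aff \<phi> c" by blast
  qed
  then show ?thesis by blast
qed

text \<open>For \<open>u j < 1\<close> the combination lies on the segment from \<open>e j\<close>
  to the normalised remainder, which belongs to \<open>T\<close> by convexity, and the face property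
  applies. In the degenerate cases the combination is \<open>e j\<close> itself.\<close>

lemma face_of_convex_sum:
  assumes F: "F face_of T" and T: "convex T" and I: "finite I"
    and u: "\<And>i. i \<in> I \<Longrightarrow> 0 \<le> u i" "sum u I = (1 :: real)" and e: "\<And>i. i \<in> I \<Longrightarrow> e i \<in> T"
    and z: "(\<Sum>i\<in>I. u i *\<^sub>R e i) \<in> F" and j: "j \<in> I" "0 < u j"
  shows "e j \<in> F"
proof -
  let ?z = "\<Sum>i\<in>I. u i *\<^sub>R e i"
  have s: "sum u (I - {j}) = 1 - u j" using u(2) I j by (simp add: sum_diff1)
  have zj: "?z = u j *\<^sub>R e j + (\<Sum>i\<in>I - {j}. u i *\<^sub>R e i)" by (rule sum.remove[OF I j(1)])
  have "0 \<le> sum u (I - {j})" using u(1) by (intro sum_nonneg) auto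
  then consider "u j = 1" | "u j < 1" using s by linarith
  then show ?thesis
  proof cases
    case 1
    then have "\<forall>i\<in>I - {j}. u i = 0"
      using sum_nonneg_eq_0_iff[of "I - {j}" u] s u(1) I by auto
    then have "?z = e j" using zj 1 by simp
    then show ?thesis using z by simp
  next
    case 2
    let ?y = "\<Sum>i\<in>I - {j}. (u i / (1 - u j)) *\<^sub>R e i"
    have y: "?y \<in> T"
      using u(1) e s 2 I by (intro convex_sum[OF _ T]) (auto simp flip: sum_divide_distrib)
    have "(1 - u j) *\<^sub>R ?y = (\<Sum>i\<in>I - {j}. u i *\<^sub>R e i)" using 2 by (simp add: scaleR_sum_right)
    then have z': "?z = (1 - u j) *\<^sub>R ?y + u j *\<^sub>R e j" using zj by simp
    show ?thesis
    proof (cases "?y = e j")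
      case True
      then have "?z = e j" using z' by (simp flip: scaleR_add_left)
      then show ?thesis using z by simp
    next
      case False
      then have "?z \<in> open_segment ?y (e j)" unfolding in_segment using z' 2 j by blast
      then show ?thesis using F y e[OF j(1)] z unfolding face_of_def by blast
    qed
  qed
qed

text \<open>Brings the nodes of simplices and rectangles to one form, with weights that are
  multiples of \<open>1 / max 1 m\<close>; from here on the shape of the element does not
  matter.\<close>

lemma node_combination:
  fixes z :: "real ^ 'n::finite"
  assumes "z \<in> nodes m \<T>"
  shows "\<exists>T\<in>\<T>. \<exists>E (a :: real ^ 'n \<Rightarrow> nat). finite E \<and> (\<forall>e\<in>E. e extreme_point_of T) \<and> sum a E = max 1 m \<and>
    z = (\<Sum>e\<in>E. (real (a e) / real (max 1 m)) *\<^sub>R e)"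
proof -
  let ?l = "max 1 m"
  obtain T where T: "T \<in> \<T>" "z \<in> simplex_nodes ?l T \<union> rectangle_nodes ?l T"
    using assms unfolding nodes_def by blast
  show ?thesis
  proof (intro bexI[of _ T])
    show "T \<in> \<T>" by (rule T)
    show "\<exists>E (a :: real ^ 'n \<Rightarrow> nat). finite E \<and> (\<forall>e\<in>E. e extreme_point_of T) \<and> sum a E = ?l \<and>
      z = (\<Sum>e\<in>E. (real (a e) / real ?l) *\<^sub>R e)"
      using T(2)
    proof
      assume "z \<in> simplex_nodes ?l T"
      then obtain V a where V: "\<not> affine_dependent V" "T = convex hull V" "(\<Sum>v\<in>V. a v) = ?l"
        "z = (\<Sum>v\<in>V. (real (a v) / real ?l) *\<^sub>R v)" unfolding simplex_nodes_def by blast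
      then show ?thesis
        using aff_independent_finite[OF V(1)] extreme_point_of_convex_hull_affine_independent[OF V(1)]
        by (intro exI[of _ V] exI[of _ a]) auto
    next
      assume "z \<in> rectangle_nodes ?l T"
      then obtain a b j where ab: "\<And>i. a $ i < b $ i" and T: "T = cbox a b"
        and j: "\<And>i. j i \<le> ?l" "\<And>i. z $ i = a $ i + (real (j i) / real ?l) * (b $ i - a $ i)"
        unfolding rectangle_nodes_def by blast
      \<comment> \<open>The \<open>t\<close>-th corner takes the upper bound in the coordinates with
        \<open>t < j i\<close>, so averaging over all \<open>t < ?l\<close> gives the upper bound of
        coordinate \<open>i\<close> the weight \<open>j i / ?l\<close>. Equal corners are merged,
        with multiplicity \<open>?c\<close>.\<close>
      define w where "w t = (\<chi> i. if t < j i then b $ i else a $ i)" for t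
      let ?E = "w ` {..<?l}" and ?c = "\<lambda>e. card {t \<in> {..<?l}. w t = e}"
      have ext: "w t extreme_point_of T" for t
        unfolding T by (rule corner_extreme_point_of_cbox[OF _ ab]) (simp add: w_def)
      have gen: "(\<Sum>e\<in>?E. real (?c e) *\<^sub>R e) = (\<Sum>t<?l. w t)"
      proof -
        have "(\<Sum>t<?l. w t) = (\<Sum>e\<in>?E. \<Sum>t | t \<in> {..<?l} \<and> w t = e. w t)"
          by (rule sum.image_gen) simp
        also have "\<dots> = (\<Sum>e\<in>?E. \<Sum>t | t \<in> {..<?l} \<and> w t = e. e)"
          by (intro sum.cong refl) auto
        finally show ?thesis by (simp only: sum_constant_scaleR)
      qed
      have card: "(\<Sum>e\<in>?E. ?c e) = ?l"
      proof -
        have "(\<Sum>t<?l. 1 :: nat) = (\<Sum>e\<in>?E. \<Sum>t | t \<in> {..<?l} \<and> w t = e. 1)"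
          by (rule sum.image_gen) simp
        then show ?thesis by simp
      qed
      have "z = (1 / real ?l) *\<^sub>R (\<Sum>t<?l. w t)"
      proof (rule vec_eq_iff[THEN iffD2], rule allI)
        fix i
        have "(\<Sum>t<?l. w t) $ i = (\<Sum>t<?l. a $ i + (if t < j i then b $ i - a $ i else 0))"
          unfolding sum_component by (intro sum.cong refl) (simp add: w_def)
        also have "\<dots> = real ?l * a $ i + (\<Sum>t\<in>{..<?l} \<inter> {t. t < j i}. b $ i - a $ i)"
          by (simp add: sum.distrib sum.If_cases)
        also have "{..<?l} \<inter> {t. t < j i} = {..<j i}" using j(1)[of i] by auto
        finally show "z $ i = ((1 / real ?l) *\<^sub>R (\<Sum>t<?l. w t)) $ i"
          using j(2)[of i] by (simp add: field_simps)
      qed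
      also have "\<dots> = (\<Sum>e\<in>?E. (real (?c e) / real ?l) *\<^sub>R e)"
        unfolding gen[symmetric] by (simp add: scaleR_sum_right)
      finally show ?thesis
        using ext card by (intro exI[of _ ?E] exI[of _ ?c]) auto
    qed
  qed
qed

lemma
  fixes T :: "'a::euclidean_space set"
  assumes "slab_rep \<Phi> T"
  shows slab_convex: "convex T" and slab_closed: "closed T" and slab_compact: "compact T"
proof -
  have T: "T = (\<Inter>\<phi>\<in>\<Phi>. {x. - fst \<phi> \<le> snd \<phi> \<bullet> x})" "bounded T"
  proof -
    have "T = {x. \<forall>\<phi>\<in>\<Phi>. 0 \<le> aff \<phi> x}" using assms unfolding slab_rep_def by blast
    also have "\<dots> = (\<Inter>\<phi>\<in>\<Phi>. {x. - fst \<phi> \<le> snd \<phi> \<bullet> x})" unfolding aff_nonneg_iff by blast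
    finally show "T = (\<Inter>\<phi>\<in>\<Phi>. {x. - fst \<phi> \<le> snd \<phi> \<bullet> x})" .
    show "bounded T" using assms unfolding slab_rep_def by blast
  qed
  show "convex T" unfolding T(1) by (intro convex_INT convex_halfspace_ge)
  show "closed T" unfolding T(1) by (intro closed_INT ballI closed_halfspace_ge)
  with T(2) show "compact T" by (simp add: compact_eq_bounded_closed)
qed

lemma slab_interior:
  fixes T :: "'a::euclidean_space set"
  assumes "slab_rep \<Phi> T"
  shows "\<exists>x s. 0 < s \<and> cball x s \<subseteq> T"
proof -
  obtain b where b: "\<forall>\<phi>\<in>\<Phi>. 0 < aff \<phi> b" and fin: "finite \<Phi>" and T: "T = {x. \<forall>\<phi>\<in>\<Phi>. 0 \<le> aff \<phi> x}"
    using assms unfolding slab_rep_def by blast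
  let ?U = "\<Inter>\<phi>\<in>\<Phi>. {x. - fst \<phi> < snd \<phi> \<bullet> x}"
  have "open ?U" by (intro open_INT fin ballI open_halfspace_gt)
  moreover have "b \<in> ?U" using b unfolding aff_pos_iff by blast
  ultimately obtain s where "0 < s" "cball b s \<subseteq> ?U" using open_contains_cball by blast
  moreover have "?U \<subseteq> T" unfolding T aff_nonneg_iff using less_imp_le by blast
  ultimately show ?thesis by blast
qed

text \<open>Behind the gradient bound is the width \<open>1 / norm (snd \<phi>)\<close> of the slab
  \<open>0 \<le> aff \<phi> \<le> 1\<close>, which limits the diameter of every ball in
  \<open>T\<close>. \<open>inner_diameter\<close> is a supremum not shown to be attained, hence the
  formulation with \<open>q\<close>.\<close>

lemma
  fixes T :: "(real ^ 'n::finite) set"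
  assumes T: "slab_rep \<Phi> T"
  shows inner_diameter_pos: "0 < inner_diameter T"
    and less_inner_diameter: "q < inner_diameter T \<Longrightarrow> \<exists>x s. q < 2 * s \<and> 0 \<le> s \<and> cball x s \<subseteq> T"
    and slab_gradient: "\<phi> \<in> \<Phi> \<Longrightarrow> norm (snd \<phi>) * inner_diameter T \<le> 1"
    and slab_diameter_pos: "0 < diameter T"
proof -
  let ?D = "{2 * s |x s. s \<ge> 0 \<and> cball x s \<subseteq> T}"
  have bT: "bounded T" using T unfolding slab_rep_def by blast
  obtain x0 s0 where s0: "0 < s0" "cball x0 s0 \<subseteq> T" using slab_interior[OF T] by blast
  have le: "2 * s \<le> diameter T" if "0 \<le> s" "cball x s \<subseteq> T" for x s
    using diameter_subset[OF that(2) bT] that(1) by simp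
  have bdd: "bdd_above ?D" by (rule bdd_aboveI[of _ "diameter T"]) (use le in auto)
  have mem: "2 * s0 \<in> ?D" using s0 by (intro CollectI exI[of _ x0] exI[of _ s0]) auto
  have "2 * s0 \<le> inner_diameter T" unfolding inner_diameter_def by (rule cSup_upper[OF mem bdd])
  then show "0 < inner_diameter T" using s0 by linarith
  show "0 < diameter T" using le[OF _ s0(2)] s0(1) by linarith
  show "\<exists>x s. q < 2 * s \<and> 0 \<le> s \<and> cball x s \<subseteq> T" if q: "q < inner_diameter T"
  proof -
    obtain y where "y \<in> ?D" "q < y"
      using less_cSupD[of ?D q] q mem unfolding inner_diameter_def by blast
    then show ?thesis by blast
  qed
  show "norm (snd \<phi>) * inner_diameter T \<le> 1" if \<phi>: "\<phi> \<in> \<Phi>"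
  proof (cases "snd \<phi> = 0")
    case False
    let ?w = "snd \<phi>"
    have n: "0 < norm ?w" using False by simp
    have "inner_diameter T \<le> 1 / norm ?w"
      unfolding inner_diameter_def
    proof (rule cSup_least)
      show "?D \<noteq> {}" using mem by blast
      fix y assume "y \<in> ?D"
      then obtain x s where y: "y = 2 * s" and s: "0 \<le> s" "cball x s \<subseteq> T" by blast
      \<comment> \<open>Antipodal points of the ball in the direction of the gradient, where \<phi>
        varies most.\<close>
      let ?p = "x + (s / norm ?w) *\<^sub>R ?w" and ?q = "x - (s / norm ?w) *\<^sub>R ?w"
      have "?p \<in> T" "?q \<in> T" using s n by (auto intro!: subsetD[OF s(2)] simp: dist_norm)
      then have "aff \<phi> ?p \<le> 1" "0 \<le> aff \<phi> ?q"
        using T \<phi> unfolding slab_rep_def by blast+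
      then have "aff \<phi> ?p - aff \<phi> ?q \<le> 1" by linarith
      then have "?w \<bullet> ((2 * (s / norm ?w)) *\<^sub>R ?w) \<le> 1"
        unfolding aff_diff by (simp add: algebra_simps flip: scaleR_add_left)
      then have "2 * s * norm ?w \<le> 1"
        using n by (simp add: dot_square_norm power2_eq_square)
      then show "y \<le> 1 / norm ?w" using n y by (simp add: field_simps)
    qed
    then show ?thesis using n by (simp add: field_simps)
  qed simp
qed

text \<open>A linear functional attains its maximum and minimum over a compact convex set at extreme
  points; if it is not constant, these two values differ.\<close>

lemma face_extreme_values:
  fixes F :: "'a::euclidean_space set"
  assumes F: "compact F" "convex F" and x: "x \<in> F" "y \<in> F" and w: "w \<bullet> x < w \<bullet> y"
  obtains e e' where "e extreme_point_of F" "e' extreme_point_of F" "w \<bullet> e < w \<bullet> e'"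
proof -
  have max: "\<exists>e. e extreme_point_of F \<and> (\<forall>u\<in>F. w \<bullet> u \<le> w \<bullet> e)" for w
  proof -
    have "continuous_on F (\<lambda>u. w \<bullet> u)" by (intro continuous_intros)
    then obtain u where u: "u \<in> F" "\<And>v. v \<in> F \<Longrightarrow> w \<bullet> v \<le> w \<bullet> u"
      using continuous_attains_sup[OF F(1)] x by blast
    let ?G = "F \<inter> {v. w \<bullet> v = w \<bullet> u}"
    have face: "?G face_of F" by (rule face_of_Int_supporting_hyperplane_le[OF F(2)]) (rule u(2))
    have "compact ?G" by (intro compact_Int_closed F closed_hyperplane)
    moreover have "convex ?G" by (intro convex_Int F convex_hyperplane)
    moreover have "?G \<noteq> {}" using u(1) by blast
    ultimately obtain e where "e extreme_point_of ?G" by (rule extreme_point_exists_convex)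
    then have "e extreme_point_of F" "w \<bullet> e = w \<bullet> u"
      using extreme_point_of_face[OF face] by auto
    with u show ?thesis by auto
  qed
  obtain e' where e': "e' extreme_point_of F" "\<forall>u\<in>F. w \<bullet> u \<le> w \<bullet> e'" using max[of w] by blast
  obtain e where e: "e extreme_point_of F" "\<forall>u\<in>F. - w \<bullet> u \<le> - w \<bullet> e" using max[of "- w"] by blast
  have "w \<bullet> e \<le> w \<bullet> x" using e(2) x(1) by auto
  also have "\<dots> < w \<bullet> y" by (rule w)
  also have "\<dots> \<le> w \<bullet> e'" using e'(2) x(2) by auto
  finally show thesis by (rule that[OF e(1) e'(1)])
qed

text \<open>If all gradients were orthogonal to \<open>y - x\<close>, the whole line through
  \<open>x\<close> in this direction would satisfy the constraints, contradicting
  boundedness.\<close>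

lemma slab_separates:
  fixes T :: "'a::euclidean_space set"
  assumes T: "slab_rep \<Phi> T" and x: "x \<in> T" and y: "y \<noteq> x"
  shows "\<exists>\<phi>\<in>\<Phi>. snd \<phi> \<bullet> x \<noteq> snd \<phi> \<bullet> y"
proof (rule ccontr)
  assume "\<not> ?thesis"
  then have eq: "snd \<phi> \<bullet> (y - x) = 0" if "\<phi> \<in> \<Phi>" for \<phi> using that by (simp add: inner_diff_right)
  have in_T: "x + t *\<^sub>R (y - x) \<in> T" for t
  proof -
    have "aff \<phi> (x + t *\<^sub>R (y - x)) = aff \<phi> x" if "\<phi> \<in> \<Phi>" for \<phi>
      using eq[OF that] by (simp add: aff_def inner_add_right)
    then show ?thesis using T x unfolding slab_rep_def by auto
  qed
  have "bounded T" using T unfolding slab_rep_def by blast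
  then obtain B where B: "\<And>u. u \<in> T \<Longrightarrow> dist x u \<le> B" unfolding bounded_any_center[of T x] by blast
  have n: "0 < norm (y - x)" using y by simp
  have "dist x (x + ((\<bar>B\<bar> + 1) / norm (y - x)) *\<^sub>R (y - x)) = \<bar>B\<bar> + 1"
    using n by (simp add: dist_norm)
  with B[OF in_T] show False by (metis abs_ge_self add_strict_increasing2 le_less_trans not_less zero_less_one less_add_one)
qed

section \<open>The elements around an interior node\<close>

locale interior_node =
  fixes \<sigma> :: real and \<Omega> :: "(real ^ 'n::finite) set" and \<T> :: "(real ^ 'n) set set" and z :: "real ^ 'n"
    and m :: nat and \<Phi> :: "(real ^ 'n) set \<Rightarrow> (real \<times> (real ^ 'n)) set"
  assumes sigma: "1 < \<sigma>" and domain_open: "open \<Omega>" and conforming: "conforming_mesh \<Omega> \<T>"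
    and ratio: "\<And>T. T \<in> \<T> \<Longrightarrow> diameter T / inner_diameter T \<le> \<sigma>"
    and dim_1: "\<And>T T'. CARD('n) = 1 \<Longrightarrow> T \<in> \<T> \<Longrightarrow> T' \<in> \<T> \<Longrightarrow> T \<inter> T' \<noteq> {} \<Longrightarrow>
      diameter T \<le> \<sigma> * diameter T'"
    and node: "z \<in> nodes m \<T>" and not_frontier: "z \<notin> frontier \<Omega>"
    and slab: "\<And>T. T \<in> \<T> \<Longrightarrow> slab_rep (\<Phi> T) T"
begin

definition star :: "(real ^ 'n) set set" where
  "star = {T \<in> \<T>. z \<in> T}"

abbreviation P :: "(real ^ 'n) set" where
  "P \<equiv> patch \<T> z"

abbreviation h :: real where
  "h \<equiv> node_size \<T> z"

abbreviation l :: nat where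
  "l \<equiv> max 1 m"

lemma P_eq: "P = \<Union>star"
  by (simp add: patch_def star_def)

lemma h_eq: "h = Min (diameter ` star)"
  by (simp add: node_size_def star_def)

lemma star_mesh: "T \<in> star \<Longrightarrow> T \<in> \<T>"
  by (simp add: star_def)

lemma star_node: "T \<in> star \<Longrightarrow> z \<in> T"
  by (simp add: star_def)

lemma finite_star: "finite star"
  using conforming by (simp add: star_def conforming_mesh_def)

lemma faces: "T \<in> \<T> \<Longrightarrow> T' \<in> \<T> \<Longrightarrow> T \<inter> T' face_of T"
  using conforming by (auto simp: conforming_mesh_def)

lemma mem_element: "T \<in> \<T> \<Longrightarrow> x \<in> T \<longleftrightarrow> (\<forall>\<phi>\<in>\<Phi> T. 0 \<le> aff \<phi> x)"
  using slab[of T] unfolding slab_rep_def by blast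

lemma element_convex: "T \<in> \<T> \<Longrightarrow> convex T"
  using slab slab_convex by blast

lemma element_compact: "T \<in> \<T> \<Longrightarrow> compact T"
  using slab slab_compact by blast

lemma element_diameter_pos: "T \<in> \<T> \<Longrightarrow> 0 < diameter T"
  using slab slab_diameter_pos by blast

lemma element_segment: "T \<in> \<T> \<Longrightarrow> x \<in> T \<Longrightarrow> y \<in> T \<Longrightarrow> 0 \<le> t \<Longrightarrow> t \<le> 1 \<Longrightarrow> x + t *\<^sub>R (y - x) \<in> T"
  using convexD_alt[OF element_convex, of T x y t] by (simp add: algebra_simps)

lemma diameter_le: "T \<in> \<T> \<Longrightarrow> diameter T \<le> \<sigma> * inner_diameter T"
  using ratio[of T] inner_diameter_pos[OF slab, of T] by (simp add: pos_divide_le_eq)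

lemma gradient: 
  assumes T: "T \<in> \<T>" and \<phi>: "\<phi> \<in> \<Phi> T"
  shows "norm (snd \<phi>) * diameter T \<le> \<sigma>"
proof -
  have "norm (snd \<phi>) * diameter T \<le> norm (snd \<phi>) * (\<sigma> * inner_diameter T)"
    by (intro mult_left_mono diameter_le T) simp
  also have "\<dots> = \<sigma> * (norm (snd \<phi>) * inner_diameter T)" by simp
  also have "\<dots> \<le> \<sigma> * 1"
    using sigma by (intro mult_left_mono slab_gradient[OF slab[OF T] \<phi>]) simp
  finally show ?thesis by simp
qed

lemma node_in_element:
  obtains T E and a :: "real ^ 'n \<Rightarrow> nat" where "T \<in> star" "finite E" "\<And>e. e \<in> E \<Longrightarrow> e extreme_point_of T"
    "sum a E = l" "z = (\<Sum>e\<in>E. (real (a e) / real l) *\<^sub>R e)"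
proof -
  obtain T E and a :: "real ^ 'n \<Rightarrow> nat" where T: "T \<in> \<T>" "finite E" "\<And>e. e \<in> E \<Longrightarrow> e extreme_point_of T"
    "sum a E = l" "z = (\<Sum>e\<in>E. (real (a e) / real l) *\<^sub>R e)"
    using node_combination[OF node] by blast
  have "(\<Sum>e\<in>E. real (a e) / real l) = 1"
    using T(4) by (simp flip: sum_divide_distrib of_nat_sum)
  then have "(\<Sum>e\<in>E. (real (a e) / real l) *\<^sub>R e) \<in> T"
    by (intro convex_sum T(2) element_convex T(1)) (use T(3) in \<open>auto simp: extreme_point_of_def\<close>)
  then have "z \<in> T" using T(5) by simp
  then have "T \<in> star" using T(1) unfolding star_def by blast
  then show thesis by (rule that[OF _ T(2-5)])
qed

lemma star_nonempty: "star \<noteq> {}"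
  using node_in_element by blast

lemma h_le: "T \<in> star \<Longrightarrow> h \<le> diameter T"
  unfolding h_eq using finite_star by simp

lemma h_attained: "\<exists>T\<in>star. h = diameter T"
proof -
  have "h \<in> diameter ` star"
    unfolding h_eq by (rule Min_in) (use finite_star star_nonempty in auto)
  then show ?thesis by blast
qed

lemma h_pos: "0 < h"
  using h_attained element_diameter_pos star_mesh by metis

text \<open>By conformity the extreme points spanning \<open>z\<close> in one element lie on the common face with
  any other element containing \<open>z\<close>, so that \<open>z\<close> is a lattice point of the latter as well.\<close>

lemma node_value:
  assumes T: "T \<in> star" and \<phi>: "\<phi> \<in> \<Phi> T"
  shows "aff \<phi> z = 0 \<or> 1 / real l \<le> aff \<phi> z"
proof -
  obtain T' E and a :: "real ^ 'n \<Rightarrow> nat" where T': "T' \<in> star" "finite E" "\<And>e. e \<in> E \<Longrightarrow> e extreme_point_of T'"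
    "sum a E = l" "z = (\<Sum>e\<in>E. (real (a e) / real l) *\<^sub>R e)"
    using node_in_element by blast
  let ?F = "T' \<inter> T"
  have F': "?F face_of T'" using faces T' T star_mesh by blast
  have F: "?F face_of T" using faces[of T T'] T' T star_mesh by (simp add: Int_commute)
  have sum1: "(\<Sum>e\<in>E. real (a e) / real l) = 1"
    using T'(4) by (simp flip: sum_divide_distrib of_nat_sum)
  have val: "a e = 0 \<or> aff \<phi> e = 0 \<or> aff \<phi> e = 1" if e: "e \<in> E" for e
  proof (cases "a e = 0")
    case False
    have "e \<in> ?F"
    proof (rule face_of_convex_sum[OF F' _ T'(2) _ sum1, where e = "\<lambda>e. e"])
      show "convex T'" using element_convex T'(1) star_mesh by blast
      show "(\<Sum>e\<in>E. (real (a e) / real l) *\<^sub>R e) \<in> ?F"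
        using T'(5) star_node[OF T] star_node[OF T'(1)] by simp
      show "0 < real (a e) / real l" using False by simp
    qed (use T'(3) e in \<open>auto simp: extreme_point_of_def\<close>)
    then have "e extreme_point_of T"
      using extreme_point_of_face[OF F'] extreme_point_of_face[OF F] T'(3)[OF e] by blast
    then show ?thesis using slab[OF star_mesh[OF T]] \<phi> unfolding slab_rep_def by blast
  qed simp
  define k where "k = (\<Sum>e\<in>E. if aff \<phi> e = 1 then a e else 0)"
  have "aff \<phi> z = (\<Sum>e\<in>E. real (a e) / real l * aff \<phi> e)"
    by (subst T'(5)) (rule aff_sum[OF sum1])
  also have "\<dots> = (\<Sum>e\<in>E. real (if aff \<phi> e = 1 then a e else 0) / real l)"
    using val by (intro sum.cong refl) fastforce
  also have "\<dots> = real k / real l" by (simp add: k_def sum_divide_distrib)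
  finally have eq: "aff \<phi> z = real k / real l" .
  show ?thesis
  proof (cases "k = 0")
    case False
    then have "1 \<le> real k" by simp
    then show ?thesis unfolding eq by (intro disjI2 divide_right_mono) auto
  qed (simp add: eq)
qed

text \<open>The elements that avoid \<open>z\<close> form a closed set, and outside of it every
  point of \<Omega> belongs to the patch.\<close>

lemma node_interior: "z \<in> interior P"
proof -
  have mesh: "finite \<T>" "\<Union>\<T> = closure \<Omega>" using conforming by (auto simp: conforming_mesh_def)
  have "z \<in> closure \<Omega>"
    using mesh(2) star_nonempty star_mesh star_node by blast
  then have "z \<in> \<Omega>"
    using not_frontier domain_open by (simp add: frontier_def interior_open)
  let ?U = "\<Omega> - \<Union>{T \<in> \<T>. z \<notin> T}"
  have "closed (\<Union>{T \<in> \<T>. z \<notin> T})"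
    using mesh(1) element_compact by (intro closed_Union) (auto intro: compact_imp_closed)
  then have "open ?U" using domain_open by (rule open_Diff[rotated])
  moreover have "z \<in> ?U" using \<open>z \<in> \<Omega>\<close> by auto
  moreover have "?U \<subseteq> P"
    using mesh(2) closure_subset[of \<Omega>] unfolding patch_def by blast
  ultimately show ?thesis by (meson interiorI)
qed

text \<open>Origin of the radius \<open>h / (l * \<sigma>)\<close>: a constraint inactive at
  \<open>z\<close> is at least \<open>1 / l\<close> there by \<open>node_value\<close>, and its
  gradient is at most \<open>\<sigma> / diameter T\<close>, hence at most
  \<open>\<sigma> / h\<close>.\<close>

lemma aff_near_node:
  assumes T: "T \<in> star" and \<phi>: "\<phi> \<in> \<Phi> T" "aff \<phi> z \<noteq> 0" and y: "y \<in> cball z (h / (real l * \<sigma>))"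
  shows "0 \<le> aff \<phi> y"
proof -
  have "\<bar>snd \<phi> \<bullet> (y - z)\<bar> \<le> norm (snd \<phi>) * norm (y - z)" by (rule Cauchy_Schwarz_ineq2)
  also have "\<dots> \<le> norm (snd \<phi>) * (diameter T / (real l * \<sigma>))"
  proof (rule mult_left_mono)
    have "norm (y - z) \<le> h / (real l * \<sigma>)" using y by (simp add: dist_norm norm_minus_commute)
    also have "\<dots> \<le> diameter T / (real l * \<sigma>)"
      using h_le[OF T] sigma by (intro divide_right_mono) auto
    finally show "norm (y - z) \<le> diameter T / (real l * \<sigma>)" .
  qed simp
  also have "\<dots> = norm (snd \<phi>) * diameter T / (real l * \<sigma>)" by simp
  also have "\<dots> \<le> \<sigma> / (real l * \<sigma>)"
    using gradient[OF star_mesh[OF T] \<phi>(1)] sigma by (intro divide_right_mono) auto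
  also have "\<dots> = 1 / real l" using sigma by simp
  finally have "\<bar>snd \<phi> \<bullet> (y - z)\<bar> \<le> 1 / real l" .
  moreover have "aff \<phi> y = aff \<phi> z + snd \<phi> \<bullet> (y - z)" by (simp add: aff_def inner_diff_right)
  ultimately show ?thesis using node_value[OF T \<phi>(1)] \<phi>(2) by linarith
qed

section \<open>Tangent cones at the node and star-shapedness\<close>

definition tangent_cone :: "(real ^ 'n) set \<Rightarrow> (real ^ 'n) set" where
  "tangent_cone T = {x. \<forall>\<phi>\<in>\<Phi> T. aff \<phi> z = 0 \<longrightarrow> 0 \<le> aff \<phi> x}"

lemma element_subset_cone: "T \<in> star \<Longrightarrow> T \<subseteq> tangent_cone T"
  using mem_element star_mesh unfolding tangent_cone_def by blast

lemma closed_cone: "closed (tangent_cone T)"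
proof -
  have "tangent_cone T = (\<Inter>\<phi>\<in>{\<phi>\<in>\<Phi> T. aff \<phi> z = 0}. {x. - fst \<phi> \<le> snd \<phi> \<bullet> x})"
    unfolding tangent_cone_def aff_nonneg_iff by blast
  then show ?thesis by (simp only:) (intro closed_INT ballI closed_halfspace_ge)
qed

text \<open>The cone keeps only the constraints active at \<open>z\<close>. The others are finitely
  many and positive at \<open>z\<close>, so they hold near \<open>z\<close> as well.\<close>

lemma eventually_cone_element:
  assumes T: "T \<in> star" and x: "x \<in> tangent_cone T"
  shows "eventually (\<lambda>t. z + t *\<^sub>R (x - z) \<in> T) (at_right 0)"
proof -
  have "eventually (\<lambda>t. 0 \<le> aff \<phi> (z + t *\<^sub>R (x - z))) (at_right 0)" if \<phi>: "\<phi> \<in> \<Phi> T" for \<phi>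
  proof (cases "aff \<phi> z = 0")
    case True
    then have "0 \<le> aff \<phi> x" using x \<phi> unfolding tangent_cone_def by blast
    then show ?thesis
      using eventually_at_right_less[of "0::real"]
      by (auto simp: aff_segment True elim!: eventually_mono)
  next
    case False
    have "0 < 1 / real l" by simp
    then have pos: "0 < aff \<phi> z" using node_value[OF T \<phi>] False by linarith
    have "((\<lambda>t. aff \<phi> (z + t *\<^sub>R (x - z))) \<longlongrightarrow> (1 - 0) * aff \<phi> z + 0 * aff \<phi> x) (at_right 0)"
      unfolding aff_segment by (intro tendsto_intros)
    then have "eventually (\<lambda>t. 0 < aff \<phi> (z + t *\<^sub>R (x - z))) (at_right 0)"
      using pos by (intro order_tendstoD) auto
    then show ?thesis by (rule eventually_mono) simp
  qed
  moreover have "finite (\<Phi> T)" using slab[OF star_mesh[OF T]] unfolding slab_rep_def by blast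
  ultimately have "eventually (\<lambda>t. \<forall>\<phi>\<in>\<Phi> T. 0 \<le> aff \<phi> (z + t *\<^sub>R (x - z))) (at_right 0)"
    by (intro eventually_ball_finite) auto
  then show ?thesis unfolding mem_element[OF star_mesh[OF T]] .
qed

text \<open>Contraction towards \<open>z\<close> brings \<open>x\<close> into the patch, hence into
  some element; an active constraint, being 0 at \<open>z\<close>, keeps its sign under the
  contraction.\<close>

lemma cone_cover: "\<exists>T\<in>star. x \<in> tangent_cone T"
proof -
  have "((\<lambda>t. z + t *\<^sub>R (x - z)) \<longlongrightarrow> z + 0 *\<^sub>R (x - z)) (at_right 0)"
    by (intro tendsto_intros)
  then have "eventually (\<lambda>t. z + t *\<^sub>R (x - z) \<in> interior P) (at_right 0)"
    by (rule topological_tendstoD) (use node_interior in auto)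
  then have "eventually (\<lambda>t. 0 < t \<and> z + t *\<^sub>R (x - z) \<in> interior P) (at_right 0)"
    using eventually_at_right_less[of "0::real"] by eventually_elim simp
  then obtain t where t: "0 < t" "z + t *\<^sub>R (x - z) \<in> interior P"
    using eventually_happens'[OF trivial_limit_at_right_real] by blast
  then obtain T where T: "T \<in> star" "z + t *\<^sub>R (x - z) \<in> T"
    using interior_subset[of P] unfolding P_eq by blast
  have "0 \<le> aff \<phi> x" if \<phi>: "\<phi> \<in> \<Phi> T" "aff \<phi> z = 0" for \<phi>
  proof -
    have "0 \<le> aff \<phi> (z + t *\<^sub>R (x - z))" using T mem_element star_mesh \<phi>(1) by blast
    then show ?thesis using t(1) by (simp add: aff_segment \<phi>(2) zero_le_mult_iff)
  qed
  then have "x \<in> tangent_cone T" by (simp add: tangent_cone_def)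
  with T(1) show ?thesis by blast
qed

text \<open>Conformity enters star-shapedness here: a point near \<open>z\<close> on the segment to
  \<open>p\<close> lies in \<open>T\<close> and in an element \<open>T'\<close> containing
  \<open>p\<close>. As \<open>T' \<inter> T\<close> is a face of \<open>T'\<close>, it contains the
  whole segment, and so \<open>p\<close>.\<close>

lemma cone_patch:
  assumes p: "p \<in> P" and T: "T \<in> star" "p \<in> tangent_cone T"
  shows "p \<in> T"
proof (cases "p = z")
  case False
  obtain T' where T': "T' \<in> star" "p \<in> T'" using p unfolding P_eq by blast
  have "eventually (\<lambda>t. t < (1 :: real)) (at_right 0)"
    by (rule order_tendstoD(2)[OF tendsto_ident_at]) simp
  with eventually_cone_element[OF T] eventually_at_right_less[of "0::real"]
  have "eventually (\<lambda>t. 0 < t \<and> t < 1 \<and> z + t *\<^sub>R (p - z) \<in> T) (at_right 0)"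
    by eventually_elim simp
  then obtain t where t: "0 < t" "t < 1" "z + t *\<^sub>R (p - z) \<in> T"
    using eventually_happens'[OF trivial_limit_at_right_real] by blast
  have "z + t *\<^sub>R (p - z) \<in> T'"
    using element_segment[OF star_mesh[OF T'(1)] star_node[OF T'(1)] T'(2)] t by simp
  moreover have "z + t *\<^sub>R (p - z) = (1 - t) *\<^sub>R z + t *\<^sub>R p" by (simp add: algebra_simps)
  then have "z + t *\<^sub>R (p - z) \<in> open_segment z p"
    unfolding in_segment using False t by auto
  ultimately have "p \<in> T' \<inter> T"
    using faces[OF star_mesh[OF T'(1)] star_mesh[OF T(1)]] T'(2) star_node[OF T'(1)] t(3)
    unfolding face_of_def by blast
  then show ?thesis by blast
qed (use star_node T in blast)

text \<open>A segment from the patch towards a point close to \<open>z\<close> cannot leave the patch: for a short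
  while it stays in one tangent cone, whose inactive constraints hold at both of its end points.\<close>

lemma patch_star_shaped:
  assumes y: "y \<in> P" and y': "y' \<in> cball z (h / (real l * \<sigma>))" and t: "0 \<le> t" "t \<le> 1"
  shows "y + t *\<^sub>R (y' - y) \<in> P"
proof -
  let ?s = "\<lambda>t. y + t *\<^sub>R (y' - y)"
  let ?A = "{0..t} \<inter> ?s -` P"
  have "closed P"
    unfolding P_eq using finite_star element_compact star_mesh by (intro closed_Union) (auto intro: compact_imp_closed)
  then have "closed ?A"
    by (intro continuous_closed_preimage continuous_intros) auto
  then have "compact ?A" by (metis compact_Icc compact_Int_closed inf.left_idem)
  moreover have "0 \<in> ?A" using y t by simp
  \<comment> \<open>The last parameter up to \<open>t\<close> at which the segment meets the patch;
    unless it is \<open>t\<close>, the segment will be continued beyond it.\<close>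
  ultimately obtain q where q: "q \<in> ?A" "\<And>r. r \<in> ?A \<Longrightarrow> r \<le> q"
    using compact_attains_sup[of ?A] by blast
  show ?thesis
  proof (cases "q = t")
    case True
    then show ?thesis using q(1) by simp
  next
    case False
    then have qt: "0 \<le> q" "q < t" using q(1) by auto
    let ?p = "?s q" and ?d = "y' - y"
    have pP: "?p \<in> P" using q(1) by simp
    \<comment> \<open>Finitely many cones cover the space, so one of them is met for arbitrarily
      small \<open>r\<close>.\<close>
    have "\<exists>T\<in>star. \<forall>e>0. \<exists>r. 0 < r \<and> r < e \<and> ?p + r *\<^sub>R ?d \<in> tangent_cone T"
    proof (rule ccontr)
      assume "\<not> ?thesis"
      then have "\<forall>T\<in>star. \<exists>e>0. \<forall>r. 0 < r \<longrightarrow> r < e \<longrightarrow> ?p + r *\<^sub>R ?d \<notin> tangent_cone T" by blast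
      then obtain e where e: "\<And>T. T \<in> star \<Longrightarrow> 0 < e T"
        "\<And>T r. T \<in> star \<Longrightarrow> 0 < r \<Longrightarrow> r < e T \<Longrightarrow> ?p + r *\<^sub>R ?d \<notin> tangent_cone T" by metis
      define r where "r = Min (e ` star) / 2"
      have "0 < Min (e ` star)" using e(1) finite_star star_nonempty by simp
      then have r0: "0 < r" "r < Min (e ` star)" by (auto simp: r_def)
      have r: "0 < r" "r < e T" if "T \<in> star" for T
      proof -
        have "Min (e ` star) \<le> e T" by (rule Min_le) (use finite_star that in auto)
        then show "0 < r" "r < e T" using r0 by linarith+
      qed
      obtain T where "T \<in> star" "?p + r *\<^sub>R ?d \<in> tangent_cone T" using cone_cover by blast
      then show False using e(2) r by blast
    qed
    then obtain T where T: "T \<in> star" and small: "\<And>e. 0 < e \<Longrightarrow> \<exists>r. 0 < r \<and> r < e \<and> ?p + r *\<^sub>R ?d \<in> tangent_cone T"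
      by blast
    \<comment> \<open>The cone is closed: a constraint negative at \<open>?p\<close> would stay
      negative for small \<open>r\<close>.\<close>
    have "?p \<in> tangent_cone T"
      unfolding tangent_cone_def
    proof (intro CollectI ballI impI, rule ccontr)
      fix \<phi> assume \<phi>: "\<phi> \<in> \<Phi> T" "aff \<phi> z = 0" and "\<not> 0 \<le> aff \<phi> ?p"
      then have neg: "aff \<phi> ?p < 0" by simp
      let ?w = "\<bar>snd \<phi> \<bullet> ?d\<bar> + 1"
      have w: "0 < ?w" by simp
      obtain r where r: "0 < r" "r < - aff \<phi> ?p / ?w" "?p + r *\<^sub>R ?d \<in> tangent_cone T"
        using small[of "- aff \<phi> ?p / ?w"] neg w by (metis divide_pos_pos neg_0_less_iff_less)
      have "0 \<le> aff \<phi> (?p + r *\<^sub>R ?d)" using r(3) \<phi> unfolding tangent_cone_def by blast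
      also have "\<dots> = aff \<phi> ?p + r * (snd \<phi> \<bullet> ?d)" by (simp add: aff_def inner_add_right)
      also have "\<dots> \<le> aff \<phi> ?p + r * ?w" using r(1) by (intro add_left_mono mult_left_mono) auto
      also have "\<dots> < 0"
      proof -
        have "r * ?w < - aff \<phi> ?p" using r(2) unfolding pos_less_divide_eq[OF w] .
        then show ?thesis by linarith
      qed
      finally show False by simp
    qed
    then have pT: "?p \<in> T" by (rule cone_patch[OF pP T])
    obtain r where r: "0 < r" "r < t - q" "?p + r *\<^sub>R ?d \<in> tangent_cone T"
      using small[of "t - q"] qt by auto
    \<comment> \<open>From \<open>?p\<close> the end point \<open>y'\<close> is a step of length
      \<open>1 - q\<close> away, so the new point is a convex combination of \<open>?p\<close> and
      \<open>y'\<close>, and inactive constraints are nonnegative at both.\<close>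
    let ?\<theta> = "r / (1 - q)"
    have \<theta>: "0 \<le> ?\<theta>" "?\<theta> \<le> 1" using r qt t by (auto simp: field_simps)
    have on_seg: "?p + r *\<^sub>R ?d = ?p + ?\<theta> *\<^sub>R (y' - ?p)"
    proof -
      have "y' - ?p = (1 - q) *\<^sub>R ?d" by (simp add: algebra_simps)
      then show ?thesis using qt t by simp
    qed
    have "?p + r *\<^sub>R ?d \<in> T"
      unfolding mem_element[OF star_mesh[OF T]]
    proof
      fix \<phi> assume \<phi>: "\<phi> \<in> \<Phi> T"
      show "0 \<le> aff \<phi> (?p + r *\<^sub>R ?d)"
      proof (cases "aff \<phi> z = 0")
        case True
        then show ?thesis using r(3) \<phi> unfolding tangent_cone_def by blast
      next
        case False
        have "0 \<le> aff \<phi> ?p" using pT mem_element[OF star_mesh[OF T]] \<phi> by blast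
        then show ?thesis
          unfolding on_seg aff_segment[of _ ?p]
          using aff_near_node[OF T \<phi> False y'] \<theta>
          by (intro add_nonneg_nonneg mult_nonneg_nonneg) simp_all
      qed
    qed
    moreover have "?p + r *\<^sub>R ?d = ?s (q + r)" by (simp add: algebra_simps)
    ultimately have "?s (q + r) \<in> P" using T unfolding P_eq by auto
    then have "q + r \<in> ?A" using r qt by simp
    with q(2) r(1) show ?thesis by force
  qed
qed

text \<open>The radius is halved so that \<open>y'\<close> is itself interior to the patch, which
  settles \<open>t = 1\<close>. Otherwise the contraction towards \<open>y'\<close> maps the
  interior onto an open subset of the patch.\<close>

lemma interior_patch_star_shaped:
  assumes y: "y \<in> interior P" and y': "y' \<in> cball z (1 / (2 * real l * \<sigma>) * h)" and t: "0 \<le> t" "t \<le> 1"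
  shows "y + t *\<^sub>R (y' - y) \<in> interior P"
proof -
  let ?R = "h / (real l * \<sigma>)"
  have R: "0 < ?R" using h_pos sigma by simp
  have "1 / (2 * real l * \<sigma>) * h = ?R / 2" by simp
  then have "dist z y' \<le> ?R / 2" using y' by (simp only: mem_cball)
  also have "\<dots> < ?R"
  proof -
    have "q / 2 < q" if "0 < q" for q :: real using that by simp
    then show ?thesis using R by blast
  qed
  finally have y'': "y' \<in> ball z ?R" by (simp only: mem_ball)
  show ?thesis
  proof (cases "t = 1")
    case True
    have "ball z ?R \<subseteq> P"
    proof
      fix x assume "x \<in> ball z ?R"
      then have "z + 1 *\<^sub>R (x - z) \<in> P"
        using node_interior interior_subset by (intro patch_star_shaped) auto
      then show "x \<in> P" by simp
    qed
    then have "y' \<in> interior P" using y'' by (meson interiorI open_ball)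
    then show ?thesis using True by simp
  next
    case False
    let ?f = "\<lambda>x. t *\<^sub>R y' + (1 - t) *\<^sub>R x"
    have "open (?f ` interior P)" by (rule open_affinity) (use False in auto)
    moreover have "?f ` interior P \<subseteq> P"
    proof
      fix x assume "x \<in> ?f ` interior P"
      then obtain u where u: "u \<in> interior P" "x = ?f u" by blast
      have "u + t *\<^sub>R (y' - u) \<in> P"
        using u(1) interior_subset y'' t by (intro patch_star_shaped) auto
      moreover have "x = u + t *\<^sub>R (y' - u)" using u(2) by (simp add: algebra_simps)
      ultimately show "x \<in> P" by simp
    qed
    moreover have "y + t *\<^sub>R (y' - y) \<in> ?f ` interior P"
      using y by (intro image_eqI[of _ _ y]) (auto simp: algebra_simps)
    ultimately show ?thesis by (meson interiorI)
  qed
qed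

text \<open>The common face contains \<open>z\<close> and \<open>x\<close>, so some function in
  \<open>\<Phi> T\<close> is not constant on it and takes the values 0 and 1 at two of its extreme
  points. These lie in \<open>T'\<close> as well, so the gradient, at most
  \<open>\<sigma> / diameter T\<close>, is at least \<open>1 / diameter T'\<close>.\<close>

lemma adjacent_diameter:
  assumes T: "T \<in> star" and T': "T' \<in> star" and x: "x \<in> T" "x \<in> T'" "x \<noteq> z"
  shows "diameter T \<le> \<sigma> * diameter T'"
proof -
  let ?F = "T \<inter> T'"
  have m: "T \<in> \<T>" "T' \<in> \<T>" using T T' star_mesh by auto
  have F: "?F face_of T" by (rule faces[OF m])
  have cF: "compact ?F" "convex ?F"
    using m element_compact element_convex by (auto intro: compact_Int_closed compact_imp_closed convex_Int)
  have zF: "z \<in> ?F" "x \<in> ?F" using star_node T T' x by auto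
  obtain \<phi> where \<phi>: "\<phi> \<in> \<Phi> T" "snd \<phi> \<bullet> z \<noteq> snd \<phi> \<bullet> x"
    using slab_separates[OF slab[OF m(1)] star_node[OF T] x(3)] by blast
  obtain e e' where e: "e extreme_point_of ?F" "e' extreme_point_of ?F" "snd \<phi> \<bullet> e < snd \<phi> \<bullet> e'"
  proof (cases "snd \<phi> \<bullet> z < snd \<phi> \<bullet> x")
    case True
    then show thesis using face_extreme_values[OF cF zF] that by blast
  next
    case False
    then have "snd \<phi> \<bullet> x < snd \<phi> \<bullet> z" using \<phi>(2) by simp
    then show thesis using face_extreme_values[OF cF zF(2,1)] that by blast
  qed
  have "e extreme_point_of T" "e' extreme_point_of T"
    using e extreme_point_of_face[OF F] by auto
  then have "aff \<phi> e = 0 \<or> aff \<phi> e = 1" "aff \<phi> e' = 0 \<or> aff \<phi> e' = 1"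
    using slab[OF m(1)] \<phi>(1) unfolding slab_rep_def by auto
  moreover have "aff \<phi> e < aff \<phi> e'" using e(3) by (simp add: aff_def)
  ultimately have "1 = aff \<phi> e' - aff \<phi> e" by auto
  also have "\<dots> = snd \<phi> \<bullet> (e' - e)" by (rule aff_diff)
  also have "\<dots> \<le> norm (snd \<phi>) * norm (e' - e)" by (rule norm_cauchy_schwarz)
  also have "\<dots> \<le> norm (snd \<phi>) * diameter T'"
  proof (rule mult_left_mono)
    have "e \<in> T'" "e' \<in> T'" using e unfolding extreme_point_of_def by auto
    then have "dist e' e \<le> diameter T'"
      by (intro diameter_bounded_bound compact_imp_bounded element_compact m)
    then show "norm (e' - e) \<le> diameter T'" by (simp add: dist_norm)
  qed simp
  finally have "1 \<le> norm (snd \<phi>) * diameter T'" .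
  then have "diameter T * 1 \<le> diameter T * (norm (snd \<phi>) * diameter T')"
    using element_diameter_pos[OF m(1)] by (intro mult_left_mono) auto
  also have "\<dots> = (norm (snd \<phi>) * diameter T) * diameter T'" by simp
  also have "\<dots> \<le> \<sigma> * diameter T'"
    using element_diameter_pos[OF m(2)] by (intro mult_right_mono gradient m \<phi>) auto
  finally show ?thesis by simp
qed

section \<open>Number and relative size of the elements around the node\<close>

lemma elements_disjoint:
  assumes "T \<in> \<T>" "T' \<in> \<T>" "T \<noteq> T'"
  shows "negligible (T \<inter> T')"
proof -
  have *: "negligible F" if F: "F face_of T" "F \<noteq> T" for F T :: "(real ^ 'n) set"
  proof -
    have "interior F \<subseteq> F \<inter> rel_interior T"
      using interior_subset interior_mono[OF face_of_imp_subset[OF F(1)]] interior_subset_rel_interior by blast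
    then have "interior F = {}" using face_of_disjoint_rel_interior[OF F] by blast
    then show ?thesis using negligible_convex_interior[OF face_of_imp_convex[OF F(1)]] by simp
  qed
  show ?thesis
  proof (cases "T \<inter> T' = T")
    case False
    then show ?thesis by (rule *[OF faces[OF assms(1,2)]])
  next
    case True
    then have "T' \<inter> T \<noteq> T'" using assms(3) by blast
    then have "negligible (T' \<inter> T)" by (rule *[OF faces[OF assms(2,1)]])
    then show ?thesis by (simp add: Int_commute)
  qed
qed

text \<open>A ball in \<open>T\<close> is contracted towards \<open>z\<close> by the factor
  \<open>h / diameter T\<close>, which puts it into \<open>cball z h\<close>. The 4 is twice 2: half
  of the supremum \<open>inner_diameter\<close> is surely exceeded, and a radius is half a
  diameter.\<close>

lemma ball_in_element:
  assumes T: "T \<in> star"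
  shows "\<exists>x. ball x (h / (4 * \<sigma>)) \<subseteq> T \<inter> cball z h"
proof -
  have m: "T \<in> \<T>" by (rule star_mesh[OF T])
  have ip: "0 < inner_diameter T" by (rule inner_diameter_pos[OF slab[OF m]])
  obtain x s where s: "inner_diameter T / 2 < 2 * s" "0 \<le> s" "cball x s \<subseteq> T"
    using less_inner_diameter[OF slab[OF m], of "inner_diameter T / 2"] ip by auto
  let ?D = "diameter T"
  have D: "0 < ?D" by (rule element_diameter_pos[OF m])
  define k where "k = h / ?D"
  have k: "0 < k" "k \<le> 1" using h_pos h_le[OF T] D by (auto simp: k_def)
  have sD: "?D / (4 * \<sigma>) < s"
  proof -
    have "?D \<le> \<sigma> * inner_diameter T" by (rule diameter_le[OF m])
    also have "\<dots> < \<sigma> * (4 * s)" using s(1) sigma by (intro mult_strict_left_mono) auto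
    finally show ?thesis using sigma by (simp add: pos_divide_less_eq mult_ac)
  qed
  have ks: "h / (4 * \<sigma>) \<le> k * s"
    using mult_left_mono[OF less_imp_le[OF sD], of k] k D by (simp add: k_def)
  show ?thesis
  proof (intro exI[of _ "z + k *\<^sub>R (x - z)"] subsetI)
    fix u assume "u \<in> ball (z + k *\<^sub>R (x - z)) (h / (4 * \<sigma>))"
    then have u: "norm (u - (z + k *\<^sub>R (x - z))) < k * s"
      using ks by (simp add: dist_norm norm_minus_commute)
    define v where "v = z + (1 / k) *\<^sub>R (u - z)"
    have uv: "u = z + k *\<^sub>R (v - z)" using k by (simp add: v_def)
    have "u - (z + k *\<^sub>R (x - z)) = k *\<^sub>R (v - x)" unfolding uv by (simp add: algebra_simps)
    then have "norm (v - x) < s" using u k by simp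
    then have v: "v \<in> T" using s(3) by (auto simp: dist_norm norm_minus_commute)
    have uT: "u \<in> T"
      unfolding uv by (rule element_segment[OF m star_node[OF T] v]) (use k in auto)
    have "dist z v \<le> ?D"
      by (intro diameter_bounded_bound compact_imp_bounded element_compact m star_node T v)
    then have "k * norm (v - z) \<le> k * ?D"
      using k by (intro mult_left_mono) (auto simp: dist_norm norm_minus_commute)
    moreover have "k * ?D = h" using D by (simp add: k_def)
    moreover have "norm (u - z) = k * norm (v - z)" using k by (simp add: uv)
    ultimately have "norm (u - z) \<le> h" by simp
    with uT show "u \<in> T \<inter> cball z h" by (simp add: dist_norm norm_minus_commute)
  qed
qed

text \<open>Packing: the balls of radius \<open>h / (4 * \<sigma>)\<close> in the elements overlap
  only in null sets and all lie in \<open>cball z h\<close>; comparing volumes bounds their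
  number.\<close>

lemma card_star_le: "real (card star) \<le> (4 * \<sigma>) ^ CARD('n)"
proof -
  obtain f where f: "\<And>T. T \<in> star \<Longrightarrow> ball (f T) (h / (4 * \<sigma>)) \<subseteq> T \<inter> cball z h"
    using ball_in_element by metis
  let ?r = "h / (4 * \<sigma>)" and ?B = "\<lambda>T. ball (f T) (h / (4 * \<sigma>))"
  let ?v = "unit_ball_vol (real CARD('n))"
  have r: "0 \<le> ?r" using h_pos sigma by simp
  have meas: "measure lebesgue (ball x ?r) = ?v * ?r ^ CARD('n)" for x :: "real ^ 'n"
    using content_ball[of ?r x] r by (simp add: measure_completion)
  have "measure lebesgue (\<Union>(?B ` star)) = (\<Sum>T\<in>star. measure lebesgue (?B T))"
  proof (rule measure_negligible_finite_Union_image[OF finite_star])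
    show "pairwise (\<lambda>T T'. negligible (?B T \<inter> ?B T')) star"
    proof (rule pairwiseI)
      fix T T' assume T: "T \<in> star" "T' \<in> star" "T \<noteq> T'"
      have "negligible (T \<inter> T')" by (rule elements_disjoint) (use T star_mesh in auto)
      then show "negligible (?B T \<inter> ?B T')"
        by (rule negligible_subset) (use f[OF T(1)] f[OF T(2)] in blast)
    qed
  qed simp
  also have "\<dots> = real (card star) * (?v * ?r ^ CARD('n))" by (simp add: meas)
  finally have "real (card star) * (?v * ?r ^ CARD('n)) = measure lebesgue (\<Union>(?B ` star))" by simp
  also have "\<dots> \<le> measure lebesgue (cball z h)"
    by (rule measure_mono_fmeasurable) (use f finite_star in \<open>auto intro!: sets.finite_UN\<close>)
  also have "\<dots> = ?v * h ^ CARD('n)"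
    using content_cball[of h z] h_pos by (simp add: measure_completion)
  also have "h ^ CARD('n) = (4 * \<sigma>) ^ CARD('n) * ?r ^ CARD('n)"
  proof -
    have "h = 4 * \<sigma> * ?r" using sigma by simp
    then show ?thesis by (metis power_mult_distrib)
  qed
  finally have "real (card star) * (?v * ?r ^ CARD('n)) \<le> (4 * \<sigma>) ^ CARD('n) * (?v * ?r ^ CARD('n))"
    by (simp add: mult_ac)
  moreover have "0 < ?v * ?r ^ CARD('n)" using h_pos sigma by simp
  ultimately show ?thesis by (rule mult_right_le_imp_le)
qed

lemma element_has_other_point: "T \<in> star \<Longrightarrow> \<exists>x\<in>T. x \<noteq> z"
proof (rule ccontr)
  assume T: "T \<in> star" and "\<not> (\<exists>x\<in>T. x \<noteq> z)"
  then have "T \<subseteq> {z}" by blast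
  then have "diameter T \<le> 0" by (metis bounded_insert bounded_empty diameter_subset diameter_singleton)
  then show False using element_diameter_pos[OF star_mesh[OF T]] by simp
qed

text \<open>The punctured space is connected and covered by the finitely many closed tangent cones.\<close>

lemma star_connected:
  assumes n: "2 \<le> CARD('n)" and X: "X \<subseteq> star" "X \<noteq> {}" "X \<noteq> star"
  shows "\<exists>T\<in>X. \<exists>T'\<in>star - X. \<exists>x. x \<in> T \<and> x \<in> T' \<and> x \<noteq> z"
proof (rule ccontr)
  assume no: "\<not> ?thesis"
  have conn: "connected (- {z})" using n by (intro connected_punctured_universe) simp
  let ?A = "\<Union>(tangent_cone ` X)" and ?B = "\<Union>(tangent_cone ` (star - X))"
  have "finite X" using X(1) finite_star finite_subset by blast
  then have cl: "closed ?A" "closed ?B" using finite_star by (auto intro!: closed_UN closed_cone)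
  have cov: "- {z} \<subseteq> ?A \<union> ?B" using cone_cover by blast
  \<comment> \<open>A point other than \<open>z\<close> in two cones, pulled towards
    \<open>z\<close>, enters both elements and is a common point of the excluded kind.\<close>
  have disj: "?A \<inter> ?B \<inter> - {z} = {}"
  proof (rule ccontr)
    assume "?A \<inter> ?B \<inter> - {z} \<noteq> {}"
    then obtain x T T' where x: "T \<in> X" "x \<in> tangent_cone T" "T' \<in> star - X" "x \<in> tangent_cone T'" "x \<noteq> z" by blast
    have T: "T \<in> star" "T' \<in> star" using x X by auto
    have "eventually (\<lambda>t. 0 < t \<and> z + t *\<^sub>R (x - z) \<in> T \<and> z + t *\<^sub>R (x - z) \<in> T') (at_right 0)"
      using eventually_cone_element[OF T(1) x(2)] eventually_cone_element[OF T(2) x(4)]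
        eventually_at_right_less[of "0::real"]
      by eventually_elim simp
    then obtain t where t: "0 < t" "z + t *\<^sub>R (x - z) \<in> T" "z + t *\<^sub>R (x - z) \<in> T'"
      using eventually_happens'[OF trivial_limit_at_right_real] by blast
    then have "z + t *\<^sub>R (x - z) \<noteq> z" using x(5) by simp
    then show False using no x(1,3) t by blast
  qed
  have ne: "\<Union>(tangent_cone ` Y) \<inter> - {z} \<noteq> {}" if Y: "T \<in> Y" "T \<in> star" for T Y
  proof -
    obtain x where "x \<in> T" "x \<noteq> z" using element_has_other_point[OF Y(2)] by blast
    then have "x \<in> tangent_cone T" "x \<in> - {z}" using element_subset_cone[OF Y(2)] by auto
    then show ?thesis using Y(1) by blast
  qed
  obtain T T' where "T \<in> X" "T \<in> star" "T' \<in> star - X" "T' \<in> star" using X by blast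
  then show False
    using connected_closedD[OF conn disj cov cl] ne[of T X] ne[of T' "star - X"] by blast
qed

text \<open>The set of elements comparable to \<open>T'\<close> with factor
  \<open>\<sigma> ^ k\<close> gains at least one member per step, by \<open>star_connected\<close>
  and \<open>adjacent_diameter\<close>, until it exhausts the star; \<open>card star\<close> steps
  suffice. A punctured line is disconnected, so in dimension one the bound comes from shape
  regularity.\<close>

lemma comparable_diameter:
  assumes T: "T \<in> star" and T': "T' \<in> star"
  shows "diameter T \<le> \<sigma> ^ card star * diameter T'"
proof (cases "CARD('n) = 1")
  case True
  have "T \<inter> T' \<noteq> {}" using star_node T T' by blast
  then have "diameter T \<le> \<sigma> * diameter T'" using dim_1[OF True] T T' star_mesh by blast
  also have "\<dots> \<le> \<sigma> ^ card star * diameter T'"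
  proof (rule mult_right_mono)
    have "1 \<le> card star" using finite_star T by (simp add: Suc_le_eq card_gt_0_iff) blast
    then show "\<sigma> \<le> \<sigma> ^ card star" using sigma power_increasing[of 1 "card star" \<sigma>] by simp
  qed (use element_diameter_pos[OF star_mesh[OF T']] in simp)
  finally show ?thesis .
next
  case False
  have n: "2 \<le> CARD('n)"
  proof -
    have "0 < CARD('n)" by simp
    with False show ?thesis by linarith
  qed
  define X where "X k = {T \<in> star. diameter T \<le> \<sigma> ^ k * diameter T'}" for k
  have fin: "finite (X k)" for k unfolding X_def using finite_star by simp
  have D': "0 < diameter T'" by (rule element_diameter_pos[OF star_mesh[OF T']])
  have grow: "X k \<subseteq> X (Suc k)" for k
  proof -
    have "\<sigma> ^ k * diameter T' \<le> \<sigma> ^ Suc k * diameter T'"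
      using sigma D' by (intro mult_right_mono power_increasing) auto
    then show ?thesis unfolding X_def using order_trans by blast
  qed
  have T'X: "T' \<in> X k" for k
    unfolding X_def using T' sigma D' by (simp add: mult_le_cancel_right1 one_le_power)
  have "X k = star \<or> k + 1 \<le> card (X k)" for k
  proof (induction k)
    case 0
    have "X 0 \<noteq> {}" using T'X by blast
    then show ?case using fin by (simp add: Suc_le_eq card_gt_0_iff)
  next
    case (Suc k)
    show ?case
    proof (cases "X k = star")
      case True
      then have "X (Suc k) = star" using grow[of k] unfolding X_def by blast
      then show ?thesis ..
    next
      case False
      have "X k \<subseteq> star" "X k \<noteq> {}" using T'X by (auto simp: X_def)
      from star_connected[OF n this False] obtain T1 T2 x
        where x: "T1 \<in> X k" "T2 \<in> star - X k" "x \<in> T1" "x \<in> T2" "x \<noteq> z" by blast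
      have "diameter T2 \<le> \<sigma> * diameter T1"
        by (rule adjacent_diameter[of T2 T1 x]) (use x in \<open>auto simp: X_def\<close>)
      also have "\<dots> \<le> \<sigma> * (\<sigma> ^ k * diameter T')"
        using x(1) sigma by (intro mult_left_mono) (auto simp: X_def)
      finally have "T2 \<in> X (Suc k)" using x(2) by (simp add: X_def mult.assoc)
      then have "X k \<subset> X (Suc k)" using grow[of k] x(2) by blast
      then have "card (X k) < card (X (Suc k))" by (rule psubset_card_mono[OF fin])
      with Suc False show ?thesis by simp
    qed
  qed
  from this[of "card star"] have "X (card star) = star"
  proof
    assume "card star + 1 \<le> card (X (card star))"
    moreover have "card (X (card star)) \<le> card star"
      by (rule card_mono[OF finite_star]) (auto simp: X_def)
    ultimately show ?thesis by simp
  qed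
  then show ?thesis using T unfolding X_def by blast
qed

text \<open>The exponent \<open>card star\<close> is replaced by \<open>N\<close> to make the radius
  independent of the mesh; the additional 1 gives the strict inequality for the open ball.\<close>

lemma patch_subset_ball:
  assumes N: "(4 * \<sigma>) ^ CARD('n) \<le> real N"
  shows "P \<subseteq> ball z ((\<sigma> ^ N + 1) * h)"
proof
  fix x assume "x \<in> P"
  then obtain T where T: "T \<in> star" "x \<in> T" unfolding P_eq by blast
  obtain T' where T': "T' \<in> star" "h = diameter T'" using h_attained by blast
  have "dist z x \<le> diameter T"
    by (intro diameter_bounded_bound compact_imp_bounded element_compact star_mesh star_node T)
  also have "\<dots> \<le> \<sigma> ^ card star * h" using comparable_diameter[OF T(1) T'(1)] T'(2) by simp
  also have "\<dots> \<le> \<sigma> ^ N * h"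
  proof (intro mult_right_mono power_increasing)
    have "real (card star) \<le> real N" using card_star_le N by linarith
    then show "card star \<le> N" by simp
  qed (use sigma h_pos in auto)
  also have "\<dots> < (\<sigma> ^ N + 1) * h" using h_pos by (simp add: distrib_right)
  finally show "x \<in> ball z ((\<sigma> ^ N + 1) * h)" by simp
qed

text \<open>The frontier of a finite union lies in the union of the frontiers, and frontiers of
  convex sets are null sets.\<close>

lemma negligible_patch_boundary: "negligible (P - interior P)"
proof -
  have "negligible (\<Union>(frontier ` star))"
    using finite_star element_convex star_mesh
    by (intro negligible_Union) (auto intro: negligible_convex_frontier)
  moreover have "P - interior P \<subseteq> frontier P"
    using closure_subset unfolding frontier_def by blast
  moreover have "frontier P \<subseteq> \<Union>(frontier ` star)"
    unfolding P_eq by (rule frontier_Union_subset[OF finite_star])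
  ultimately show ?thesis by (meson negligible_subset order_trans)
qed

end

section \<open>The estimate on patches\<close>

lemma integral_scaled_kernel:
  fixes \<psi> :: "real ^ 'n::finite \<Rightarrow> real"
  assumes psi: "\<psi> \<in> borel_measurable borel" "(\<integral>x. \<psi> x \<partial>lborel) = 1" and h: "0 < h"
  shows "(\<integral>x. scaled_kernel m \<psi> h z x \<partial>lborel) = 1"
proof -
  let ?a = "real (m + 1) / h"
  have a: "0 < ?a" using h by simp
  have "(\<integral>x. \<psi> x \<partial>lborel) = \<bar>- ?a\<bar> ^ DIM(real ^ 'n) * (\<integral>x. \<psi> (?a *\<^sub>R z + (- ?a) *\<^sub>R x) \<partial>lborel)"
    by (rule integral_lborel_affine[OF psi(1)]) (use a h in simp)
  also have "\<bar>- ?a\<bar> ^ DIM(real ^ 'n) = real (m + 1) ^ CARD('n) / h ^ CARD('n)"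
    using h by (simp add: power_divide)
  also have "\<dots> * (\<integral>x. \<psi> (?a *\<^sub>R z + (- ?a) *\<^sub>R x) \<partial>lborel) = (\<integral>x. scaled_kernel m \<psi> h z x \<partial>lborel)"
    unfolding scaled_kernel_def integral_mult_right_zero[symmetric] by (simp add: scaleR_diff_right)
  finally show ?thesis using psi(2) by simp
qed

theorem corollary4p5:
  fixes p \<sigma> r :: real and m :: nat and \<psi> :: "real ^ 'n::finite \<Rightarrow> real"
  assumes "1 < p" and "1 < \<sigma>"
    and "smooth \<psi>" and "supp \<psi> \<subseteq> cball 0 r" and "(LINT x|lebesgue. \<psi> x) = 1"
  shows "\<exists>C :: real \<Rightarrow> real.
    \<forall>(\<Omega> :: (real ^ 'n) set) (TT :: (real ^ 'n) set set set) (\<omega> :: real ^ 'n \<Rightarrow> real)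
      (\<T> :: (real ^ 'n) set set) (z :: real ^ 'n) (v :: real ^ 'n \<Rightarrow> real) (k :: nat).
      polyhedral_lipschitz_domain \<Omega> \<longrightarrow>
      shape_regular_family \<sigma> \<Omega> TT \<longrightarrow>
      (\<forall>\<T>'\<in>TT. \<forall>z'\<in>interior_nodes m \<Omega> \<T>'.
         supp (scaled_kernel m \<psi> (node_size \<T>' z') z') \<subseteq> patch \<T>' z') \<longrightarrow>
      Ap_weight p \<omega> \<longrightarrow>
      \<T> \<in> TT \<longrightarrow>
      z \<in> interior_nodes m \<Omega> \<T> \<longrightarrow>
      v \<in> weighted_sobolev (m + 1) p \<omega> (interior (patch \<T> z)) \<longrightarrow>
      k \<le> m + 1 \<longrightarrow>
      weighted_seminorm k p \<omega> (interior (patch \<T> z)) (\<lambda>y. v y - averaged_taylor m \<psi> \<T> z v y)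
        \<le> C (Ap_const p \<omega>) * node_size \<T> z ^ (m + 1 - k) *
          weighted_seminorm (m + 1) p \<omega> (interior (patch \<T> z)) v"
proof -
  let ?l = "max 1 m"
  \<comment> \<open>An integer above the packing bound of \<open>card_star_le\<close>. Below,
    \<open>c\<close> is the halved radius of \<open>interior_patch_star_shaped\<close> and
    \<open>C\<close> the radius of \<open>patch_subset_ball\<close>, both in units of
    \<open>h\<close>.\<close>
  define N where "N = nat \<lceil>(4 * \<sigma>) ^ CARD('n)\<rceil>"
  define c where "c = 1 / (2 * real ?l * \<sigma>)"
  define C where "C = \<sigma> ^ N + 1"
  have N: "(4 * \<sigma>) ^ CARD('n) \<le> real N" unfolding N_def by (rule real_nat_ceiling_ge)
  have l\<sigma>: "1 \<le> 2 * real ?l * \<sigma>"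
  proof -
    have "1 * 1 \<le> (2 * real ?l) * \<sigma>" using assms(2) by (intro mult_mono) auto
    then show ?thesis by simp
  qed
  have c: "0 < c" "c \<le> C"
  proof -
    have inv: "0 < 1 / q" "1 / q \<le> 1" if "1 \<le> q" for q :: real using that by simp_all
    show "0 < c" unfolding c_def by (rule inv(1)[OF l\<sigma>])
    have "c \<le> 1" unfolding c_def by (rule inv(2)[OF l\<sigma>])
    also have "1 \<le> C" using assms(2) by (simp add: C_def)
    finally show "c \<le> C" .
  qed
  have pc: "continuous_on UNIV \<psi>" by (rule smooth_continuous_on[OF assms(3)])
  then have [measurable]: "\<psi> \<in> borel_measurable borel" by (rule borel_measurable_continuous_onI)
  have int1: "(\<integral>x. \<psi> x \<partial>lborel) = 1" using assms(5) by (simp add: integral_completion)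
  \<comment> \<open>The sign of \<open>r\<close> is not prescribed; \<open>max r 1\<close> is a
    positive support radius.\<close>
  have zero: "\<psi> x = 0" if "max r 1 < norm x" for x
    by (rule zero_outside_supp) (use assms(4) that in auto)
  have r1: "0 < max r 1" by simp
  \<comment> \<open>\<open>K\<close> is fixed before the domain, the mesh, the node and the weight:
    besides \<open>n\<close>, \<open>p\<close>, \<open>m\<close> and \<psi> it depends only on
    \<open>c\<close> and \<open>C\<close>, and these come from \<open>n\<close>, \<open>m\<close>
    and \<sigma>.\<close>
  obtain K where K: "\<And>\<omega> S z h v k. Ap_weight p \<omega> \<Longrightarrow> open S \<Longrightarrow> S \<subseteq> ball z (C * h) \<Longrightarrow> 0 < h \<Longrightarrow>
    (\<forall>y\<in>S. \<forall>y'\<in>cball z (c * h). \<forall>t. 0 \<le> t \<and> t \<le> 1 \<longrightarrow> y + t *\<^sub>R (y' - y) \<in> S) \<Longrightarrow>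
    (LINT x:S|lebesgue. scaled_kernel m \<psi> h z x) = 1 \<Longrightarrow>
    v \<in> weighted_sobolev (m + 1) p \<omega> S \<Longrightarrow> k \<le> m + 1 \<Longrightarrow>
    weighted_seminorm k p \<omega> S (\<lambda>y. v y - (LINT x:S|lebesgue. taylor_poly m S v x y * scaled_kernel m \<psi> h z x))
      \<le> K (Ap_const p \<omega>) * h ^ (m + 1 - k) * weighted_seminorm (m + 1) p \<omega> S v"
    using averaged_taylor_estimate[where r = "max r 1" and m = m and \<psi> = \<psi>, OF assms(1,3) zero int1 r1 c]
    by blast
  show ?thesis
  proof (intro exI[of _ K] allI impI)
    fix \<Omega> :: "(real ^ 'n) set" and TT :: "(real ^ 'n) set set set" and \<omega> :: "real ^ 'n \<Rightarrow> real"
      and \<T> :: "(real ^ 'n) set set" and z :: "real ^ 'n" and v :: "real ^ 'n \<Rightarrow> real" and k :: nat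
    assume \<Omega>: "polyhedral_lipschitz_domain \<Omega>" and TT: "shape_regular_family \<sigma> \<Omega> TT"
      and supp: "\<forall>\<T>'\<in>TT. \<forall>z'\<in>interior_nodes m \<Omega> \<T>'.
         supp (scaled_kernel m \<psi> (node_size \<T>' z') z') \<subseteq> patch \<T>' z'"
      and \<omega>: "Ap_weight p \<omega>" and \<T>: "\<T> \<in> TT" and z: "z \<in> interior_nodes m \<Omega> \<T>"
      and v: "v \<in> weighted_sobolev (m + 1) p \<omega> (interior (patch \<T> z))" and k: "k \<le> m + 1"
    have conf: "conforming_mesh \<Omega> \<T>" using TT \<T> unfolding shape_regular_family_def by blast
    have "\<exists>\<Phi>. slab_rep \<Phi> T" if "T \<in> \<T>" for T
    proof -
      have "int CARD('n) simplex T \<or> n_rectangle T" using conf that unfolding conforming_mesh_def by blast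
      then show ?thesis using slab_rep_simplex[of T] slab_rep_rectangle[of T] by auto
    qed
    then obtain \<Phi> where \<Phi>: "\<And>T. T \<in> \<T> \<Longrightarrow> slab_rep (\<Phi> T) T" by metis
    interpret interior_node \<sigma> \<Omega> \<T> z m \<Phi>
    proof
      show "open \<Omega>" using \<Omega> by (simp add: polyhedral_lipschitz_domain_def)
      show "diameter T / inner_diameter T \<le> \<sigma>" if "T \<in> \<T>" for T
        using TT \<T> that unfolding shape_regular_family_def by blast
      show "diameter T \<le> \<sigma> * diameter T'" if "CARD('n) = 1" "T \<in> \<T>" "T' \<in> \<T>" "T \<inter> T' \<noteq> {}" for T T'
        using TT \<T> that unfolding shape_regular_family_def by blast
      show "z \<in> nodes m \<T>" "z \<notin> frontier \<Omega>" using z unfolding interior_nodes_def by auto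
    qed (use assms(2) conf \<Phi> in auto)
    let ?S = "interior P" and ?sk = "scaled_kernel m \<psi> h z"
    have [measurable]: "?sk \<in> borel_measurable borel" unfolding scaled_kernel_def by measurable
    \<comment> \<open>Restriction to the interior loses no mass: the kernel vanishes off the patch,
      whose remaining boundary points form a null set.\<close>
    have "(LINT x:?S|lebesgue. ?sk x) = (LINT x:UNIV|lebesgue. indicator ?S x * ?sk x)"
      by (simp add: set_lebesgue_integral_def)
    also have "\<dots> = (\<integral>x. ?sk x \<partial>lborel)"
    proof (rule LINT_rep)
      have "?sk x = 0" if "x \<notin> P" for x
        by (rule zero_outside_supp) (use supp \<T> z that in blast)
      then have "{x \<in> UNIV. indicator ?S x * ?sk x \<noteq> ?sk x} \<subseteq> P - ?S"
        by (auto simp: indicator_def split: if_splits)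
      then show "negligible {x \<in> UNIV. indicator ?S x * ?sk x \<noteq> ?sk x}"
        by (rule negligible_subset[OF negligible_patch_boundary])
    qed auto
    also have "\<dots> = 1" by (rule integral_scaled_kernel) (use int1 h_pos in auto)
    finally have one: "(LINT x:?S|lebesgue. ?sk x) = 1" .
    have sub: "?S \<subseteq> ball z (C * h)"
      using patch_subset_ball[OF N] interior_subset unfolding C_def by blast
    have star: "\<forall>y\<in>?S. \<forall>y'\<in>cball z (c * h). \<forall>t. 0 \<le> t \<and> t \<le> 1 \<longrightarrow> y + t *\<^sub>R (y' - y) \<in> ?S"
      unfolding c_def using interior_patch_star_shaped by blast
    show "weighted_seminorm k p \<omega> ?S (\<lambda>y. v y - averaged_taylor m \<psi> \<T> z v y)
        \<le> K (Ap_const p \<omega>) * h ^ (m + 1 - k) * weighted_seminorm (m + 1) p \<omega> ?S v"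
      unfolding averaged_taylor_def by (rule K[OF \<omega> open_interior sub h_pos star one v k])
  qed
qed

end
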